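(* Let $H_2\subset H_1$ be separable Hilbert spaces with a dense inclusion of $H_2$ into $H_1$. Let $U_1\subset H_1$ be open and $\phi\colon U_1\to H_1$ be tame. Assume in addition that $0\in U_1$ and $\phi(0)=0$. Let $$\mathcal U:=\{\xi\in W^{1,2}(\mathbb R,H_1)\cap L^2(\mathbb R,H_2)\mid \xi(s)\in U_1\ \forall s\in\mathbb R\}.$$ Then the map $$\Phi\colon\mathcal U\to W^{1,2}(\mathbb R,H_1)\cap L^2(\mathbb R,H_2),\qquad \xi\mapsto[s\mapsto\phi(\xi(s))],$$ is well defined and continuously differentiable.
   Context: Norms are $|\cdot|_1:=\|\cdot\|_{H_1}$, $|\cdot|_2:=\|\cdot\|_{H_2}$, normalized so that $|\cdot|_1\le|\cdot|_2$ on $H_2$. The inclusion $H_2\subset H_1$ is not assumed compact. For $U_1\subset H_1$ open and $U_2:=U_1\cap H_2$, a $C^2$ map $\phi\colon U_1\to H_1$ is *tame* if (i) $\phi(U_2)\subset H_2$ and $\phi|_{U_2}\colon U_2\to H_2$ is $C^2$; (ii) for every $x\in U_1$ there are an $H_1$-open neighborhood $W_x\subset U_1$ of $x$ and a constant $\kappa>0$ such that for all $y\in W_x\cap H_2$ and all $\xi,\eta\in H_2$: $|d^2\phi|_y(\xi,\eta)|_2\le\kappa\big(|\xi|_1|\eta|_2+|\xi|_2|\eta|_1+|y|_2|\xi|_1|\eta|_1\big)$. $W^{1,2}(\mathbb R,H_1)\cap L^2(\mathbb R,H_2)$ is a Hilbert space with inner product $\int_{\mathbb R}\langle\dot\xi,\dot\eta\rangle_{H_1}ds+\int_{\mathbb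 R}\langle\xi,\eta\rangle_{H_2}ds$. Elements of $W^{1,2}(\mathbb R,H_1)$ are identified with their continuous representatives. *)

theory Defs
  imports "HOL-Analysis.Analysis" "HOL-Library.Function_Algebras"
begin

(* The two Hilbert spaces are separate types 'h1 and 'h2, and "H2 is a subset of H1" is
   represented by an explicit inclusion map i from 'h2 to 'h1.  An element x of H1 lies
   in H2 iff x is in range i; inv i x is then x regarded as an element of H2. *)

definition dense_inclusion ::
  "('h2::real_inner \<Rightarrow> 'h1::real_inner) \<Rightarrow> bool" where
  "dense_inclusion i \<longleftrightarrow>
     linear i \<and> inj i \<and> closure (range i) = UNIV \<and> (\<forall>x. norm (i x) \<le> norm x)"


section \<open>Tame maps\<close>

definition C2_with ::
  "'a::real_normed_vector set \<Rightarrow> ('a \<Rightarrow> 'b::real_normed_vector) \<Rightarrow>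
   ('a \<Rightarrow> 'a \<Rightarrow>\<^sub>L 'b) \<Rightarrow> ('a \<Rightarrow> 'a \<Rightarrow>\<^sub>L 'a \<Rightarrow>\<^sub>L 'b) \<Rightarrow> bool" where
  "C2_with U f f' f'' \<longleftrightarrow>
     (\<forall>x\<in>U. (f has_derivative blinfun_apply (f' x)) (at x)) \<and>
     (\<forall>x\<in>U. (f' has_derivative blinfun_apply (f'' x)) (at x)) \<and>
     continuous_on U f''"

(* The map "\<lambda>y. inv i (\<phi> (i y))" is the restriction of \<phi> to a map from U2 to H2.
   Since U2 is open in H2, its second derivative f'' is unique on U2, and i (f'' y \<xi> \<eta>) is
   the second derivative of \<phi> at i y applied to i \<xi> and i \<eta>. *)

definition tame ::
  "('h2::real_inner \<Rightarrow> 'h1::real_inner) \<Rightarrow> 'h1 set \<Rightarrow> ('h1 \<Rightarrow> 'h1) \<Rightarrow> bool" where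
  "tame i U1 \<phi> \<longleftrightarrow>
     (\<exists>f' f''. C2_with U1 \<phi> f' f'') \<and>
     \<phi> ` (U1 \<inter> range i) \<subseteq> range i \<and>
     (\<exists>f' f''. C2_with (i -` U1) (\<lambda>y. inv i (\<phi> (i y))) f' f'' \<and>
       (\<forall>x\<in>U1. \<exists>W \<kappa>. open W \<and> x \<in> W \<and> W \<subseteq> U1 \<and> \<kappa> > 0 \<and>
         (\<forall>y \<xi> \<eta>. i y \<in> W \<longrightarrow>
           norm (blinfun_apply (blinfun_apply (f'' y) \<xi>) \<eta>) \<le>
             \<kappa> * (norm (i \<xi>) * norm \<eta> + norm \<xi> * norm (i \<eta>) +
                  norm y * norm (i \<xi>) * norm (i \<eta>)))))"


section \<open>The space $W^{1,2}(\mathbb R,H_1)\cap L^2(\mathbb R,H_2)$\<close>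

definition square_integrable ::
  "(real \<Rightarrow> 'a::{real_inner,complete_space,second_countable_topology}) \<Rightarrow> bool" where
  "square_integrable f \<longleftrightarrow>
     f \<in> borel_measurable lebesgue \<and> integrable lebesgue (\<lambda>s. (norm (f s))\<^sup>2)"

definition test_function :: "(real \<Rightarrow> real) \<Rightarrow> bool" where
  "test_function \<psi> \<longleftrightarrow>
     (\<forall>n. ((deriv ^^ n) \<psi>) differentiable_on UNIV) \<and> compact (closure {s. \<psi> s \<noteq> 0})"

definition weak_derivative ::
  "(real \<Rightarrow> 'a::{real_inner,complete_space,second_countable_topology}) \<Rightarrow>
   (real \<Rightarrow> 'a) \<Rightarrow> bool" where
  "weak_derivative f g \<longleftrightarrow>
     (\<forall>\<psi>. test_function \<psi> \<longrightarrow>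
        (LINT s|lebesgue. deriv \<psi> s *\<^sub>R f s) = - (LINT s|lebesgue. \<psi> s *\<^sub>R g s))"

(* Elements are represented by their continuous representatives. *)

definition W12 ::
  "(real \<Rightarrow> 'a::{real_inner,complete_space,second_countable_topology}) set" where
  "W12 = {f. continuous_on UNIV f \<and> square_integrable f \<and>
             (\<exists>g. square_integrable g \<and> weak_derivative f g)}"

(* Unique up to null sets. *)

definition wderiv ::
  "(real \<Rightarrow> 'a::{real_inner,complete_space,second_countable_topology}) \<Rightarrow> real \<Rightarrow> 'a" where
  "wderiv f = (SOME g. square_integrable g \<and> weak_derivative f g)"

(* A continuous function into H1 belongs to L^2(R,H2) if it takes values in H2 almost
   everywhere and is square integrable as a function into H2.  The junk values of inv i on
   the exceptional null set do not matter, because lebesgue is a complete measure. *)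

definition W12_L2 ::
  "('h2::{real_inner,complete_space,second_countable_topology} \<Rightarrow>
    'h1::{real_inner,complete_space,second_countable_topology}) \<Rightarrow> (real \<Rightarrow> 'h1) set" where
  "W12_L2 i = {\<xi> \<in> W12. (AE s in lebesgue. \<xi> s \<in> range i) \<and>
                         square_integrable (\<lambda>s. inv i (\<xi> s))}"

definition W12_L2_inner ::
  "('h2::{real_inner,complete_space,second_countable_topology} \<Rightarrow>
    'h1::{real_inner,complete_space,second_countable_topology}) \<Rightarrow>
   (real \<Rightarrow> 'h1) \<Rightarrow> (real \<Rightarrow> 'h1) \<Rightarrow> real" where
  "W12_L2_inner i \<xi> \<eta> =
     (LINT s|lebesgue. wderiv \<xi> s \<bullet> wderiv \<eta> s) +
     (LINT s|lebesgue. inv i (\<xi> s) \<bullet> inv i (\<eta> s))"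

definition W12_L2_norm ::
  "('h2::{real_inner,complete_space,second_countable_topology} \<Rightarrow>
    'h1::{real_inner,complete_space,second_countable_topology}) \<Rightarrow> (real \<Rightarrow> 'h1) \<Rightarrow> real" where
  "W12_L2_norm i \<xi> = sqrt (W12_L2_inner i \<xi> \<xi>)"


section \<open>Continuous differentiability on spaces of functions\<close>

(* The space W12_L2 i depends on the term i, so it cannot be made a type carrying a norm, and
   has_derivative does not apply.  The following definitions spell out Frechet
   differentiability for a linear space E of functions with norm N. *)

definition bounded_linear_on ::
  "('s \<Rightarrow> 'a::real_vector) set \<Rightarrow> (('s \<Rightarrow> 'a) \<Rightarrow> real) \<Rightarrow>
   (('s \<Rightarrow> 'a) \<Rightarrow> ('s \<Rightarrow> 'a)) \<Rightarrow> bool" where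
  "bounded_linear_on E N T \<longleftrightarrow>
     (\<forall>h\<in>E. T h \<in> E) \<and>
     (\<forall>h\<in>E. \<forall>k\<in>E. T (h + k) = T h + T k) \<and>
     (\<forall>c. \<forall>h\<in>E. T (\<lambda>s. c *\<^sub>R h s) = (\<lambda>s. c *\<^sub>R T h s)) \<and>
     (\<exists>K. \<forall>h\<in>E. N (T h) \<le> K * N h)"

definition frechet_derivative_on ::
  "('s \<Rightarrow> 'a::real_vector) set \<Rightarrow> (('s \<Rightarrow> 'a) \<Rightarrow> real) \<Rightarrow>
   (('s \<Rightarrow> 'a) \<Rightarrow> ('s \<Rightarrow> 'a)) \<Rightarrow> (('s \<Rightarrow> 'a) \<Rightarrow> ('s \<Rightarrow> 'a)) \<Rightarrow>
   ('s \<Rightarrow> 'a) \<Rightarrow> bool" where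
  "frechet_derivative_on E N F T \<xi> \<longleftrightarrow>
     bounded_linear_on E N T \<and>
     (\<forall>e>0. \<exists>d>0. \<forall>h\<in>E. N h < d \<longrightarrow> N (F (\<xi> + h) - F \<xi> - T h) \<le> e * N h)"

definition open_subset_of ::
  "('s \<Rightarrow> 'a::real_vector) set \<Rightarrow> (('s \<Rightarrow> 'a) \<Rightarrow> real) \<Rightarrow> ('s \<Rightarrow> 'a) set \<Rightarrow> bool" where
  "open_subset_of E N U \<longleftrightarrow>
     U \<subseteq> E \<and> (\<forall>\<xi>\<in>U. \<exists>d>0. \<forall>\<eta>\<in>E. N (\<eta> - \<xi>) < d \<longrightarrow> \<eta> \<in> U)"

(* The last clause is continuity of dF in the operator norm. *)

definition continuously_differentiable_on ::
  "('s \<Rightarrow> 'a::real_vector) set \<Rightarrow> (('s \<Rightarrow> 'a) \<Rightarrow> real) \<Rightarrow> ('s \<Rightarrow> 'a) set \<Rightarrow>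
   (('s \<Rightarrow> 'a) \<Rightarrow> ('s \<Rightarrow> 'a)) \<Rightarrow> bool" where
  "continuously_differentiable_on E N U F \<longleftrightarrow>
     open_subset_of E N U \<and>
     (\<exists>dF. (\<forall>\<xi>\<in>U. frechet_derivative_on E N F (dF \<xi>) \<xi>) \<and>
       (\<forall>\<xi>\<in>U. \<forall>e>0. \<exists>d>0. \<forall>\<eta>\<in>U. N (\<eta> - \<xi>) < d \<longrightarrow>
          (\<forall>h\<in>E. N (dF \<eta> h - dF \<xi> h) \<le> e * N h)))"

end

theory Submission
  imports Defs
begin

text \<open>
  Functions in \<open>W\<^sup>1\<^sup>,\<^sup>2(H\<^sub>1) \<inter> L\<^sup>2(H\<^sub>2)\<close> are exactly the continuous primitives of square integrable functions
  that are also square integrable into \<open>H\<^sub>2\<close>. They vanish at infinity and their supremum norm in \<open>H\<^sub>1\<close> is at most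
  twice the norm of the space. Since \<open>0 \<in> U\<^sub>1\<close>, the image of \<open>\<xi>\<close> together with \<open>0\<close> is
  therefore a compact subset of \<open>U\<^sub>1\<close>, and tameness together with the \<open>C\<^sup>2\<close> bounds on \<open>\<phi>\<close> holds with uniform constants on an \<open>H\<^sub>1\<close>-neighbourhood of it.
  Integrating the tame estimate from a point of the dense subspace \<open>H\<^sub>2\<close> gives
  \<open>|\<phi>(y)|\<^sub>2 \<le> C |y|\<^sub>2\<close> and \<open>|d\<phi>(y) \<eta>|\<^sub>2 \<le> C (|\<eta>|\<^sub>2 + |y|\<^sub>2 |\<eta>|\<^sub>1)\<close>.
  The derivative is \<open>(d\<Phi>(\<xi>) h)(s) = d\<phi>(\<xi>(s)) h(s)\<close>. Every term in the remainder and in the increment of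
  \<open>d\<Phi>\<close> is linear in one factor measured in \<open>H\<^sub>2\<close> or in a weak derivative, and only this factor is
  estimated in \<open>L\<^sup>2\<close>; all others enter through their \<open>H\<^sub>1\<close> supremum norms.
\<close>

section \<open>Integrals and primitives\<close>

text \<open>The obstacle is that a curve \<open>\<xi>\<close> in the space has no pointwise bound in
  H2: its values need not stay in any ball of H2, nor lie in H2 for every \<open>s\<close>.
  Continuity of derivatives in the topology of H2 thus yields no constants uniform along the curve.
  The tame estimate does, since it holds on H1-open sets and each of its three summands contains
  exactly one H2 norm. The two components of the norm need different arguments. In L2(R,H2) the
  remainder is quadratic by the tame estimate. The weak derivative of
  \<open>d\<phi> (\<xi> s) (h s)\<close> contains \<open>dd\<phi> (\<xi> s) (g s) (h s)\<close>,
  where the weak derivative \<open>g\<close> of \<open>\<xi>\<close> need not be bounded; here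
  smallness comes from uniform continuity of \<open>dd\<phi>\<close> near a compact set. Weak
  derivatives are traded for increments given by integrals, because the chain rule can then be
  proved on short intervals, without pointwise differentiability of the curve.\<close>

text \<open>The library's criterion needs the class \<open>banach\<close>, which the sort
  \<open>{real_inner, complete_space, second_countable_topology}\<close> does not imply.\<close>

lemma integrable_dominated:
  fixes f :: "'a \<Rightarrow> 'b::{real_normed_vector,complete_space,second_countable_topology}"
  assumes f[measurable]: "f \<in> borel_measurable M"
    and h: "integrable M (h :: 'a \<Rightarrow> real)"
    and le: "AE x in M. norm (f x) \<le> h x"
  shows "integrable M f"
proof -
  obtain s where s: "\<And>n. simple_function M (s n)"
    and lim: "\<And>x. x \<in> space M \<Longrightarrow> (\<lambda>n. s n x) \<longlonglongrightarrow> f x"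
    and bd: "\<And>n x. x \<in> space M \<Longrightarrow> norm (s n x) \<le> 2 * norm (f x)"
    using borel_measurable_implies_sequence_metric[OF f, of 0] by simp metis
  have h_fin: "(\<integral>\<^sup>+x. ennreal (norm (h x)) \<partial>M) < \<infinity>"
    using h unfolding integrable_iff_bounded by blast
  have "(\<integral>\<^sup>+x. ennreal (2 * norm (f x)) \<partial>M) \<le> (\<integral>\<^sup>+x. 2 * ennreal (norm (h x)) \<partial>M)"
    using le by (intro nn_integral_mono_AE) (auto elim!: eventually_mono
        simp: numeral_mult_ennreal intro!: ennreal_leI)
  also have "\<dots> < \<infinity>"
    using h_fin h by (subst nn_integral_cmult) (auto simp: ennreal_mult_less_top)
  finally have fin: "(\<integral>\<^sup>+x. ennreal (2 * norm (f x)) \<partial>M) < \<infinity>" .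
  have sb: "Bochner_Integration.simple_bochner_integrable M (s n)" for n
  proof (rule simple_bochner_integrableI_bounded)
    show "simple_function M (s n)" by (rule s)
    have "(\<integral>\<^sup>+x. norm (s n x) \<partial>M) \<le> (\<integral>\<^sup>+x. ennreal (2 * norm (f x)) \<partial>M)"
      by (intro nn_integral_mono) (simp add: bd)
    then show "(\<integral>\<^sup>+x. norm (s n x) \<partial>M) < \<infinity>"
      using fin by (rule le_less_trans)
  qed
  let ?d = "\<lambda>n. \<integral>\<^sup>+x. ennreal (norm (f x - s n x)) \<partial>M"
  let ?I = "\<lambda>n. Bochner_Integration.simple_bochner_integral M (s n)"
  have d: "?d \<longlonglongrightarrow> 0"
    by (rule nn_integral_dominated_convergence_norm[where w="\<lambda>x. 2 * norm (f x)"])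
      (use s bd lim fin in \<open>auto intro: borel_measurable_simple_function\<close>)
  have "Cauchy ?I"
  proof (rule metric_CauchyI)
    fix e :: real assume "e > 0"
    then obtain N where N: "\<And>n. n \<ge> N \<Longrightarrow> ?d n < ennreal (e / 2)"
      using order_tendstoD(2)[OF d, of "ennreal (e / 2)"] by (auto simp: eventually_sequentially)
    have "dist (?I m) (?I n) < e" if "m \<ge> N" "n \<ge> N" for m n
    proof -
      have "ennreal (dist (?I m) (?I n)) \<le> ?d m + ?d n"
        unfolding dist_norm by (rule simple_bochner_integral_bounded[OF f sb sb])
      also have "\<dots> < ennreal (e / 2) + ennreal (e / 2)"
        by (intro add_strict_mono N that)
      also have "\<dots> = ennreal e"
        using \<open>e > 0\<close> by (simp flip: ennreal_plus)
      finally show ?thesis by (simp add: ennreal_less_iff)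
    qed
    then show "\<exists>N. \<forall>m\<ge>N. \<forall>n\<ge>N. dist (?I m) (?I n) < e" by blast
  qed
  then obtain L where "?I \<longlonglongrightarrow> L"
    using Cauchy_convergent convergent_def by blast
  then show ?thesis
    using has_bochner_integral.intros[OF f sb d] by (auto intro: integrable.intros)
qed

lemma norm_integral_le:
  fixes f :: "'a \<Rightarrow> 'b::{real_normed_vector,second_countable_topology}"
  assumes "integrable M f" "integrable M h" "AE x in M. norm (f x) \<le> h x"
  shows "norm (integral\<^sup>L M f) \<le> integral\<^sup>L M h"
proof -
  have nonneg: "AE x in M. 0 \<le> h x"
    using assms(3) by eventually_elim (rule order_trans[OF norm_ge_zero])
  have "ennreal (norm (integral\<^sup>L M f)) \<le> (\<integral>\<^sup>+x. norm (f x) \<partial>M)"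
    using assms(1) by (rule integral_norm_bound_ennreal)
  also have "\<dots> \<le> (\<integral>\<^sup>+x. ennreal (h x) \<partial>M)"
    using assms(3) by (intro nn_integral_mono_AE) (auto elim!: eventually_mono intro!: ennreal_leI)
  also have "\<dots> = ennreal (integral\<^sup>L M h)"
    by (rule nn_integral_eq_integral[OF assms(2) nonneg])
  finally show ?thesis
    using integral_nonneg_AE[OF nonneg] by simp
qed

text \<open>\<open>f\<close> is locally absolutely continuous with density \<open>g\<close>, encoded
  by increments so that no base point has to be chosen. Half-open intervals concatenate without
  overlap, and \<open>{s<..t}\<close> is empty for \<open>t \<le> s\<close>, so integrability can be
  asked for all \<open>s\<close> and \<open>t\<close>.\<close>

definition primitive ::
  "(real \<Rightarrow> 'a::{real_normed_vector,second_countable_topology}) \<Rightarrow> (real \<Rightarrow> 'a) \<Rightarrow> bool" where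
  "primitive f g \<longleftrightarrow> g \<in> borel_measurable lebesgue \<and>
     (\<forall>s t. set_integrable lebesgue {s<..t} g) \<and>
     (\<forall>s t. s \<le> t \<longrightarrow> f t - f s = (LINT x:{s<..t}|lebesgue. g x))"

lemma set_integral_Ioc_split:
  fixes g :: "real \<Rightarrow> 'a::{real_normed_vector,second_countable_topology}"
  assumes "set_integrable lebesgue {s<..t} g" "set_integrable lebesgue {t<..u} g" "s \<le> t" "t \<le> u"
  shows "(LINT x:{s<..u}|lebesgue. g x) = (LINT x:{s<..t}|lebesgue. g x) + (LINT x:{t<..u}|lebesgue. g x)"
proof -
  have "(LINT x:{s<..u}|lebesgue. g x)
      = (LINT x|lebesgue. indicator {s<..t} x *\<^sub>R g x + indicator {t<..u} x *\<^sub>R g x)"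
    unfolding set_lebesgue_integral_def using assms(3,4)
    by (intro Bochner_Integration.integral_cong) (auto simp: indicator_def)
  then show ?thesis
    using assms(1,2) unfolding set_integrable_def set_lebesgue_integral_def by simp
qed

lemma set_integrable_Ioc_dominated:
  fixes f :: "real \<Rightarrow> 'b::{real_normed_vector,complete_space,second_countable_topology}"
  assumes [measurable]: "f \<in> borel_measurable lebesgue"
    and h: "set_integrable lebesgue {s<..t} (h :: real \<Rightarrow> real)"
    and le: "\<And>x. s < x \<Longrightarrow> x \<le> t \<Longrightarrow> norm (f x) \<le> h x"
  shows "set_integrable lebesgue {s<..t} f"
  unfolding set_integrable_def
proof (rule integrable_dominated)
  show "(\<lambda>x. indicator {s<..t} x *\<^sub>R f x) \<in> borel_measurable lebesgue"
    by (intro borel_measurable_scaleR borel_measurable_indicator) auto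
  show "integrable lebesgue (\<lambda>x. indicator {s<..t} x *\<^sub>R h x)"
    using h by (simp add: set_integrable_def)
qed (use le in \<open>auto simp: indicator_def\<close>)

lemma norm_set_integral_Ioc_le:
  fixes f :: "real \<Rightarrow> 'b::{real_normed_vector,second_countable_topology}"
  assumes "set_integrable lebesgue {s<..t} f" "set_integrable lebesgue {s<..t} h"
    and "\<And>x. s < x \<Longrightarrow> x \<le> t \<Longrightarrow> norm (f x) \<le> h x"
  shows "norm (LINT x:{s<..t}|lebesgue. f x) \<le> (LINT x:{s<..t}|lebesgue. h x)"
  unfolding set_lebesgue_integral_def
  by (rule norm_integral_le) (use assms in \<open>auto simp: set_integrable_def indicator_def\<close>)

lemma set_integrable_norm_Ioc:
  fixes f :: "real \<Rightarrow> 'b::{real_normed_vector,second_countable_topology}"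
  assumes "set_integrable lebesgue {s<..t} f"
  shows "set_integrable lebesgue {s<..t} (\<lambda>x. norm (f x))"
proof -
  let ?F = "\<lambda>x. indicator {s<..t} x *\<^sub>R f x"
  obtain x where x: "has_bochner_integral lebesgue ?F x"
    using assms by (auto simp: set_integrable_def integrable.simps)
  have "(\<lambda>x. norm (?F x)) \<in> borel_measurable lebesgue"
    using borel_measurable_has_bochner_integral[OF x] by (rule measurable_compose) simp
  then have "integrable lebesgue (\<lambda>x. norm (?F x))"
    using has_bochner_integral_implies_finite_norm[OF x] unfolding integrable_iff_bounded by simp
  then show ?thesis by (simp add: set_integrable_def)
qed

text \<open>Uniform smallness on short intervals propagates to long ones by bisection.\<close>

lemma additive_interval_function_zero:
  fixes Q :: "real \<Rightarrow> real \<Rightarrow> 'a::real_normed_vector" and m :: "real \<Rightarrow> real"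
  assumes add: "\<And>s t u. a \<le> s \<Longrightarrow> s \<le> t \<Longrightarrow> t \<le> u \<Longrightarrow> u \<le> b \<Longrightarrow> Q s u = Q s t + Q t u"
    and small: "\<And>e. e > 0 \<Longrightarrow> \<exists>d>0. \<forall>s t. a \<le> s \<longrightarrow> s \<le> t \<longrightarrow> t \<le> b \<longrightarrow> t - s < d \<longrightarrow>
                  norm (Q s t) \<le> e * (m t - m s)"
    and "a \<le> b"
  shows "Q a b = 0"
proof -
  have bd: "norm (Q a b) \<le> e * (m b - m a)" if e: "e > 0" for e
  proof -
    obtain d where "d > 0" and d: "\<And>s t. a \<le> s \<Longrightarrow> s \<le> t \<Longrightarrow> t \<le> b \<Longrightarrow> t - s < d \<Longrightarrow>
                  norm (Q s t) \<le> e * (m t - m s)"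
      using small[OF e] by blast
    have ind: "norm (Q s t) \<le> e * (m t - m s)"
      if "a \<le> s" "s \<le> t" "t \<le> b" "t - s < 2 ^ n * d" for n s t
      using that
    proof (induction n arbitrary: s t)
      case 0
      then show ?case using d by simp
    next
      case (Suc n)
      define r where "r = (s + t) / 2"
      have r: "s \<le> r" "r \<le> t" "r - s < 2 ^ n * d" "t - r < 2 ^ n * d"
        using Suc.prems by (auto simp: r_def field_simps)
      have "norm (Q s t) \<le> norm (Q s r) + norm (Q r t)"
        using add[of s r t] Suc.prems r norm_triangle_ineq by metis
      also have "\<dots> \<le> e * (m r - m s) + e * (m t - m r)"
        using Suc.IH[of s r] Suc.IH[of r t] Suc.prems r by linarith
      finally show ?case by (simp add: algebra_simps)
    qed
    obtain n where "(b - a) / d < 2 ^ n"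
      using real_arch_pow[of 2 "(b - a) / d"] by auto
    then show ?thesis
      using ind[of a b n] \<open>d > 0\<close> \<open>a \<le> b\<close> by (simp add: field_simps)
  qed
  have "norm (Q a b) \<le> e" if "e > 0" for e
  proof -
    define M where "M = \<bar>m b - m a\<bar> + 1"
    have "M > 0" by (simp add: M_def)
    have "norm (Q a b) \<le> (e / M) * (m b - m a)"
      using bd[of "e / M"] that \<open>M > 0\<close> by simp
    also have "\<dots> \<le> (e / M) * M"
      using that \<open>M > 0\<close> by (intro mult_left_mono) (auto simp: M_def)
    finally show ?thesis using \<open>M > 0\<close> by simp
  qed
  then show ?thesis
    using field_le_epsilon[of "norm (Q a b)" 0] by simp
qed

section \<open>Calculus in normed spaces and the chain rule for primitives\<close>

text \<open>Restriction to the segment reduces this to one real variable. Only the values of the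
  derivative in the direction \<open>k\<close> are bounded, not its operator norm, because the tame
  estimate controls such values by products of H1 and H2 norms.\<close>

lemma norm_increment_le:
  fixes g :: "'a::real_normed_vector \<Rightarrow> 'b::real_normed_vector"
  assumes der: "\<And>t. 0 \<le> t \<Longrightarrow> t \<le> 1 \<Longrightarrow> (g has_derivative g' t) (at (y + t *\<^sub>R k))"
    and bd: "\<And>t. 0 \<le> t \<Longrightarrow> t \<le> 1 \<Longrightarrow> norm (g' t k) \<le> B"
  shows "norm (g (y + k) - g y) \<le> B"
proof -
  let ?f = "\<lambda>t. g (y + t *\<^sub>R k)"
  have "norm (?f 1 - ?f 0) \<le> B * norm (1 - 0 :: real)"
  proof (rule differentiable_bound[where S="{0..1}" and f'="\<lambda>t s. g' t (s *\<^sub>R k)"])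
    fix t :: real assume t: "t \<in> {0..1}"
    have l: "bounded_linear (g' t)"
      using der[of t] t by (auto intro: has_derivative_bounded_linear)
    have line: "((\<lambda>t. y + t *\<^sub>R k) has_derivative (\<lambda>s. s *\<^sub>R k)) (at t within {0..1})"
      by (auto intro!: derivative_eq_intros)
    show "(?f has_derivative (\<lambda>s. g' t (s *\<^sub>R k))) (at t within {0..1})"
      using has_derivative_compose[OF line der[of t]] t by simp
    show "onorm (\<lambda>s. g' t (s *\<^sub>R k)) \<le> B"
    proof (rule onorm_le)
      fix s :: real
      have "norm (g' t (s *\<^sub>R k)) = \<bar>s\<bar> * norm (g' t k)"
        by (simp add: linear_simps(5)[OF l])
      also have "\<dots> \<le> B * \<bar>s\<bar>"
        using bd[of t] t mult_left_mono[of "norm (g' t k)" B "\<bar>s\<bar>"] by (simp add: mult.commute)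
      finally show "norm (g' t (s *\<^sub>R k)) \<le> B * norm s" by simp
    qed
  qed auto
  then show ?thesis by simp
qed

lemma has_derivative_diff_blinfun:
  assumes "(f has_derivative f') F"
  shows "((\<lambda>x. f x - blinfun_apply L x) has_derivative (\<lambda>v. f' v - blinfun_apply L v)) F"
  by (rule has_derivative_diff[OF assms bounded_linear.has_derivative[OF blinfun.bounded_linear_right has_derivative_ident]])

text \<open>The mean value inequality is applied twice: to \<open>f'\<close> in the direction
  \<open>k\<close>, then to the difference \<open>f (w + k) - f w\<close> in the direction
  \<open>h\<close>, each time after subtracting the expected linear term.\<close>

lemma second_difference_bound:
  fixes f :: "'a::real_normed_vector \<Rightarrow> 'b::real_normed_vector"
  assumes f': "\<And>z. z \<in> ball x r \<Longrightarrow> (f has_derivative blinfun_apply (f' z)) (at z)"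
    and f'': "\<And>z. z \<in> ball x r \<Longrightarrow> (f' has_derivative blinfun_apply (f'' z)) (at z)"
    and close: "\<And>z. z \<in> ball x r \<Longrightarrow> norm (f'' z - f'' x) \<le> e"
    and small: "norm h + norm k < r"
  shows "norm (f (x + h + k) - f (x + h) - f (x + k) + f x - f'' x k h) \<le> e * norm h * norm k"
proof -
  have in_ball: "x + t *\<^sub>R h + s *\<^sub>R k \<in> ball x r" if "0 \<le> t" "t \<le> 1" "0 \<le> s" "s \<le> 1" for s t
  proof -
    have "norm (t *\<^sub>R h + s *\<^sub>R k) \<le> norm (t *\<^sub>R h) + norm (s *\<^sub>R k)" by (rule norm_triangle_ineq)
    also have "\<dots> \<le> norm h + norm k"
      using that by (intro add_mono) (auto intro: mult_left_le_one_le)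
    finally show ?thesis
      using small norm_minus_cancel[of "t *\<^sub>R h + s *\<^sub>R k"] by (simp add: dist_norm add.assoc)
  qed
  have first: "norm (f' (w + k) - f' w - f'' x k) \<le> e * norm k"
    if w: "w = x + t *\<^sub>R h" "0 \<le> t" "t \<le> 1" for w t
  proof -
    let ?g = "\<lambda>z. f' z - f'' x z"
    have "norm (?g (w + k) - ?g w) \<le> e * norm k"
    proof (rule norm_increment_le)
      fix s :: real assume s: "0 \<le> s" "s \<le> 1"
      have b: "w + s *\<^sub>R k \<in> ball x r" using in_ball[of t s] w s by simp
      show "(?g has_derivative (\<lambda>u. f'' (w + s *\<^sub>R k) u - f'' x u)) (at (w + s *\<^sub>R k))"
        by (rule has_derivative_diff_blinfun[OF f''[OF b]])
      have "norm ((f'' (w + s *\<^sub>R k) - f'' x) k) \<le> norm (f'' (w + s *\<^sub>R k) - f'' x) * norm k"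
        by (rule norm_blinfun)
      also have "\<dots> \<le> e * norm k" by (intro mult_right_mono close b) simp
      finally show "norm (f'' (w + s *\<^sub>R k) k - f'' x k) \<le> e * norm k"
        by (simp add: blinfun.diff_left)
    qed
    then show ?thesis by (simp add: blinfun.add_right algebra_simps)
  qed
  let ?G = "\<lambda>w. f (w + k) - f w - f'' x k w"
  have "norm (?G (x + h) - ?G x) \<le> e * norm h * norm k"
  proof (rule norm_increment_le)
    fix t :: real assume t: "0 \<le> t" "t \<le> 1"
    let ?w = "x + t *\<^sub>R h"
    have "(f has_derivative blinfun_apply (f' (?w + k))) (at (?w + k))"
      using in_ball[of t 1] t f' by simp
    then have shift: "((\<lambda>w. f (w + k)) has_derivative blinfun_apply (f' (?w + k))) (at ?w)"
      by (rule has_derivative_compose[of "\<lambda>w. w + k" "\<lambda>w. w" ?w UNIV f "blinfun_apply (f' (?w + k))", rotated])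
        (auto intro!: derivative_eq_intros)
    have at: "(f has_derivative blinfun_apply (f' ?w)) (at ?w)"
      using in_ball[of t 0] t f' by simp
    show "(?G has_derivative (\<lambda>u. f' (?w + k) u - f' ?w u - f'' x k u)) (at ?w)"
      by (intro has_derivative_diff_blinfun has_derivative_diff shift at)
    have "norm ((f' (?w + k) - f' ?w - f'' x k) h) \<le> norm (f' (?w + k) - f' ?w - f'' x k) * norm h"
      by (rule norm_blinfun)
    also have "\<dots> \<le> e * norm k * norm h" by (intro mult_right_mono first[OF refl t]) simp
    finally show "norm (f' (?w + k) h - f' ?w h - f'' x k h) \<le> e * norm h * norm k"
      by (simp add: blinfun.diff_left mult_ac)
  qed
  then show ?thesis by (simp add: blinfun.add_right algebra_simps)
qed

text \<open>The second difference is symmetric in its two increments, so for small \<open>t\<close>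
  it approximates both \<open>(t * t) *\<^sub>R f'' x v u\<close> and
  \<open>(t * t) *\<^sub>R f'' x u v\<close>, with errors at most \<open>t * t * e\<close> times a
  fixed factor; the scale \<open>t\<close> cancels and \<open>e\<close> is arbitrary.\<close>

lemma C2_with_symmetric:
  assumes C2: "C2_with U f f' f''" and U: "open U" and x: "x \<in> U"
  shows "f'' x u v = f'' x v u"
proof -
  define N where "N = norm u + norm v + 1"
  have N: "N > 0" "norm u + norm v < N" by (auto simp: N_def add_nonneg_pos)
  have "norm (f'' x u v - f'' x v u) \<le> 2 * e * (norm u * norm v)" if e: "e > 0" for e
  proof -
    have "isCont f'' x"
      using C2 U x by (auto simp: C2_with_def continuous_on_eq_continuous_at)
    then obtain r0 where "r0 > 0" and r0: "\<And>z. dist z x < r0 \<Longrightarrow> dist (f'' z) (f'' x) < e"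
      using e unfolding continuous_at_eps_delta by blast
    obtain r1 where "r1 > 0" and r1: "ball x r1 \<subseteq> U"
      using U x openE by blast
    define r where "r = min r0 r1"
    have "r > 0" using \<open>r0 > 0\<close> \<open>r1 > 0\<close> by (simp add: r_def)
    define t where "t = r / N"
    have t: "t > 0" "t * norm u + t * norm v < r"
      using \<open>r > 0\<close> N mult_strict_left_mono[OF N(2), of t] by (auto simp: t_def algebra_simps)
    have b: "norm (f (x + h + k) - f (x + h) - f (x + k) + f x - f'' x k h) \<le> e * norm h * norm k"
      if "norm h + norm k < r" for h k
    proof (rule second_difference_bound[OF _ _ _ that, where f'=f'])
      fix z assume z: "z \<in> ball x r"
      then have "z \<in> U" using r1 by (auto simp: r_def)
      then show "(f has_derivative blinfun_apply (f' z)) (at z)"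
        "(f' has_derivative blinfun_apply (f'' z)) (at z)"
        using C2 by (auto simp: C2_with_def)
      show "norm (f'' z - f'' x) \<le> e"
        using r0[of z] z by (simp add: r_def dist_norm norm_minus_commute less_imp_le)
    qed
    let ?D = "f (x + t *\<^sub>R u + t *\<^sub>R v) - f (x + t *\<^sub>R u) - f (x + t *\<^sub>R v) + f x"
    have 1: "norm (?D - (t * t) *\<^sub>R f'' x v u) \<le> t * t * (e * (norm u * norm v))"
      using b[of "t *\<^sub>R u" "t *\<^sub>R v"] t
      by (simp add: blinfun.scaleR_right blinfun.scaleR_left mult_ac)
    have 2: "norm (?D - (t * t) *\<^sub>R f'' x u v) \<le> t * t * (e * (norm u * norm v))"
      using b[of "t *\<^sub>R v" "t *\<^sub>R u"] t
      by (simp add: blinfun.scaleR_right blinfun.scaleR_left mult_ac add_ac algebra_simps)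
    have "norm ((t * t) *\<^sub>R (f'' x u v - f'' x v u))
        = norm ((?D - (t * t) *\<^sub>R f'' x v u) - (?D - (t * t) *\<^sub>R f'' x u v))"
      by (simp add: scaleR_diff_right)
    also have "\<dots> \<le> t * t * (2 * e * (norm u * norm v))"
      using norm_triangle_ineq4[of "?D - (t * t) *\<^sub>R f'' x v u" "?D - (t * t) *\<^sub>R f'' x u v"] 1 2
      by (simp add: algebra_simps)
    finally show ?thesis using t by simp
  qed
  note * = this
  have "norm (f'' x u v - f'' x v u) \<le> e" if "e > 0" for e
  proof -
    define M where "M = 2 * (norm u * norm v) + 1"
    have "M > 0" by (simp add: M_def add_nonneg_pos)
    have "norm (f'' x u v - f'' x v u) \<le> (e / M) * (2 * (norm u * norm v))"
      using *[of "e / M"] that \<open>M > 0\<close> by (simp add: mult_ac)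
    also have "\<dots> \<le> (e / M) * M"
      using that \<open>M > 0\<close> by (intro mult_left_mono) (auto simp: M_def)
    finally show ?thesis using \<open>M > 0\<close> by simp
  qed
  then show ?thesis
    using field_le_epsilon[of "norm (f'' x u v - f'' x v u)" 0] by simp
qed

text \<open>A Lebesgue number of a finite subcover gives one radius, and monotonicity in
  \<open>C\<close> lets one constant serve all its members. The conclusion concerns all
  \<open>z\<close> near \<open>K\<close>, not only \<open>z \<in> K\<close>, since perturbed curves
  leave \<open>K\<close>.\<close>

lemma compact_uniform_near:
  fixes K :: "'a::metric_space set" and P :: "real \<Rightarrow> 'a \<Rightarrow> bool"
  assumes K: "compact K"
    and loc: "\<And>x. x \<in> K \<Longrightarrow> \<exists>r>0. \<exists>C. \<forall>z. dist x z < r \<longrightarrow> P C z"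
    and mono: "\<And>C C' z. P C z \<Longrightarrow> C \<le> C' \<Longrightarrow> P C' z"
  obtains d C where "d > 0" "C > 0" "\<And>x z. x \<in> K \<Longrightarrow> dist x z < d \<Longrightarrow> P C z"
proof -
  obtain r C where rC: "\<And>x. x \<in> K \<Longrightarrow> r x > 0"
      "\<And>x z. x \<in> K \<Longrightarrow> dist x z < r x \<Longrightarrow> P (C x) z"
    using loc by metis
  obtain D where D: "D \<subseteq> K" "finite D" "K \<subseteq> (\<Union>x\<in>D. ball x (r x))"
    by (rule compactE_image[OF K, of K "\<lambda>x. ball x (r x)"]) (use rC(1) in auto)
  obtain d where d: "d > 0" "\<And>x. x \<in> K \<Longrightarrow> \<exists>b\<in>(\<lambda>x. ball x (r x)) ` D. ball x d \<subseteq> b"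
    by (rule Heine_Borel_lemma[OF K, of "(\<lambda>x. ball x (r x)) ` D"]) (use D in auto)
  \<comment> \<open>The sum bounds every \<open>C x\<close> with \<open>x \<in> D\<close>; the added
    1 makes \<open>B\<close> positive even if \<open>D\<close> is empty.\<close>
  define B where "B = (\<Sum>x\<in>D. \<bar>C x\<bar>) + 1"
  have "B > 0" by (simp add: B_def add_nonneg_pos sum_nonneg)
  moreover have "P B z" if "x \<in> K" "dist x z < d" for x z
  proof -
    obtain y where y: "y \<in> D" "ball x d \<subseteq> ball y (r y)" using d(2)[OF \<open>x \<in> K\<close>] by auto
    then have "y \<in> K" "dist y z < r y" using D(1) that by auto
    then have "P (C y) z" by (rule rC(2))
    have "\<bar>C y\<bar> \<le> (\<Sum>x\<in>D. \<bar>C x\<bar>)" by (rule member_le_sum) (use y D in auto)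
    then have "C y \<le> B" by (simp add: B_def)
    with \<open>P (C y) z\<close> show ?thesis by (rule mono)
  qed
  ultimately show thesis using that d(1) by blast
qed

text \<open>Only one of the two points has to lie in \<open>K\<close>; in infinite dimensions
  \<open>K\<close> has no compact neighbourhood to which uniform continuity could be applied. The
  Lebesgue number is taken for the cover by sets on which \<open>F\<close> stays within
  \<open>e / 2\<close> of \<open>F b\<close>.\<close>

lemma compact_uniformly_continuous_near:
  fixes F :: "'a::metric_space \<Rightarrow> 'b::metric_space"
  assumes K: "compact K" "K \<subseteq> S" and S: "open S" and F: "continuous_on S F" and e: "e > 0"
  obtains d where "d > 0" "\<And>x z. x \<in> K \<Longrightarrow> dist x z < d \<Longrightarrow> z \<in> S \<and> dist (F z) (F x) < e"
proof -
  let ?W = "\<lambda>b. S \<inter> F -` ball (F b) (e / 2)"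
  have "open (?W b)" for b
    by (rule continuous_open_preimage[OF F S]) simp
  then obtain d where d: "d > 0" "\<And>x. x \<in> K \<Longrightarrow> \<exists>w\<in>?W ` K. ball x d \<subseteq> w"
    by (rule_tac Heine_Borel_lemma[OF K(1), of "?W ` K"]) (use K e in auto)
  moreover have "z \<in> S \<and> dist (F z) (F x) < e" if x: "x \<in> K" "dist x z < d" for x z
  proof -
    obtain b where "ball x d \<subseteq> ?W b" using d(2)[OF x(1)] by auto
    moreover have "x \<in> ball x d" "z \<in> ball x d" using x d(1) by auto
    ultimately have "z \<in> ?W b" "x \<in> ?W b" by blast+
    then have "z \<in> S" "dist (F b) (F z) < e / 2" "dist (F b) (F x) < e / 2" by simp_all
    then show ?thesis by (metis dist_commute dist_triangle_half_r)
  qed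
  ultimately show thesis using that by blast
qed

lemma borel_measurable_continuous_on_compose:
  fixes G :: "'a::topological_space \<Rightarrow> 'b::topological_space"
  assumes "continuous_on S G" "p \<in> borel_measurable M" "\<And>x. x \<in> space M \<Longrightarrow> p x \<in> S"
  shows "(\<lambda>x. G (p x)) \<in> borel_measurable M"
proof (rule measurable_compose[where N="restrict_space borel S" and g=G])
  show "p \<in> measurable M (restrict_space borel S)"
    using assms by (intro measurable_restrict_space2) auto
  show "G \<in> borel_measurable (restrict_space borel S)"
    by (rule borel_measurable_continuous_on_restrict) fact
qed

text \<open>The space of operators need not be separable, so the argument avoids the operator-valued
  map \<open>A (p x)\<close>. Instead evaluation is jointly continuous on
  \<open>S \<times> UNIV\<close>, and the pair of \<open>p\<close> and \<open>q\<close> is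
  measurable.\<close>

lemma borel_measurable_blinfun_compose:
  fixes A :: "'a::{metric_space,second_countable_topology} \<Rightarrow>
    'b::{real_normed_vector,second_countable_topology} \<Rightarrow>\<^sub>L 'c::real_normed_vector"
  assumes "continuous_on S A" "p \<in> borel_measurable M" "q \<in> borel_measurable M"
    and "\<And>x. x \<in> space M \<Longrightarrow> p x \<in> S"
  shows "(\<lambda>x. A (p x) (q x)) \<in> borel_measurable M"
proof -
  have "continuous_on (S \<times> UNIV) (\<lambda>z. A (fst z) (snd z))"
    by (intro continuous_intros continuous_on_compose2[OF assms(1)]) auto
  from borel_measurable_continuous_on_compose[OF this borel_measurable_Pair[OF assms(2,3)]] assms(4)
  show ?thesis by simp
qed

lemma borel_measurable_lebesgue_continuous:
  fixes f :: "real \<Rightarrow> 'a::topological_space"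
  assumes "continuous_on UNIV f"
  shows "f \<in> borel_measurable lebesgue"
  by (rule measurable_completion) (use borel_measurable_continuous_onI[OF assms] in simp)

text \<open>The defect \<open>Q s t\<close> between the increment of \<open>F\<close> along
  \<open>f\<close> and the integral is additive in the interval, so it suffices that on short
  intervals it is small relative to the integral of \<open>norm (g x)\<close>. There
  \<open>F\<close> is replaced by its linearization at \<open>f s\<close>, for which the formula
  holds by linearity.\<close>

lemma primitive_compose:
  fixes f :: "real \<Rightarrow> 'a::{real_normed_vector,second_countable_topology}"
    and F :: "'a \<Rightarrow> 'b::{real_normed_vector,complete_space,second_countable_topology}"
  assumes p: "primitive f g" and f: "continuous_on UNIV f" and S: "open S" "\<And>s. f s \<in> S"
    and F: "\<And>x. x \<in> S \<Longrightarrow> (F has_derivative blinfun_apply (F' x)) (at x)"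
    and F': "continuous_on S F'"
  shows "primitive (\<lambda>s. F (f s)) (\<lambda>s. F' (f s) (g s))"
proof -
  have g: "g \<in> borel_measurable lebesgue" and g_int: "\<And>s t. set_integrable lebesgue {s<..t} g"
    and g_eq: "\<And>s t. s \<le> t \<Longrightarrow> f t - f s = (LINT x:{s<..t}|lebesgue. g x)"
    using p by (auto simp: primitive_def)
  note ng_int = set_integrable_norm_Ioc[OF g_int]
  let ?h = "\<lambda>s. F' (f s) (g s)"
  have h: "?h \<in> borel_measurable lebesgue"
    by (rule borel_measurable_blinfun_compose[OF F' borel_measurable_lebesgue_continuous[OF f] g])
      (rule S)
  have F'f: "continuous_on T (\<lambda>s. F' (f s))" for T
    by (rule continuous_on_compose2[OF F' continuous_on_subset[OF f]]) (use S in auto)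
  have h_int: "set_integrable lebesgue {s<..t} ?h" for s t
  proof -
    have "compact ((\<lambda>s. F' (f s)) ` {s..t})"
      by (intro compact_continuous_image F'f) simp
    then obtain B where B: "\<And>x. x \<in> {s..t} \<Longrightarrow> norm (F' (f x)) \<le> B"
      using compact_imp_bounded bounded_iff by (metis imageI)
    show ?thesis
    proof (rule set_integrable_Ioc_dominated[OF h])
      show "set_integrable lebesgue {s<..t} (\<lambda>x. B * norm (g x))"
        using ng_int by (intro set_integrable_mult_right) auto
      fix x assume "s < x" "x \<le> t"
      then have "norm (F' (f x)) * norm (g x) \<le> B * norm (g x)" by (intro mult_right_mono B) auto
      then show "norm (F' (f x) (g x)) \<le> B * norm (g x)" by (rule order_trans[OF norm_blinfun])
    qed
  qed
  have "F (f b) - F (f a) = (LINT x:{a<..b}|lebesgue. ?h x)" if ab: "a \<le> b" for a b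
  proof -
    define Q where "Q s t = F (f t) - F (f s) - (LINT x:{s<..t}|lebesgue. ?h x)" for s t
    define m where "m t = (LINT x:{a<..t}|lebesgue. norm (g x))" for t
    have m: "m t - m s = (LINT x:{s<..t}|lebesgue. norm (g x))" if "a \<le> s" "s \<le> t" for s t
      using set_integral_Ioc_split[OF ng_int ng_int that] by (simp add: m_def)
    have "Q a b = 0"
    proof (rule additive_interval_function_zero[where m=m and Q=Q])
      show "Q s u = Q s t + Q t u" if "s \<le> t" "t \<le> u" for s t u
        using set_integral_Ioc_split[OF h_int h_int that] by (simp add: Q_def)
    next
      fix e :: real assume e: "e > 0"
      have K: "compact (f ` {a..b})" "f ` {a..b} \<subseteq> S"
        using S by (auto intro!: compact_continuous_image continuous_on_subset[OF f])
      obtain r where r: "r > 0" "\<And>x z. x \<in> f ` {a..b} \<Longrightarrow> dist x z < r \<Longrightarrow>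
          z \<in> S \<and> dist (F' z) (F' x) < e / 2"
        using compact_uniformly_continuous_near[OF K S(1) F', of "e / 2"] e by auto
      have "uniformly_continuous_on {a..b} f"
        by (intro compact_uniformly_continuous continuous_on_subset[OF f]) auto
      then obtain d where d: "d > 0"
        "\<And>s t. s \<in> {a..b} \<Longrightarrow> t \<in> {a..b} \<Longrightarrow> dist t s < d \<Longrightarrow> dist (f t) (f s) < r"
        using r(1) unfolding uniformly_continuous_on_def by metis
      have "norm (Q s t) \<le> e * (m t - m s)" if st: "a \<le> s" "s \<le> t" "t \<le> b" "t - s < d" for s t
      proof -
        \<comment> \<open>Both halves of the defect are compared with \<open>?L (f t - f s)\<close>,
          which is also the integral of \<open>?L (g x)\<close>; each comparison costs
          \<open>e / 2\<close>.\<close>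
        let ?L = "F' (f s)"
        have near: "norm (F' (f x) - ?L) \<le> e / 2" if "s \<le> x" "x \<le> t" for x
          using r(2)[of "f s" "f x"] d(2)[of s x] that st
          by (force simp: dist_norm norm_minus_commute intro!: less_imp_le)
        have incr: "norm (f t - f s) \<le> m t - m s"
          unfolding g_eq[OF st(2)] m[OF st(1,2)]
          by (rule norm_set_integral_Ioc_le) (use g_int ng_int in auto)
        have "norm ((F (f s + (f t - f s)) - ?L (f s + (f t - f s))) - (F (f s) - ?L (f s)))
            \<le> e / 2 * norm (f t - f s)"
        proof (rule norm_increment_le)
          fix u :: real assume u: "0 \<le> u" "u \<le> 1"
          let ?z = "f s + u *\<^sub>R (f t - f s)"
          have "dist (f s) ?z = u * norm (f t - f s)"
            using u by (simp add: dist_norm)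
          also have "\<dots> \<le> 1 * norm (f t - f s)"
            using u by (intro mult_right_mono) auto
          also have "\<dots> < r"
            using d(2)[of s t] st by (simp add: dist_norm)
          finally have z: "?z \<in> S" "dist (F' ?z) ?L < e / 2" using r(2)[of "f s" ?z] st by auto
          show "((\<lambda>x. F x - ?L x) has_derivative (\<lambda>v. F' ?z v - ?L v)) (at ?z)"
            by (rule has_derivative_diff_blinfun[OF F[OF z(1)]])
          have "norm ((F' ?z - ?L) (f t - f s)) \<le> norm (F' ?z - ?L) * norm (f t - f s)"
            by (rule norm_blinfun)
          also have "\<dots> \<le> e / 2 * norm (f t - f s)"
            using z(2) by (intro mult_right_mono) (auto simp: dist_norm)
          finally show "norm (F' ?z (f t - f s) - ?L (f t - f s)) \<le> e / 2 * norm (f t - f s)"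
            by (simp add: blinfun.diff_left)
        qed
        also have "\<dots> \<le> e / 2 * (m t - m s)"
          using e incr by (intro mult_left_mono) auto
        finally have 1: "norm (F (f t) - F (f s) - ?L (f t - f s)) \<le> e / 2 * (m t - m s)"
          by (simp add: blinfun.diff_right algebra_simps)
        have Lg_int: "set_integrable lebesgue {s<..t} (\<lambda>x. ?L (g x))"
          using integrable_bounded_linear[OF blinfun.bounded_linear_right g_int[unfolded set_integrable_def], of ?L s t]
          by (simp add: set_integrable_def blinfun.scaleR_right)
        have "?L (f t - f s) = (LINT x:{s<..t}|lebesgue. ?L (g x))"
          unfolding g_eq[OF st(2)] set_lebesgue_integral_def
          using integral_bounded_linear[OF blinfun.bounded_linear_right g_int[unfolded set_integrable_def], of ?L s t]
          by (simp add: blinfun.scaleR_right)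
        then have "?L (f t - f s) - (LINT x:{s<..t}|lebesgue. ?h x)
            = (LINT x:{s<..t}|lebesgue. ?L (g x) - ?h x)"
          using Lg_int h_int[of s t]
          by (simp add: set_lebesgue_integral_def set_integrable_def scaleR_diff_right)
        also have "norm \<dots> \<le> (LINT x:{s<..t}|lebesgue. e / 2 * norm (g x))"
        proof (rule norm_set_integral_Ioc_le)
          show "set_integrable lebesgue {s<..t} (\<lambda>x. ?L (g x) - ?h x)"
            using Lg_int h_int[of s t] by (simp add: set_integrable_def scaleR_diff_right)
          show "set_integrable lebesgue {s<..t} (\<lambda>x. e / 2 * norm (g x))"
            using ng_int by (intro set_integrable_mult_right) auto
          fix x assume x: "s < x" "x \<le> t"
          have "norm ((?L - F' (f x)) (g x)) \<le> norm (?L - F' (f x)) * norm (g x)"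
            by (rule norm_blinfun)
          also have "\<dots> \<le> e / 2 * norm (g x)"
            using near[of x] x by (intro mult_right_mono) (auto simp: norm_minus_commute)
          finally show "norm (?L (g x) - ?h x) \<le> e / 2 * norm (g x)"
            by (simp add: blinfun.diff_left)
        qed
        also have "\<dots> = e / 2 * (m t - m s)"
          using st by (simp add: m)
        finally have 2: "norm (?L (f t - f s) - (LINT x:{s<..t}|lebesgue. ?h x)) \<le> e / 2 * (m t - m s)" .
        have "Q s t = (F (f t) - F (f s) - ?L (f t - f s)) + (?L (f t - f s) - (LINT x:{s<..t}|lebesgue. ?h x))"
          by (simp add: Q_def)
        then show ?thesis
          using norm_triangle_mono[OF 1 2] by simp
      qed
      then show "\<exists>d>0. \<forall>s t. a \<le> s \<longrightarrow> s \<le> t \<longrightarrow> t \<le> b \<longrightarrow> t - s < d \<longrightarrow>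
          norm (Q s t) \<le> e * (m t - m s)"
        using d(1) by blast
    qed (rule ab)
    then show ?thesis by (simp add: Q_def)
  qed
  then show ?thesis
    using h h_int by (simp add: primitive_def)
qed

section \<open>Test functions and weak derivatives\<close>

text \<open>Not all smooth functions: only a class that contains bump functions and is closed under
  differentiation.\<close>

inductive smooth_fn :: "(real \<Rightarrow> real) \<Rightarrow> bool" where
  flat: "smooth_fn (\<lambda>x. if x > 0 then (1 / x) ^ k * exp (- (1 / x)) else 0)"
| affine: "smooth_fn f \<Longrightarrow> smooth_fn (\<lambda>x. f (a * x + b))"
| scale: "smooth_fn f \<Longrightarrow> smooth_fn (\<lambda>x. c * f x)"
| add: "smooth_fn f \<Longrightarrow> smooth_fn g \<Longrightarrow> smooth_fn (\<lambda>x. f x + g x)"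
| mult: "smooth_fn f \<Longrightarrow> smooth_fn g \<Longrightarrow> smooth_fn (\<lambda>x. f x * g x)"

text \<open>Away from 0 this is elementary calculus. At 0 the difference quotient of
  \<open>F k\<close> is \<open>F (k + 1)\<close> itself, which tends to 0 because the exponential
  beats every power of \<open>1 / x\<close>.\<close>

lemma has_real_derivative_flat:
  fixes k :: nat
  defines "F \<equiv> \<lambda>k x. if x > 0 then (1 / x) ^ k * exp (- (1 / x)) else (0::real)"
  shows "(F k has_real_derivative (F (k + 2) x + - real k * F (k + 1) x)) (at x)"
proof -
  consider "x < 0" | "x = 0" | "x > 0" by linarith
  then show ?thesis
  proof cases
    case 1
    have "((\<lambda>x. 0) has_real_derivative 0) (at x)" by simp
    moreover have "\<forall>\<^sub>F y in nhds x. F k y = 0"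
      using eventually_nhds_in_open[of "{..<0}" x] 1
      by (auto simp: F_def elim!: eventually_mono)
    ultimately have "(F k has_real_derivative 0) (at x)"
      using DERIV_cong_ev[OF refl, of "F k" "\<lambda>x. 0" x 0 0] by simp
    then show ?thesis using 1 by (simp add: F_def)
  next
    case 2
    have right: "(F (k + 1) \<longlongrightarrow> 0) (at_right 0)"
    proof (rule Lim_transform_eventually)
      show "((\<lambda>x. inverse x ^ (k + 1) / exp (inverse x)) \<longlongrightarrow> (0::real)) (at_right 0)"
        by (rule filterlim_compose[OF tendsto_power_div_exp_0 filterlim_inverse_at_top_right])
      show "\<forall>\<^sub>F x in at_right 0. inverse x ^ (k + 1) / exp (inverse x) = F (k + 1) x"
        by (rule eventually_at_right_less[THEN eventually_mono])
          (simp add: F_def exp_minus divide_simps)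
    qed
    have left: "(F (k + 1) \<longlongrightarrow> 0) (at_left 0)"
    proof (rule Lim_transform_eventually)
      show "\<forall>\<^sub>F x in at_left 0. 0 = F (k + 1) x"
        by (simp add: eventually_at_filter F_def)
    qed simp
    have "(F (k + 1) \<longlongrightarrow> 0) (at 0)"
      using left right by (simp add: filterlim_at_split)
    \<comment> \<open>At \<open>y = 0\<close> both sides are 0, the left one by the convention
      \<open>0 / 0 = 0\<close>.\<close>
    moreover have "(\<lambda>y. (F k y - F k 0) / (y - 0)) = F (k + 1)"
      by (auto simp: F_def fun_eq_iff)
    ultimately have "(F k has_real_derivative 0) (at 0)"
      by (simp add: has_field_derivative_iff)
    then show ?thesis using 2 by (simp add: F_def)
  next
    case 3
    let ?G = "\<lambda>x. (1 / x) ^ k * exp (- (1 / x))"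
    have "(?G has_real_derivative
        (real k * (1 / x) ^ (k - 1) * (- (1 / x ^ 2))) * exp (- (1 / x))
        + exp (- (1 / x)) * (1 / x ^ 2) * (1 / x) ^ k) (at x)"
      using 3 by (auto intro!: derivative_eq_intros simp: power2_eq_square)
    moreover have "(real k * (1 / x) ^ (k - 1) * (- (1 / x ^ 2))) * exp (- (1 / x))
        + exp (- (1 / x)) * (1 / x ^ 2) * (1 / x) ^ k = F (k + 2) x + - real k * F (k + 1) x"
      \<comment> \<open>For \<open>k = 0\<close> the truncated exponent \<open>k - 1\<close> is
        harmless since its coefficient \<open>real k\<close> is 0.\<close>
      using 3 by (cases k) (auto simp: F_def power2_eq_square field_simps)
    moreover have "\<forall>\<^sub>F y in nhds x. F k y = ?G y"
      using eventually_nhds_in_open[of "{0<..}" x] 3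
      by (auto simp: F_def elim!: eventually_mono)
    ultimately show ?thesis
      using DERIV_cong_ev[OF refl, of "F k" ?G x] by simp
  qed
qed

lemma smooth_fn_has_derivative:
  "smooth_fn f \<Longrightarrow> \<exists>f'. smooth_fn f' \<and> (\<forall>x. (f has_real_derivative f' x) (at x))"
proof (induction rule: smooth_fn.induct)
  case (flat k)
  show ?case
    by (intro exI conjI allI) (rule smooth_fn.add[OF smooth_fn.flat smooth_fn.scale[OF smooth_fn.flat]],
        rule has_real_derivative_flat)
next
  case (affine f a b)
  then obtain f' where f': "smooth_fn f'" "\<And>x. (f has_real_derivative f' x) (at x)" by blast
  have "((\<lambda>x. f (a * x + b)) has_real_derivative (a * f' (a * x + b))) (at x)" for x
    by (rule DERIV_cong[OF DERIV_chain2[OF f'(2)]]) (auto intro!: derivative_eq_intros)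
  moreover have "smooth_fn (\<lambda>x. a * f' (a * x + b))"
    by (intro smooth_fn.scale smooth_fn.affine f')
  ultimately show ?case by blast
next
  case (scale f c)
  then obtain f' where f': "smooth_fn f'" "\<And>x. (f has_real_derivative f' x) (at x)" by blast
  then have "smooth_fn (\<lambda>x. c * f' x)" "\<And>x. ((\<lambda>x. c * f x) has_real_derivative (c * f' x)) (at x)"
    by (auto intro: smooth_fn.intros DERIV_cmult)
  then show ?case by blast
next
  case (add f g)
  then obtain f' g' where "smooth_fn f'" "\<And>x. (f has_real_derivative f' x) (at x)"
    "smooth_fn g'" "\<And>x. (g has_real_derivative g' x) (at x)" by blast
  then have "smooth_fn (\<lambda>x. f' x + g' x)"
    "\<And>x. ((\<lambda>x. f x + g x) has_real_derivative (f' x + g' x)) (at x)"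
    by (auto intro: smooth_fn.intros DERIV_add)
  then show ?case by blast
next
  case (mult f g)
  then obtain f' g' where fg: "smooth_fn f'" "\<And>x. (f has_real_derivative f' x) (at x)"
    "smooth_fn g'" "\<And>x. (g has_real_derivative g' x) (at x)" by blast
  then have "smooth_fn (\<lambda>x. f' x * g x + g' x * f x)"
    using mult by (intro smooth_fn.add smooth_fn.mult)
  moreover have "((\<lambda>x. f x * g x) has_real_derivative (f' x * g x + g' x * f x)) (at x)" for x
    using fg DERIV_mult by blast
  ultimately show ?case by blast
qed

lemma smooth_fn_continuous: "smooth_fn f \<Longrightarrow> continuous_on UNIV f"
  by (metis DERIV_continuous_on UNIV_I has_field_derivative_at_within smooth_fn_has_derivative)

lemma smooth_fn_funpow_deriv: "smooth_fn f \<Longrightarrow> smooth_fn ((deriv ^^ n) f)"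
proof (induction n)
  case (Suc n)
  then obtain f' where f': "smooth_fn f'" "\<And>x. ((deriv ^^ n) f has_real_derivative f' x) (at x)"
    using smooth_fn_has_derivative by blast
  then have "deriv ((deriv ^^ n) f) = f'" by (auto intro: DERIV_imp_deriv)
  with f' show ?case by simp
qed simp

text \<open>Only the derivative has to lie in \<open>smooth_fn\<close>: the function to be tested
  with is an antiderivative of bumps, and \<open>smooth_fn\<close> has no rule for
  antiderivatives.\<close>

lemma test_functionI:
  assumes d: "\<And>x. (\<psi> has_real_derivative f x) (at x)" and f: "smooth_fn f"
    and supp: "\<And>x. \<psi> x \<noteq> 0 \<Longrightarrow> a \<le> x \<and> x \<le> b"
  shows "test_function \<psi>"
  unfolding test_function_def
proof
  have deriv: "deriv \<psi> = f" using d by (auto intro: DERIV_imp_deriv)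
  show "\<forall>n. ((deriv ^^ n) \<psi>) differentiable_on UNIV"
  proof
    fix n
    show "((deriv ^^ n) \<psi>) differentiable_on UNIV"
    proof (cases n)
      case 0
      then show ?thesis
        using d by (auto simp: differentiable_on_def real_differentiable_def)
    next
      case (Suc m)
      have "(deriv ^^ n) \<psi> = (deriv ^^ m) f"
        unfolding Suc funpow_Suc_right by (simp add: deriv)
      then show ?thesis
        using smooth_fn_has_derivative[OF smooth_fn_funpow_deriv[OF f, of m]]
        by (auto simp: differentiable_on_def real_differentiable_def)
    qed
  qed
  have "{s. \<psi> s \<noteq> 0} \<subseteq> {a..b}" using supp by auto
  then show "compact (closure {s. \<psi> s \<noteq> 0})"
    by (metis bounded_closed_interval bounded_subset compact_closure)
qed

text \<open>The complement of the closed support is open, so \<open>\<psi>\<close> vanishes near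
  each of its points and its derivative vanishes there too. Taking
  \<open>c = \<bar>B\<bar> + 1\<close> puts even the points with \<open>\<bar>x\<bar> = c\<close>
  outside.\<close>

lemma test_functionD:
  assumes "test_function \<psi>"
  obtains c where "\<And>x. (\<psi> has_real_derivative deriv \<psi> x) (at x)" "continuous_on UNIV (deriv \<psi>)"
    "c > 0" "\<And>x. c \<le> \<bar>x\<bar> \<Longrightarrow> \<psi> x = 0" "\<And>x. c \<le> \<bar>x\<bar> \<Longrightarrow> deriv \<psi> x = 0"
proof -
  have diff: "((deriv ^^ n) \<psi>) differentiable_on UNIV" for n
    using assms by (simp add: test_function_def)
  have 1: "(\<psi> has_real_derivative deriv \<psi> x) (at x)" for x
    using diff[of 0] DERIV_deriv_iff_real_differentiable by (auto simp: differentiable_on_def)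
  have 2: "continuous_on UNIV (deriv \<psi>)"
    using diff[of 1] by (simp add: differentiable_imp_continuous_on)
  have "bounded (closure {s. \<psi> s \<noteq> 0})"
    using assms by (simp add: test_function_def compact_imp_bounded)
  then obtain B where B: "\<And>x. x \<in> closure {s. \<psi> s \<noteq> 0} \<Longrightarrow> \<bar>x\<bar> \<le> B"
    unfolding bounded_iff real_norm_def by blast
  define c where "c = \<bar>B\<bar> + 1"
  have out: "x \<notin> closure {s. \<psi> s \<noteq> 0}" if "c \<le> \<bar>x\<bar>" for x
    using B[of x] that by (auto simp: c_def)
  have "deriv \<psi> x = 0" if "c \<le> \<bar>x\<bar>" for x
  proof -
    have "\<forall>\<^sub>F y in nhds x. y \<in> - closure {s. \<psi> s \<noteq> 0}"
      by (rule eventually_nhds_in_open) (use out[OF that] in auto)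
    then have "\<forall>\<^sub>F y in nhds x. \<psi> y = 0"
      using closure_subset[of "{s. \<psi> s \<noteq> 0}"] by (auto elim!: eventually_mono)
    then have "deriv \<psi> x = deriv (\<lambda>_. 0) x" by (intro deriv_cong_ev) auto
    then show ?thesis by simp
  qed
  moreover have "\<psi> x = 0" if "c \<le> \<bar>x\<bar>" for x
    using out[OF that] closure_subset[of "{s. \<psi> s \<noteq> 0}"] by auto
  ultimately show thesis using that[of c] 1 2 by (simp add: c_def add_nonneg_pos)
qed

section \<open>Primitives of continuous functions and integration by parts\<close>

lemma set_integrable_Ioc_const:
  fixes c :: "'a::{real_normed_vector,second_countable_topology}" and s t :: real
  shows "set_integrable lebesgue {s<..t} (\<lambda>_. c)"
proof -
  have "emeasure lborel {s<..t} < top"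
    by (cases "s \<le> t") auto
  then have "integrable lborel (indicat_real {s<..t})"
    by (intro integrable_real_indicator) auto
  then have "integrable lebesgue (indicat_real {s<..t})"
    by (subst integrable_completion) auto
  then show ?thesis
    unfolding set_integrable_def by (intro integrable_scaleR_left)
qed

text \<open>The fundamental theorem of calculus as an instance of the chain rule: the identity is a
  primitive of the constant 1, and \<open>F\<close> is composed with it.\<close>

lemma primitive_C1:
  fixes F :: "real \<Rightarrow> 'a::{real_normed_vector,complete_space,second_countable_topology}"
  assumes F: "\<And>x. (F has_vector_derivative f x) (at x)" and f: "continuous_on UNIV f"
  shows "primitive F f"
proof -
  have "primitive (\<lambda>x. x) (\<lambda>_. 1::real)"
    using set_integrable_Ioc_const[of _ _ "1::real"]
    by (auto simp: primitive_def set_lebesgue_integral_def)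
  then have "primitive (\<lambda>s. F s) (\<lambda>s. blinfun_scaleR_left (f s) 1)"
  proof (rule primitive_compose)
    show "(F has_derivative blinfun_apply (blinfun_scaleR_left (f x))) (at x)" for x
      using F[of x] by (simp add: has_vector_derivative_def)
    show "continuous_on UNIV (\<lambda>x. blinfun_scaleR_left (f x))"
      by (intro continuous_intros f)
  qed auto
  then show ?thesis by simp
qed

text \<open>Pairing lets the chain rule yield product rules: a product is a bilinear map composed
  with a pair of curves.\<close>

lemma primitive_Pair:
  assumes "primitive f1 g1" "primitive f2 g2"
  shows "primitive (\<lambda>s. (f1 s, f2 s)) (\<lambda>s. (g1 s, g2 s))"
proof -
  have g: "g1 \<in> borel_measurable lebesgue" "g2 \<in> borel_measurable lebesgue"
    and i1: "set_integrable lebesgue {s<..t} g1" and i2: "set_integrable lebesgue {s<..t} g2"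
    and e: "s \<le> t \<Longrightarrow> f1 t - f1 s = (LINT x:{s<..t}|lebesgue. g1 x)"
      "s \<le> t \<Longrightarrow> f2 t - f2 s = (LINT x:{s<..t}|lebesgue. g2 x)" for s t
    using assms by (auto simp: primitive_def)
  have "bounded_linear (\<lambda>x::'a. (x, 0::'b))" "bounded_linear (\<lambda>x::'b. (0::'a, x))"
    by (auto intro!: bounded_linear_Pair bounded_linear_ident bounded_linear_zero)
  then have i: "set_integrable lebesgue {s<..t} (\<lambda>s. (g1 s, g2 s))" for s t
    using Bochner_Integration.integrable_add[OF
        integrable_bounded_linear[OF _ i1[unfolded set_integrable_def, of s t]]
        integrable_bounded_linear[OF _ i2[unfolded set_integrable_def, of s t]],
        of "\<lambda>x. (x, 0)" "\<lambda>x. (0, x)"]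
    by (simp add: set_integrable_def)
  have "(LINT x:{s<..t}|lebesgue. (g1 x, g2 x))
      = (LINT x:{s<..t}|lebesgue. g1 x, LINT x:{s<..t}|lebesgue. g2 x)" for s t
    using integral_fst[OF i[unfolded set_integrable_def, of s t]]
      integral_snd[OF i[unfolded set_integrable_def, of s t]]
    by (simp add: set_lebesgue_integral_def prod_eq_iff)
  then show ?thesis
    using g i e by (auto simp: primitive_def)
qed

lemma integrable_compact_support_scaleR:
  fixes g :: "real \<Rightarrow> 'a::{real_normed_vector,complete_space,second_countable_topology}"
  assumes c: "continuous_on UNIV c" "\<And>x. a \<le> \<bar>x\<bar> \<Longrightarrow> c x = (0::real)"
    and g: "g \<in> borel_measurable lebesgue" "\<And>s t. set_integrable lebesgue {s<..t} g"
  shows "integrable lebesgue (\<lambda>x. c x *\<^sub>R g x)"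
proof -
  have "bounded (c ` {-a..a})"
    by (intro compact_imp_bounded compact_continuous_image continuous_on_subset[OF c(1)]) auto
  then obtain B where "\<And>y. y \<in> c ` {-a..a} \<Longrightarrow> norm y \<le> B"
    unfolding bounded_iff by blast
  then have B: "\<bar>c x\<bar> \<le> B" if "x \<in> {-a..a}" for x
    using that by force
  have "set_integrable lebesgue {-a<..a} (\<lambda>x. c x *\<^sub>R g x)"
  proof (rule set_integrable_Ioc_dominated)
    show "(\<lambda>x. c x *\<^sub>R g x) \<in> borel_measurable lebesgue"
      by (intro borel_measurable_scaleR g borel_measurable_lebesgue_continuous c)
    show "set_integrable lebesgue {-a<..a} (\<lambda>x. B * norm (g x))"
      by (intro set_integrable_mult_right set_integrable_norm_Ioc g)
    show "norm (c x *\<^sub>R g x) \<le> B * norm (g x)" if "-a < x" "x \<le> a" for x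
      using mult_right_mono[OF B[of x] norm_ge_zero[of "g x"]] that by simp
  qed
  moreover have "indicator {-a<..a} x *\<^sub>R c x *\<^sub>R g x = c x *\<^sub>R g x" for x
    using c(2)[of x] by (cases "a \<le> \<bar>x\<bar>") (auto simp: indicator_def)
  ultimately show ?thesis by (simp only: set_integrable_def)
qed

lemma set_integrable_Ioc_continuous:
  fixes f :: "real \<Rightarrow> 'a::{real_normed_vector,complete_space,second_countable_topology}"
  assumes "continuous_on UNIV f"
  shows "set_integrable lebesgue {s<..t} f"
proof -
  have "compact (f ` {s..t})"
    by (intro compact_continuous_image continuous_on_subset[OF assms]) auto
  then obtain B where B: "\<And>x. x \<in> {s..t} \<Longrightarrow> norm (f x) \<le> B"
    using compact_imp_bounded bounded_iff by (metis imageI)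
  show ?thesis
    by (rule set_integrable_Ioc_dominated[where h="\<lambda>_. B"])
      (use B borel_measurable_lebesgue_continuous[OF assms] set_integrable_Ioc_const in auto)
qed

text \<open>Integration by parts: \<open>\<psi> s *\<^sub>R f s\<close> is a primitive by the chain
  rule for scalar multiplication, and it vanishes at both ends of \<open>{-c<..c}\<close>, outside
  of which all integrands are zero.\<close>

lemma primitive_imp_weak_derivative:
  fixes f :: "real \<Rightarrow> 'a::{real_inner,complete_space,second_countable_topology}"
  assumes p: "primitive f g" and f: "continuous_on UNIV f"
  shows "weak_derivative f g"
  unfolding weak_derivative_def
proof (intro allI impI)
  fix \<psi> assume "test_function \<psi>"
  then obtain c where \<psi>: "\<And>x. (\<psi> has_real_derivative deriv \<psi> x) (at x)" "continuous_on UNIV (deriv \<psi>)"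
    and c: "c > 0" "\<And>x. c \<le> \<bar>x\<bar> \<Longrightarrow> \<psi> x = 0" "\<And>x. c \<le> \<bar>x\<bar> \<Longrightarrow> deriv \<psi> x = 0"
    by (rule test_functionD) blast
  have \<psi>_cont: "continuous_on UNIV \<psi>"
    using \<psi>(1) by (meson DERIV_continuous_on)
  have g: "g \<in> borel_measurable lebesgue" "\<And>s t. set_integrable lebesgue {s<..t} g"
    using p by (auto simp: primitive_def)
  have "primitive \<psi> (deriv \<psi>)"
    by (rule primitive_C1) (use \<psi> in \<open>auto simp: has_real_derivative_iff_has_vector_derivative\<close>)
  let ?F' = "\<lambda>z::real \<times> 'a. 
      (blinfun_scaleR_right (fst z) o\<^sub>L snd_blinfun) + (blinfun_scaleR_left (snd z) o\<^sub>L fst_blinfun)"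
  from \<open>primitive \<psi> (deriv \<psi>)\<close> p have "primitive (\<lambda>s. (\<psi> s, f s)) (\<lambda>s. (deriv \<psi> s, g s))"
    by (rule primitive_Pair)
  then have "primitive (\<lambda>s. (\<lambda>z. fst z *\<^sub>R snd z) (\<psi> s, f s)) (\<lambda>s. ?F' (\<psi> s, f s) (deriv \<psi> s, g s))"
  proof (rule primitive_compose)
    show "continuous_on UNIV (\<lambda>s. (\<psi> s, f s))" by (intro continuous_intros f \<psi>_cont)
    show "continuous_on UNIV ?F'"
      by (intro continuous_intros bounded_bilinear.continuous_on[OF bounded_bilinear_blinfun_compose]
          bounded_linear.continuous_on[OF bounded_linear_blinfun_scaleR_right]
          bounded_linear.continuous_on[OF bounded_linear_blinfun_scaleR_left])
    show "((\<lambda>z. fst z *\<^sub>R snd z) has_derivative blinfun_apply (?F' z)) (at z)" for z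
      by (auto intro!: derivative_eq_intros simp: blinfun.add_left fun_eq_iff)
  qed auto
  then have P: "primitive (\<lambda>s. \<psi> s *\<^sub>R f s) (\<lambda>s. \<psi> s *\<^sub>R g s + deriv \<psi> s *\<^sub>R f s)"
    by (simp add: blinfun.add_left)
  have i: "integrable lebesgue (\<lambda>s. \<psi> s *\<^sub>R g s)" "integrable lebesgue (\<lambda>s. deriv \<psi> s *\<^sub>R f s)"
    by (rule integrable_compact_support_scaleR[where a=c];
        use \<psi> \<psi>_cont c g f borel_measurable_lebesgue_continuous set_integrable_Ioc_continuous in blast)+
  have "0 = \<psi> c *\<^sub>R f c - \<psi> (-c) *\<^sub>R f (-c)" using c by simp
  also have "\<dots> = (LINT s:{-c<..c}|lebesgue. \<psi> s *\<^sub>R g s + deriv \<psi> s *\<^sub>R f s)"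
    using P c(1) unfolding primitive_def by auto
  also have "\<dots> = (LINT s|lebesgue. \<psi> s *\<^sub>R g s + deriv \<psi> s *\<^sub>R f s)"
    unfolding set_lebesgue_integral_def
  proof (intro Bochner_Integration.integral_cong refl)
    fix x
    show "indicator {-c<..c} x *\<^sub>R (\<psi> x *\<^sub>R g x + deriv \<psi> x *\<^sub>R f x) = \<psi> x *\<^sub>R g x + deriv \<psi> x *\<^sub>R f x"
      using c(2,3)[of x] by (auto simp: indicator_def)
  qed
  also have "\<dots> = (LINT s|lebesgue. \<psi> s *\<^sub>R g s) + (LINT s|lebesgue. deriv \<psi> s *\<^sub>R f s)"
    using i by simp
  finally show "(LINT s|lebesgue. deriv \<psi> s *\<^sub>R f s) = - (LINT s|lebesgue. \<psi> s *\<^sub>R g s)"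
    by (simp add: eq_neg_iff_add_eq_0 add.commute)
qed

text \<open>The test function is the difference of a smooth step up at \<open>s\<close> and one at \<open>t\<close>, so that its
  derivative is a bump near \<open>s\<close> minus a bump near \<open>t\<close>.\<close>

lemma weak_derivative_zero_imp_const:
  fixes D :: "real \<Rightarrow> 'a::{real_inner,complete_space,second_countable_topology}"
  assumes D: "continuous_on UNIV D"
    and weak: "\<And>\<psi>. test_function \<psi> \<Longrightarrow> (LINT x|lebesgue. deriv \<psi> x *\<^sub>R D x) = 0"
    and st: "s < t"
  shows "D s = D t"
proof (rule ccontr)
  assume ne: "D s \<noteq> D t"
  define v where "v = D t - D s"
  define d where "d x = D x \<bullet> v" for x
  have "d t - d s = v \<bullet> v" by (simp add: d_def v_def inner_diff_left)
  moreover have "v \<bullet> v > 0" using ne by (simp add: v_def)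
  ultimately have less: "d s < d t" by linarith
  have d_cont: "continuous_on UNIV d" unfolding d_def by (intro continuous_intros D)
  \<comment> \<open>The midpoint separates the values of the real function \<open>d\<close>, so that
    by continuity \<open>d\<close> stays below \<open>m\<close> near \<open>s\<close> and above
    \<open>m\<close> near \<open>t\<close>.\<close>
  define m where "m = (d s + d t) / 2"
  have m: "d s < m" "m < d t" using less by (auto simp: m_def)
  have "isCont d s" "isCont d t" using d_cont by (auto simp: continuous_on_eq_continuous_at)
  then obtain e1 e2 where e1: "e1 > 0" "\<And>x. \<bar>x - s\<bar> < e1 \<Longrightarrow> \<bar>d x - d s\<bar> < m - d s"
    and e2: "e2 > 0" "\<And>x. \<bar>x - t\<bar> < e2 \<Longrightarrow> \<bar>d x - d t\<bar> < d t - m"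
    using m unfolding continuous_at_eps_delta real_norm_def dist_real_def by (metis diff_gt_0_iff_gt)
  define e where "e = min e1 e2 / 2"
  have e: "e > 0" "e < e1" "e < e2" using e1(1) e2(1) by (auto simp: e_def min_def)
  define \<tau> where "\<tau> = t - s"
  have "\<tau> > 0" using st by (simp add: \<tau>_def)
  define F where "F x = (if x > 0 then (1 / x) ^ 0 * exp (- (1 / x)) else (0::real))" for x
  have F: "smooth_fn F" "\<And>x. F x \<ge> 0" "\<And>x. F x > 0 \<longleftrightarrow> x > 0" "\<And>x. x \<le> 0 \<Longrightarrow> F x = 0"
    using smooth_fn.flat[of 0] by (auto simp: F_def[abs_def])
  \<comment> \<open>A bump positive exactly on \<open>s < x < s + e\<close>: one factor is flat at
    \<open>s\<close>, the other, reflected, at \<open>s + e\<close>.\<close>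
  define b where "b x = F (1 * x + (- s)) * F ((- 1) * x + (s + e))" for x
  have b_smooth: "smooth_fn b"
    unfolding b_def[abs_def] by (intro smooth_fn.mult smooth_fn.affine F)
  have b: "b x \<ge> 0" "b x > 0 \<longleftrightarrow> s < x \<and> x < s + e" "b x \<noteq> 0 \<longrightarrow> s < x \<and> x < s + e" for x
  proof -
    show "b x \<ge> 0" using F(2) by (simp add: b_def)
    show "b x > 0 \<longleftrightarrow> s < x \<and> x < s + e"
      using F(2)[of "x - s"] F(2)[of "s + e - x"] F(3)[of "x - s"] F(3)[of "s + e - x"]
      by (auto simp: b_def zero_less_mult_iff)
    then show "b x \<noteq> 0 \<longrightarrow> s < x \<and> x < s + e" using \<open>b x \<ge> 0\<close> by auto
  qed
  have "isCont b x" for x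
    using smooth_fn_continuous[OF b_smooth] by (simp add: continuous_on_eq_continuous_at)
  then obtain A where A: "\<And>x. (A has_real_derivative b x) (at x)"
    using einterval_antiderivative[of "-\<infinity>" "\<infinity>" b]
    by (auto simp: has_real_derivative_iff_has_vector_derivative)
  have A_const: "A x = A y" if "x \<le> y" "y \<le> s \<or> s + e \<le> x" for x y
  proof (cases "x < y")
    case True
    show ?thesis
    proof (rule DERIV_isconst_end[OF True, symmetric])
      show "continuous_on {x..y} A"
        using A by (meson DERIV_continuous_on has_field_derivative_at_within)
      show "DERIV A z :> 0" if "x < z" "z < y" for z
        using A[of z] b(3)[of z] that \<open>y \<le> s \<or> s + e \<le> x\<close> by auto
    qed
  qed (use that in simp)
  define \<psi> where "\<psi> x = A x - A (x - \<tau>)" for x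
  have \<psi>: "(\<psi> has_real_derivative (b x - b (x - \<tau>))) (at x)" for x
  proof -
    have "((\<lambda>x. A (x - \<tau>)) has_real_derivative b (x - \<tau>) * 1) (at x)"
      by (rule DERIV_chain2[OF A]) (auto intro!: derivative_eq_intros)
    then show ?thesis unfolding \<psi>_def using DERIV_diff[OF A] by simp
  qed
  have test: "test_function \<psi>"
  proof (rule test_functionI[where a=s and b="s + e + \<tau>"])
    show "(\<psi> has_real_derivative (b x + (- 1) * b (1 * x + (- \<tau>)))) (at x)" for x
      using \<psi>[of x] by simp
    show "smooth_fn (\<lambda>x. b x + (- 1) * b (1 * x + (- \<tau>)))"
      by (intro smooth_fn.add smooth_fn.scale smooth_fn.affine b_smooth)
    show "s \<le> x \<and> x \<le> s + e + \<tau>" if "\<psi> x \<noteq> 0" for x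
      using that A_const[of "x - \<tau>" x] \<open>\<tau> > 0\<close> by (force simp: \<psi>_def)
  qed
  have deriv: "deriv \<psi> x = b x - b (x - \<tau>)" for x
    by (rule DERIV_imp_deriv[OF \<psi>])
  obtain c where c: "continuous_on UNIV (deriv \<psi>)" "\<And>x. c \<le> \<bar>x\<bar> \<Longrightarrow> deriv \<psi> x = 0"
    using test_functionD[OF test] by metis
  have i: "integrable lebesgue (\<lambda>x. deriv \<psi> x *\<^sub>R f x)"
    if "continuous_on UNIV f" for f :: "real \<Rightarrow> 'b::{real_normed_vector,complete_space,second_countable_topology}"
    by (rule integrable_compact_support_scaleR[OF c borel_measurable_lebesgue_continuous[OF that]
        set_integrable_Ioc_continuous[OF that]])
  have "primitive (\<lambda>_. 1::real) (\<lambda>_. 0)"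
    by (rule primitive_C1) auto
  then have "weak_derivative (\<lambda>_. 1::real) (\<lambda>_. 0)"
    by (rule primitive_imp_weak_derivative) simp
  then have int_deriv: "(LINT x|lebesgue. deriv \<psi> x) = 0"
    using test by (simp add: weak_derivative_def)
  \<comment> \<open>Since \<open>deriv \<psi>\<close> has integral 0, subtracting \<open>d x\<close>
    from the constant \<open>m\<close> changes only the sign of a test integral that
    vanishes.\<close>
  have "(LINT x|lebesgue. deriv \<psi> x * (m - d x))
      = (LINT x|lebesgue. deriv \<psi> x * m - (deriv \<psi> x *\<^sub>R D x) \<bullet> v)"
    by (simp add: d_def algebra_simps)
  also have "\<dots> = (LINT x|lebesgue. deriv \<psi> x) * m - (LINT x|lebesgue. deriv \<psi> x *\<^sub>R D x) \<bullet> v"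
    using i[OF D] i[of "\<lambda>_. 1::real"]
    by (subst Bochner_Integration.integral_diff) (auto simp del: inner_scaleR_left)
  finally have zero: "(LINT x|lebesgue. deriv \<psi> x * (m - d x)) = 0"
    using int_deriv weak[OF test] by simp
  \<comment> \<open>Each bump sits where \<open>m - d x\<close> has the sign with which the bump
    enters \<open>deriv \<psi>\<close>, so the integrand is nonnegative. Its integral is 0, which
    contradicts its positivity on an interval.\<close>
  have part1: "b x * (m - d x) \<ge> 0" for x
    using b(1,3)[of x] e1(2)[of x] e by (cases "b x = 0") auto
  have part2: "b (x - \<tau>) * (m - d x) \<le> 0" for x
    using b(1,3)[of "x - \<tau>"] e2(2)[of x] e
    by (cases "b (x - \<tau>) = 0") (auto simp: \<tau>_def intro!: mult_nonneg_nonpos)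
  have nonneg: "deriv \<psi> x * (m - d x) \<ge> 0" for x
    using part1[of x] part2[of x] by (simp add: deriv left_diff_distrib)
  have "AE x in lebesgue. deriv \<psi> x * (m - d x) = 0"
    using integral_nonneg_eq_0_iff_AE[of lebesgue "\<lambda>x. deriv \<psi> x * (m - d x)"] nonneg zero
      i[OF continuous_on_diff[OF continuous_on_const d_cont]]
    by simp
  moreover have pos: "deriv \<psi> x * (m - d x) > 0" if "s < x" "x < s + e" for x
  proof -
    have "m - d x > 0" using e1(2)[of x] e that by auto
    then have "b x * (m - d x) > 0" using b(2) that by simp
    then show ?thesis using part2[of x] by (simp add: deriv left_diff_distrib)
  qed
  ultimately have "AE x in lebesgue. x \<notin> {s<..<s + e}"
    by (elim eventually_mono) (metis greaterThanLessThan_iff less_irrefl pos)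
  then have "{s<..<s + e} \<in> null_sets lebesgue"
    by (subst AE_iff_null_sets) auto
  then show False
    using e(1) by (simp add: null_sets_def)
qed

section \<open>Square integrable densities and weak derivatives\<close>

lemma square_integrable_set_integrable_Ioc:
  assumes "square_integrable g"
  shows "set_integrable lebesgue {s<..t} g"
proof (rule set_integrable_Ioc_dominated)
  show "g \<in> borel_measurable lebesgue" using assms by (simp add: square_integrable_def)
  show "set_integrable lebesgue {s<..t} (\<lambda>x. 1 + (norm (g x))\<^sup>2)"
    using assms set_integrable_Ioc_const[of s t "1::real"]
    by (intro set_integral_add)
      (auto simp: square_integrable_def set_integrable_def intro!: integrable_mult_indicator[where 'b=real, simplified])
  show "norm (g x) \<le> 1 + (norm (g x))\<^sup>2" for x
  proof -
    have "0 \<le> (norm (g x) - 1 / 2)\<^sup>2 + 3 / 4" by (intro add_nonneg_nonneg) auto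
    also have "\<dots> = 1 + (norm (g x))\<^sup>2 - norm (g x)" by (simp add: power2_eq_square algebra_simps)
    finally show ?thesis by simp
  qed
qed

text \<open>The weighted inequality \<open>norm (g x) \<le> r * (norm (g x))\<^sup>2 + 1 / r\<close>
  plays the role of Cauchy-Schwarz: the increment over \<open>{s<..t}\<close> is at most
  \<open>r * M + (t - s) / r\<close>, where \<open>r\<close> is chosen before the length of the
  interval.\<close>

lemma square_integrable_primitive_continuous:
  assumes p: "primitive f g" and g: "square_integrable g"
  shows "continuous_on UNIV f"
proof -
  define M where "M = (LINT x|lebesgue. (norm (g x))\<^sup>2)"
  have gi: "integrable lebesgue (\<lambda>x. (norm (g x))\<^sup>2)" using g by (simp add: square_integrable_def)
  have M: "M \<ge> 0" by (simp add: M_def)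
  have incr: "norm (f t - f s) \<le> r * M + (t - s) / r" if "s \<le> t" "r > 0" for s t r
  proof -
    have "norm (f t - f s) = norm (LINT x:{s<..t}|lebesgue. g x)"
      using p that by (simp add: primitive_def)
    also have "\<dots> \<le> (LINT x|lebesgue. r * (norm (g x))\<^sup>2 + indicator {s<..t} x * (1 / r))"
      unfolding set_lebesgue_integral_def
    proof (rule norm_integral_le)
      show "integrable lebesgue (\<lambda>x. indicator {s<..t} x *\<^sub>R g x)"
        using square_integrable_set_integrable_Ioc[OF g] by (simp add: set_integrable_def)
      show "integrable lebesgue (\<lambda>x. r * (norm (g x))\<^sup>2 + indicator {s<..t} x * (1 / r))"
        using gi set_integrable_Ioc_const[of s t "1 / r"]
        by (intro Bochner_Integration.integrable_add) (auto simp: set_integrable_def)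
      have "norm (g x) \<le> r * (norm (g x))\<^sup>2 + 1 / r" for x
      proof -
        have "0 \<le> (r * norm (g x) - 1 / 2)\<^sup>2 / r + 3 / (4 * r)" using \<open>r > 0\<close> by simp
        also have "\<dots> = r * (norm (g x))\<^sup>2 + 1 / r - norm (g x)"
          using \<open>r > 0\<close> by (simp add: field_simps power2_eq_square)
        finally show ?thesis by simp
      qed
      then show "AE x in lebesgue. norm (indicator {s<..t} x *\<^sub>R g x)
          \<le> r * (norm (g x))\<^sup>2 + indicator {s<..t} x * (1 / r)"
        using \<open>r > 0\<close> by (auto simp: indicator_def)
    qed
    also have "\<dots> = r * M + (LINT x:{s<..t}|lebesgue. 1 / r)"
      using gi set_integrable_Ioc_const[of s t "1 / r"] unfolding M_def set_lebesgue_integral_def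
      by (subst Bochner_Integration.integral_add) (auto simp: set_integrable_def)
    also have "(LINT x:{s<..t}|lebesgue. 1 / r) = (t - s) / r"
      using that by (simp add: set_lebesgue_integral_def)
    finally show ?thesis .
  qed
  have "isCont f s" for s
    unfolding continuous_at_eps_delta
  proof (intro allI impI)
    fix e :: real assume e: "e > 0"
    define r where "r = e / (2 * (M + 1))"
    have r: "r > 0" unfolding r_def using e M by (intro divide_pos_pos mult_pos_pos add_nonneg_pos) auto
    have "r * M \<le> r * (M + 1)" using r by simp
    also have "r * (M + 1) = e / 2" using M by (simp add: r_def field_simps)
    finally have rM: "r * M \<le> e / 2" .
    have "dist (f t) (f s) < e" if "dist t s < r * e / 2" for t
    proof -
      have *: "\<bar>t - s\<bar> / r < e / 2" using that r by (simp add: dist_real_def field_simps)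
      have "norm (f t - f s) \<le> r * M + \<bar>t - s\<bar> / r"
        using incr[of s t r] incr[of t s r] r by (cases "s \<le> t") (auto simp: norm_minus_commute)
      then show ?thesis using * rM unfolding dist_norm by linarith
    qed
    then show "\<exists>d>0. \<forall>t. dist t s < d \<longrightarrow> dist (f t) (f s) < e"
      using r e by (intro exI[of _ "r * e / 2"]) auto
  qed
  then show ?thesis by (simp add: continuous_on_eq_continuous_at)
qed

text \<open>The witness is the oriented integral from 0: of the two integrals over
  \<open>{0<..t}\<close> and \<open>{t<..0}\<close> at least one is over the empty set.\<close>

lemma square_integrable_primitive_exists:
  assumes g: "square_integrable g"
  obtains G where "primitive G g"
proof
  note i = square_integrable_set_integrable_Ioc[OF g]
  let ?I = "\<lambda>s t. LINT x:{s<..t}|lebesgue. g x"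
  have null: "?I s t = 0" if "t \<le> s" for t s
    using that by (simp add: set_lebesgue_integral_def)
  have split: "?I s u = ?I s t + ?I t u" if "s \<le> t" "t \<le> u" for s t u
    by (rule set_integral_Ioc_split[OF i i that])
  have "(?I 0 t - ?I t 0) - (?I 0 s - ?I s 0) = ?I s t" if "s \<le> t" for s t
  proof -
    consider "0 \<le> s" | "s \<le> 0" "0 \<le> t" | "t \<le> 0" by linarith
    then show ?thesis
    proof cases
      case 1
      then show ?thesis using split[OF 1 that] null[of 0 s] null[of 0 t] that by simp
    next
      case 2
      then show ?thesis using split[OF 2] null[of s 0] null[of 0 t] by simp
    next
      case 3
      then show ?thesis using split[OF that 3] null[of s 0] null[of t 0] that by simp
    qed
  qed
  then show "primitive (\<lambda>t. ?I 0 t - ?I t 0) g"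
    using g i by (auto simp: primitive_def square_integrable_def)
qed

text \<open>If \<open>G\<close> is a primitive of \<open>g\<close>, then \<open>f - G\<close> has
  weak derivative 0 and is therefore constant, so \<open>f\<close> has the same increments as
  \<open>G\<close>.\<close>

lemma weak_derivative_imp_primitive:
  assumes f: "continuous_on UNIV f" and g: "square_integrable g" and w: "weak_derivative f g"
  shows "primitive f g"
proof -
  obtain G where G: "primitive G g"
    by (rule square_integrable_primitive_exists[OF g])
  note G_cont = square_integrable_primitive_continuous[OF G g]
  have wG: "weak_derivative G g" by (rule primitive_imp_weak_derivative[OF G G_cont])
  have "f s - G s = f t - G t" if st: "s < t" for s t
  proof (rule weak_derivative_zero_imp_const[OF _ _ st])
    show "continuous_on UNIV (\<lambda>s. f s - G s)" by (intro continuous_intros f G_cont)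
    fix \<psi> assume \<psi>: "test_function \<psi>"
    then obtain c where c: "continuous_on UNIV (deriv \<psi>)" "\<And>x. c \<le> \<bar>x\<bar> \<Longrightarrow> deriv \<psi> x = 0"
      using test_functionD by metis
    have i: "integrable lebesgue (\<lambda>x. deriv \<psi> x *\<^sub>R h x)" if "continuous_on UNIV h" for h :: "real \<Rightarrow> 'a"
      by (rule integrable_compact_support_scaleR[OF c borel_measurable_lebesgue_continuous[OF that]
          set_integrable_Ioc_continuous[OF that]])
    show "(LINT x|lebesgue. deriv \<psi> x *\<^sub>R (f x - G x)) = 0"
      using w wG \<psi> i[OF f] i[OF G_cont] by (simp add: scaleR_diff_right weak_derivative_def)
  qed
  then have eq: "f t - f s = G t - G s" if "s \<le> t" for s t
    using that by (cases "s = t") (auto simp: algebra_simps)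
  then show ?thesis using G by (auto simp: primitive_def)
qed

section \<open>Uniqueness of the density almost everywhere\<close>

text \<open>The positive and negative parts of \<open>w\<close>, obtained by \<open>ennreal\<close>
  sending negative numbers to 0, are densities of two finite measures that agree on half-lines.
  Half-lines determine such measures, and densities are unique almost everywhere, so the two parts
  coincide.\<close>

lemma AE_zero_if_half_line_integrals_zero:
  assumes w: "integrable lborel (w :: real \<Rightarrow> real)" and 0: "\<And>x. (LINT y:{x<..}|lborel. w y) = 0"
  shows "AE x in lborel. w x = 0"
proof -
  have [measurable]: "w \<in> borel_measurable lborel" using w by auto
  have i: "integrable lborel (\<lambda>y. indicator {x<..} y * max 0 (w y))"
    "integrable lborel (\<lambda>y. indicator {x<..} y * max 0 (- w y))" for x
    using w by (auto intro!: integrable_mult_indicator[where 'b=real, simplified] integrable_max)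
  have em: "emeasure (density lborel (\<lambda>y. ennreal (u y))) {x<..}
      = ennreal (LINT y|lborel. indicator {x<..} y * max 0 (u y))"
    if [measurable]: "u \<in> borel_measurable lborel"
      and "integrable lborel (\<lambda>y. indicator {x<..} y * max 0 (u y))" for u :: "real \<Rightarrow> real" and x
  proof -
    have "emeasure (density lborel (\<lambda>y. ennreal (u y))) {x<..}
        = (\<integral>\<^sup>+y. ennreal (indicator {x<..} y * max 0 (u y)) \<partial>lborel)"
      by (subst emeasure_density)
        (auto intro!: nn_integral_cong simp: indicator_def max_def ennreal_neg)
    also have "\<dots> = ennreal (LINT y|lborel. indicator {x<..} y * max 0 (u y))"
      by (rule nn_integral_eq_integral[OF that(2)]) (auto simp: indicator_def)
    finally show ?thesis .
  qed
  have "density lborel (\<lambda>y. ennreal (w y)) = density lborel (\<lambda>y. ennreal (- w y))"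
  proof (rule measure_eqI_lessThan)
    fix x
    show "emeasure (density lborel (\<lambda>y. ennreal (w y))) {x<..} < \<infinity>"
      using em[of w x] i by simp
    have "(LINT y|lborel. indicator {x<..} y * max 0 (w y)) - (LINT y|lborel. indicator {x<..} y * max 0 (- w y))
        = (LINT y:{x<..}|lborel. w y)"
      unfolding set_lebesgue_integral_def
      by (subst Bochner_Integration.integral_diff[OF i, symmetric])
        (auto intro!: Bochner_Integration.integral_cong simp: indicator_def max_def)
    then have "(LINT y|lborel. indicator {x<..} y * max 0 (w y)) = (LINT y|lborel. indicator {x<..} y * max 0 (- w y))"
      using 0[of x] by simp
    then show "emeasure (density lborel (\<lambda>y. ennreal (w y))) {x<..}
        = emeasure (density lborel (\<lambda>y. ennreal (- w y))) {x<..}"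
      using em[of w x] em[of "\<lambda>y. - w y" x] i by simp
  qed auto
  then have "AE x in lborel. ennreal (w x) = ennreal (- w x)"
    by (subst (asm) sigma_finite_measure.density_unique_iff[OF sigma_finite_lborel]) auto
  then show ?thesis
    by eventually_elim (metis add.inverse_inverse ennreal_eq_0_iff ennreal_neg le_cases neg_le_0_iff_le order_antisym)
qed

text \<open>Cutting off to \<open>{- real n<..real n}\<close> gives global integrability, and a
  Borel representative \<open>w\<close> of the cut-off function moves the question from the
  completed measure to \<open>lborel\<close>, where half-line integrals decide it.\<close>

lemma AE_zero_if_Ioc_integrals_zero_real:
  fixes u :: "real \<Rightarrow> real"
  assumes i: "\<And>s t. set_integrable lebesgue {s<..t} u"
    and 0: "\<And>s t. s \<le> t \<Longrightarrow> (LINT x:{s<..t}|lebesgue. u x) = 0"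
  shows "AE x in lebesgue. u x = 0"
proof -
  have "AE x in lebesgue. indicator {- real n<..real n} x * u x = 0" for n
  proof -
    let ?v = "\<lambda>x. indicator {- real n<..real n} x * u x"
    have v: "integrable lebesgue ?v" using i by (simp add: set_integrable_def)
    then obtain w where w[measurable]: "w \<in> borel_measurable lborel" and eq: "AE x in lborel. ?v x = w x"
      using completion_ex_borel_measurable_real[of ?v lborel] by auto
    have eq': "AE x in lebesgue. ?v x = w x" by (rule AE_completion[OF eq])
    have w_leb: "w \<in> borel_measurable lebesgue" by (rule measurable_completion) simp
    have "integrable lebesgue w"
      using integrable_cong_AE[OF _ w_leb eq'] v by auto
    then have wi: "integrable lborel w" by (subst (asm) integrable_completion) auto
    have "(LINT y:{x<..}|lborel. w y) = 0" for x
    proof -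
      have "(LINT y:{x<..}|lborel. w y) = (LINT y|lebesgue. indicator {x<..} y * w y)"
        unfolding set_lebesgue_integral_def by (subst integral_completion) auto
      also have "\<dots> = (LINT y|lebesgue. indicator {x<..} y * ?v y)"
      proof (rule integral_cong_AE)
        show "(\<lambda>y. indicator {x<..} y * w y) \<in> borel_measurable lebesgue"
          by (rule measurable_completion) simp
        show "(\<lambda>y. indicator {x<..} y * ?v y) \<in> borel_measurable lebesgue"
          by (intro borel_measurable_times[OF borel_measurable_indicator borel_measurable_integrable[OF v]]) auto
        show "AE y in lebesgue. indicator {x<..} y * w y = indicator {x<..} y * ?v y"
          using eq' by eventually_elim simp
      qed
      \<comment> \<open>This is the intersection of the half-line with the cut-off interval; the
        outer \<open>max\<close> orders the endpoints unconditionally, as assumption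
        \<open>0\<close> requires.\<close>
      also have "\<dots> = (LINT y:{max x (- real n)<..max (max x (- real n)) (real n)}|lebesgue. u y)"
        if "x < real n"
        unfolding set_lebesgue_integral_def using that
        by (intro Bochner_Integration.integral_cong) (auto simp: indicator_def)
      moreover have "(LINT y|lebesgue. indicator {x<..} y * ?v y) = 0" if "\<not> x < real n"
      proof -
        have "(\<lambda>y. indicator {x<..} y * ?v y) = (\<lambda>_. 0)"
          using that by (auto simp: indicator_def fun_eq_iff)
        then show ?thesis by (simp only: Bochner_Integration.integral_zero)
      qed
      ultimately show ?thesis
        using 0[of "max x (- real n)" "max (max x (- real n)) (real n)"] by (cases "x < real n") auto
    qed
    from AE_zero_if_half_line_integrals_zero[OF wi this]
    have "AE x in lebesgue. w x = 0" by (rule AE_completion)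
    with eq' show ?thesis by eventually_elim simp
  qed
  then have "AE x in lebesgue. \<forall>n. indicator {- real n<..real n} x * u x = 0"
    by (simp only: AE_all_countable simp_thms)
  then show ?thesis
  proof eventually_elim
    fix x assume *: "\<forall>n. indicator {- real n<..real n} x * u x = 0"
    obtain n where "\<bar>x\<bar> < real n" using reals_Archimedean2 by blast
    then have "indicator {- real n<..real n} x = (1::real)" by (auto simp: indicator_def)
    then show "u x = 0" using *[rule_format, of n] by simp
  qed
qed

text \<open>Separability provides countably many test vectors, hence one null set off which
  \<open>u x\<close> is orthogonal to a dense set and therefore 0.\<close>

lemma AE_zero_if_Ioc_integrals_zero:
  fixes u :: "real \<Rightarrow> 'a::{real_inner,second_countable_topology}"
  assumes i: "\<And>s t. set_integrable lebesgue {s<..t} u"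
    and 0: "\<And>s t. s \<le> t \<Longrightarrow> (LINT x:{s<..t}|lebesgue. u x) = 0"
  shows "AE x in lebesgue. u x = 0"
proof -
  obtain V :: "'a set" where V: "countable V" "\<And>X. open X \<Longrightarrow> X \<noteq> {} \<Longrightarrow> \<exists>v\<in>V. v \<in> X"
    by (rule countable_dense_setE) blast
  have "AE x in lebesgue. u x \<bullet> v = 0" for v
  proof (rule AE_zero_if_Ioc_integrals_zero_real)
    show "set_integrable lebesgue {s<..t} (\<lambda>x. u x \<bullet> v)" for s t
      using integrable_inner_left[of v lebesgue "\<lambda>x. indicator {s<..t} x *\<^sub>R u x"] i[of s t]
      by (simp add: set_integrable_def)
    show "(LINT x:{s<..t}|lebesgue. u x \<bullet> v) = 0" if "s \<le> t" for s t
      using integral_inner_left[of v lebesgue "\<lambda>x. indicator {s<..t} x *\<^sub>R u x"] i[of s t] 0[OF that]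
      by (simp add: set_integrable_def set_lebesgue_integral_def)
  qed
  then have "AE x in lebesgue. \<forall>v\<in>V. u x \<bullet> v = 0"
    by (simp add: AE_ball_countable[OF V(1)])
  then show ?thesis
  proof eventually_elim
    fix x assume *: "\<forall>v\<in>V. u x \<bullet> v = 0"
    show "u x = 0"
    proof (rule ccontr)
      assume ne: "u x \<noteq> 0"
      then obtain v where v: "v \<in> V" "v \<in> ball (u x) (norm (u x))"
        using V(2)[of "ball (u x) (norm (u x))"] by auto
      have "norm (u x) * norm (u x) = u x \<bullet> (u x - v)"
        using * v(1) by (simp add: inner_diff_right dot_square_norm power2_eq_square)
      also have "\<dots> \<le> norm (u x) * norm (u x - v)" by (rule norm_cauchy_schwarz)
      also have "\<dots> < norm (u x) * norm (u x)"
        using v(2) ne by (intro mult_strict_left_mono) (auto simp: dist_norm)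
      finally show False by simp
    qed
  qed
qed

text \<open>The difference of the densities integrates to 0 over every interval. This makes the
  arbitrary choice in \<open>wderiv\<close> harmless.\<close>

lemma primitive_unique:
  fixes f :: "real \<Rightarrow> 'a::{real_inner,second_countable_topology}"
  assumes "primitive f g" "primitive f h"
  shows "AE x in lebesgue. g x = h x"
proof -
  have "AE x in lebesgue. g x - h x = 0"
  proof (rule AE_zero_if_Ioc_integrals_zero)
    show "set_integrable lebesgue {s<..t} (\<lambda>x. g x - h x)" for s t
      using assms by (auto simp: primitive_def set_integrable_def scaleR_diff_right)
    show "(LINT x:{s<..t}|lebesgue. g x - h x) = 0" if "s \<le> t" for s t
    proof -
      have "(LINT x:{s<..t}|lebesgue. g x - h x) = (LINT x:{s<..t}|lebesgue. g x) - (LINT x:{s<..t}|lebesgue. h x)"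
        using assms by (auto simp: primitive_def set_integrable_def set_lebesgue_integral_def scaleR_diff_right)
      then show ?thesis using assms that by (auto simp: primitive_def)
    qed
  qed
  then show ?thesis by simp
qed

section \<open>The norm of the function space\<close>

text \<open>Lebesgue measure is complete, so changes on null sets preserve measurability; this
  disposes of the values of \<open>inv i\<close> outside the range of \<open>i\<close>.\<close>

lemma borel_measurable_lebesgue_cong_AE:
  fixes f g :: "real \<Rightarrow> 'a::topological_space"
  assumes f: "f \<in> borel_measurable lebesgue" and eq: "AE s in lebesgue. f s = g s"
  shows "g \<in> borel_measurable lebesgue"
proof (rule measurableI)
  fix A :: "'a set" assume "A \<in> sets borel"
  then have "f -` A \<inter> space lebesgue \<in> sets lebesgue" by (rule measurable_sets[OF f])
  then show "g -` A \<inter> space lebesgue \<in> sets lebesgue"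
    by (rule completion.in_sets_AE[rotated]) (use eq in \<open>auto elim!: eventually_mono\<close>)
qed simp

definition l2sq :: "(real \<Rightarrow> 'a::real_normed_vector) \<Rightarrow> real" where
  "l2sq f = (LINT s|lebesgue. (norm (f s))\<^sup>2)"

lemma l2sq_nonneg [simp]: "0 \<le> l2sq f"
  by (simp add: l2sq_def)

text \<open>The inequality \<open>(x + y + z)\<^sup>2 \<le> 3 * (x\<^sup>2 + y\<^sup>2 +
  z\<^sup>2)\<close> replaces the triangle inequality in L2, since the norm of the space is computed
  through its square. The increment of the derivative has three summands; shorter estimates set
  coefficients to 0.\<close>

lemma square_integrable_l2sq_bound:
  assumes f: "f \<in> borel_measurable lebesgue"
    and p: "square_integrable p" and q: "square_integrable q" and r: "square_integrable r"
    and le: "AE s in lebesgue. norm (f s) \<le> a * norm (p s) + b * norm (q s) + c * norm (r s)"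
  shows "square_integrable f" "l2sq f \<le> 3 * (a\<^sup>2 * l2sq p + b\<^sup>2 * l2sq q + c\<^sup>2 * l2sq r)"
proof -
  let ?h = "\<lambda>s. 3 * (a\<^sup>2 * (norm (p s))\<^sup>2 + b\<^sup>2 * (norm (q s))\<^sup>2 + c\<^sup>2 * (norm (r s))\<^sup>2)"
  have h: "integrable lebesgue ?h"
    using p q r by (simp add: square_integrable_def)
  have sq: "(x + y + z)\<^sup>2 \<le> 3 * (x\<^sup>2 + y\<^sup>2 + z\<^sup>2)" for x y z :: real
  proof -
    have "0 \<le> (x - y)\<^sup>2 + (y - z)\<^sup>2 + (x - z)\<^sup>2" by simp
    also have "\<dots> = 3 * (x\<^sup>2 + y\<^sup>2 + z\<^sup>2) - (x + y + z)\<^sup>2"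
      by (simp add: power2_eq_square algebra_simps)
    finally show ?thesis by simp
  qed
  have le': "AE s in lebesgue. (norm (f s))\<^sup>2 \<le> ?h s"
    using le
  proof eventually_elim
    fix s assume "norm (f s) \<le> a * norm (p s) + b * norm (q s) + c * norm (r s)"
    then have "(norm (f s))\<^sup>2 \<le> (a * norm (p s) + b * norm (q s) + c * norm (r s))\<^sup>2"
      by (intro power_mono) auto
    also have "\<dots> \<le> ?h s" using sq by (metis power_mult_distrib)
    finally show "(norm (f s))\<^sup>2 \<le> ?h s" .
  qed
  have i: "integrable lebesgue (\<lambda>s. (norm (f s))\<^sup>2)"
  proof (rule Bochner_Integration.integrable_bound[OF h])
    show "(\<lambda>s. (norm (f s))\<^sup>2) \<in> borel_measurable lebesgue"
      using f by measurable
    show "AE s in lebesgue. norm ((norm (f s))\<^sup>2) \<le> norm (?h s)"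
      using le' by eventually_elim simp
  qed
  then show "square_integrable f" using f by (simp add: square_integrable_def)
  have "l2sq f \<le> (LINT s|lebesgue. ?h s)"
    unfolding l2sq_def by (rule integral_mono_AE[OF i h le'])
  also have "\<dots> = 3 * (a\<^sup>2 * l2sq p + b\<^sup>2 * l2sq q + c\<^sup>2 * l2sq r)"
    using p q r by (simp add: l2sq_def square_integrable_def)
  finally show "l2sq f \<le> 3 * (a\<^sup>2 * l2sq p + b\<^sup>2 * l2sq q + c\<^sup>2 * l2sq r)" .
qed

lemma square_integrable_scaleR:
  assumes "square_integrable f" shows "square_integrable (\<lambda>s. c *\<^sub>R f s)"
  using assms by (auto simp: square_integrable_def power_mult_distrib)

lemma square_integrable_add:
  assumes f: "square_integrable f" and g: "square_integrable g"
  shows "square_integrable (\<lambda>s. f s + g s)"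
proof (rule square_integrable_l2sq_bound(1)[OF _ f g f, where a=1 and b=1 and c=0])
  show "(\<lambda>s. f s + g s) \<in> borel_measurable lebesgue"
    using f g by (intro borel_measurable_add) (auto simp: square_integrable_def)
qed (auto simp: norm_triangle_ineq)

lemma primitive_add:
  assumes "primitive f g" "primitive f' g'"
  shows "primitive (\<lambda>s. f s + f' s) (\<lambda>s. g s + g' s)"
  using assms unfolding primitive_def set_integrable_def set_lebesgue_integral_def
  by (auto simp: scaleR_add_right intro!: borel_measurable_add) (metis add_diff_add)

lemma primitive_scaleR:
  assumes "primitive f g" shows "primitive (\<lambda>s. c *\<^sub>R f s) (\<lambda>s. c *\<^sub>R g s)"
proof -
  have "set_integrable lebesgue {s<..t} (\<lambda>s. c *\<^sub>R g s)" for s t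
    using assms by (auto simp: primitive_def intro!: set_integrable_scaleR_right)
  then show ?thesis
    using assms by (auto simp: primitive_def scaleR_diff_right[symmetric] intro!: borel_measurable_scaleR)
qed

text \<open>A function \<open>u\<close> in \<open>W\<^sup>1\<^sup>,\<^sup>2(H\<^sub>1) \<inter> L\<^sup>2(H\<^sub>2)\<close> together with explicit representatives \<open>g\<close> of its weak
  derivative and \<open>k\<close> of \<open>u\<close> as an \<open>H\<^sub>2\<close>-valued function; unlike \<open>wderiv u\<close> and \<open>inv i \<circ> u\<close>, these
  are free of arbitrary choices and junk values.\<close>

definition repr ::
  "('h2::{real_inner,complete_space,second_countable_topology} \<Rightarrow>
    'h1::{real_inner,complete_space,second_countable_topology}) \<Rightarrow>
   (real \<Rightarrow> 'h1) \<Rightarrow> (real \<Rightarrow> 'h1) \<Rightarrow> (real \<Rightarrow> 'h2) \<Rightarrow> bool" where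
  "repr i u g k \<longleftrightarrow> continuous_on UNIV u \<and> primitive u g \<and> square_integrable g \<and>
     square_integrable k \<and> (AE s in lebesgue. u s = i (k s))"

lemma
  assumes "dense_inclusion i"
  shows dense_inclusion_linear: "linear i"
    and dense_inclusion_bounded_linear: "bounded_linear i"
    and dense_inclusion_norm_le: "norm (i x) \<le> norm x"
    and dense_inclusion_inv: "inv i (i x) = x"
    and dense_inclusion_inj: "i x = i y \<Longrightarrow> x = y"
proof -
  have i: "linear i" "inj i" "\<And>x. norm (i x) \<le> norm x" using assms by (auto simp: dense_inclusion_def)
  then show "linear i" "norm (i x) \<le> norm x" "inv i (i x) = x" "i x = i y \<Longrightarrow> x = y"
    by (auto simp: inj_eq)
  show "bounded_linear i"
    using i by (intro bounded_linear.intro bounded_linear_axioms.intro exI[of _ 1]) auto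
qed

lemma square_integrable_imp_norm_bound:
  assumes g: "square_integrable g" and f: "f \<in> borel_measurable lebesgue"
    and le: "AE s in lebesgue. norm (f s) \<le> norm (g s)"
  shows "square_integrable f"
  by (rule square_integrable_l2sq_bound(1)[OF f g g g, where a=1 and b=0 and c=0]) (use le in simp)

text \<open>The norm can be computed from any representatives: \<open>wderiv u\<close> agrees with
  \<open>g\<close> almost everywhere by uniqueness of densities, and \<open>inv i (u s)\<close> with
  \<open>k s\<close> by injectivity of \<open>i\<close>.\<close>

lemma repr_imp_W12_L2:
  assumes i: "dense_inclusion i" and r: "repr i u g k"
  shows "u \<in> W12_L2 i" "(W12_L2_norm i u)\<^sup>2 = l2sq g + l2sq k"
proof -
  have u: "continuous_on UNIV u" and p: "primitive u g" and g: "square_integrable g"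
    and k: "square_integrable k" and eq: "AE s in lebesgue. u s = i (k s)"
    using r by (auto simp: repr_def)
  have "square_integrable u"
    by (rule square_integrable_imp_norm_bound[OF k borel_measurable_lebesgue_continuous[OF u]])
      (use eq dense_inclusion_norm_le[OF i] in \<open>auto elim!: eventually_mono\<close>)
  moreover have w: "weak_derivative u g" by (rule primitive_imp_weak_derivative[OF p u])
  ultimately have "u \<in> W12" using u g by (auto simp: W12_def)
  moreover have "AE s in lebesgue. u s \<in> range i" using eq by eventually_elim simp
  moreover have inv: "AE s in lebesgue. k s = inv i (u s)"
    using eq by eventually_elim (simp add: dense_inclusion_inv[OF i])
  moreover have invm: "(\<lambda>s. inv i (u s)) \<in> borel_measurable lebesgue"
    by (rule borel_measurable_lebesgue_cong_AE[OF _ inv]) (use k in \<open>simp add: square_integrable_def\<close>)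
  moreover have "square_integrable (\<lambda>s. inv i (u s))"
    by (rule square_integrable_imp_norm_bound[OF k invm]) (use inv in \<open>auto elim!: eventually_mono\<close>)
  ultimately show "u \<in> W12_L2 i" by (simp add: W12_L2_def)
  have "square_integrable (wderiv u) \<and> weak_derivative u (wderiv u)"
    unfolding wderiv_def by (rule someI[of _ g]) (use g w in simp)
  then have wd: "square_integrable (wderiv u)" "AE s in lebesgue. wderiv u s = g s"
    using primitive_unique[OF weak_derivative_imp_primitive[OF u] p] by auto
  have "(LINT s|lebesgue. wderiv u s \<bullet> wderiv u s) = (LINT s|lebesgue. (norm (g s))\<^sup>2)"
  proof (rule integral_cong_AE)
    show "(\<lambda>s. wderiv u s \<bullet> wderiv u s) \<in> borel_measurable lebesgue"
      using wd(1) by (intro borel_measurable_inner) (auto simp: square_integrable_def)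
    show "(\<lambda>s. (norm (g s))\<^sup>2) \<in> borel_measurable lebesgue"
      using g by (auto simp: square_integrable_def)
    show "AE s in lebesgue. wderiv u s \<bullet> wderiv u s = (norm (g s))\<^sup>2"
      using wd(2) by eventually_elim (simp add: dot_square_norm)
  qed
  moreover have "(LINT s|lebesgue. inv i (u s) \<bullet> inv i (u s)) = (LINT s|lebesgue. (norm (k s))\<^sup>2)"
  proof (rule integral_cong_AE)
    show "(\<lambda>s. inv i (u s) \<bullet> inv i (u s)) \<in> borel_measurable lebesgue"
      using invm by (intro borel_measurable_inner)
    show "(\<lambda>s. (norm (k s))\<^sup>2) \<in> borel_measurable lebesgue"
      using k by (auto simp: square_integrable_def)
    show "AE s in lebesgue. inv i (u s) \<bullet> inv i (u s) = (norm (k s))\<^sup>2"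
      using inv by eventually_elim (metis dot_square_norm)
  qed
  ultimately have "W12_L2_inner i u u = l2sq g + l2sq k"
    by (simp add: W12_L2_inner_def l2sq_def)
  then show "(W12_L2_norm i u)\<^sup>2 = l2sq g + l2sq k"
    by (simp add: W12_L2_norm_def add_nonneg_nonneg)
qed

lemma W12_L2_imp_repr:
  assumes "u \<in> W12_L2 i"
  obtains g where "repr i u g (\<lambda>s. inv i (u s))"
proof -
  obtain g where "continuous_on UNIV u" "square_integrable g" "weak_derivative u g"
    using assms by (auto simp: W12_L2_def W12_def)
  moreover from this have "primitive u g" by (intro weak_derivative_imp_primitive)
  moreover have "AE s in lebesgue. u s = i (inv i (u s))"
    using assms by (auto simp: W12_L2_def f_inv_into_f elim!: eventually_mono)
  ultimately have "repr i u g (\<lambda>s. inv i (u s))"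
    using assms by (simp add: repr_def W12_L2_def)
  then show thesis by (rule that)
qed

lemma W12_L2_norm_nonneg: "W12_L2_norm i u \<ge> 0"
  by (auto simp: W12_L2_norm_def W12_L2_inner_def intro!: real_sqrt_ge_zero add_nonneg_nonneg)

lemma repr_add:
  assumes i: "dense_inclusion i" and "repr i u g k" "repr i u' g' k'"
  shows "repr i (u + u') (\<lambda>s. g s + g' s) (\<lambda>s. k s + k' s)"
proof -
  have "AE s in lebesgue. u s = i (k s)" "AE s in lebesgue. u' s = i (k' s)"
    using assms by (auto simp: repr_def)
  then have "AE s in lebesgue. u s + u' s = i (k s + k' s)"
    by eventually_elim (simp add: linear_add[OF dense_inclusion_linear[OF i]])
  then show ?thesis
    using assms by (auto simp: repr_def plus_fun_def intro!: continuous_on_add primitive_add square_integrable_add)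
qed

lemma repr_scaleR:
  assumes i: "dense_inclusion i" and "repr i u g k"
  shows "repr i (\<lambda>s. c *\<^sub>R u s) (\<lambda>s. c *\<^sub>R g s) (\<lambda>s. c *\<^sub>R k s)"
proof -
  have "AE s in lebesgue. u s = i (k s)" using assms by (auto simp: repr_def)
  then have "AE s in lebesgue. c *\<^sub>R u s = i (c *\<^sub>R k s)"
    by eventually_elim (simp add: linear_scale[OF dense_inclusion_linear[OF i]])
  then show ?thesis
    using assms by (auto simp: repr_def intro!: continuous_on_scaleR primitive_scaleR square_integrable_scaleR)
qed

lemma repr_diff:
  assumes i: "dense_inclusion i" and u: "repr i u g k" and u': "repr i u' g' k'"
  shows "repr i (u - u') (\<lambda>s. g s - g' s) (\<lambda>s. k s - k' s)"
proof -
  have eq: "u - u' = u + (\<lambda>s. - u' s)" by (simp add: fun_eq_iff)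
  show ?thesis
    unfolding eq using repr_add[OF i u repr_scaleR[OF i u', of "-1"]] by simp
qed

section \<open>Supremum bound, decay at infinity and compactness of the range\<close>

text \<open>A Sobolev estimate on the unit interval after \<open>t\<close>:
  \<open>norm (u t)\<close> is at most \<open>norm (u s)\<close> plus the integral of
  \<open>norm (g s)\<close>, and averaging the squares over \<open>s\<close> introduces
  \<open>k\<close>. The bound is kept local so that it gives both the supremum bound and the decay
  at infinity.\<close>

lemma repr_norm_square_le:
  assumes i: "dense_inclusion i" and r: "repr i u g k"
  shows "(norm (u t))\<^sup>2 \<le> 2 * (LINT s:{t<..t + 1}|lebesgue. (norm (k s))\<^sup>2 + (norm (g s))\<^sup>2)"
proof -
  have u: "continuous_on UNIV u" and p: "primitive u g" and g: "square_integrable g"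
    and k: "square_integrable k" and eq: "AE s in lebesgue. u s = i (k s)"
    using r by (auto simp: repr_def)
  let ?S = "{t<..t + 1}"
  have gi: "set_integrable lebesgue {a<..b} g" and ng: "set_integrable lebesgue {a<..b} (\<lambda>s. norm (g s))" for a b
    using square_integrable_set_integrable_Ioc[OF g] set_integrable_norm_Ioc by blast+
  have sq: "set_integrable lebesgue ?S (\<lambda>s. (norm (f s))\<^sup>2)" if "square_integrable f"
    for f :: "real \<Rightarrow> 'c::{real_inner,complete_space,second_countable_topology}"
    using that unfolding set_integrable_def
    by (intro integrable_mult_indicator) (auto simp: square_integrable_def)
  have const: "set_integrable lebesgue ?S (\<lambda>s. c)" "(LINT s:?S|lebesgue. c) = c" for c :: real
    using set_integrable_Ioc_const by (auto simp: set_lebesgue_integral_def)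
  define G where "G = (LINT s:?S|lebesgue. norm (g s))"
  define G2 where "G2 = (LINT s:?S|lebesgue. (norm (g s))\<^sup>2)"
  \<comment> \<open>Nonnegativity of the variance of \<open>norm (g s)\<close> on an interval of
    length 1 gives \<open>G\<^sup>2 \<le> G2\<close>.\<close>
  have "0 \<le> (LINT s:?S|lebesgue. (norm (g s) - G)\<^sup>2)"
    unfolding set_lebesgue_integral_def by (intro Bochner_Integration.integral_nonneg) simp
  also have "\<dots> = (LINT s:?S|lebesgue. ((norm (g s))\<^sup>2 - 2 * G * norm (g s)) + G\<^sup>2)"
    by (simp add: power2_diff algebra_simps)
  also have "\<dots> = G2 - 2 * G * G + G\<^sup>2"
    using sq[OF g] ng const
    by (subst set_integral_add(2))
      (auto simp: G_def G2_def set_integral_diff intro!: set_integral_diff(1) set_integrable_mult_right)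
  finally have G: "G\<^sup>2 \<le> G2" by (simp add: power2_eq_square)
  have pointwise: "(norm (u t))\<^sup>2 \<le> 2 * (norm (u s))\<^sup>2 + 2 * G2" if s: "s \<in> ?S" for s
  proof -
    have "norm (u s - u t) = norm (LINT x:{t<..s}|lebesgue. g x)"
      using p s by (simp add: primitive_def)
    also have "\<dots> \<le> (LINT x:{t<..s}|lebesgue. norm (g x))"
      by (rule norm_set_integral_Ioc_le[OF gi ng]) simp
    also have "\<dots> \<le> (LINT x:{t<..s}|lebesgue. norm (g x)) + (LINT x:{s<..t + 1}|lebesgue. norm (g x))"
      unfolding set_lebesgue_integral_def by (simp add: Bochner_Integration.integral_nonneg)
    also have "\<dots> = G"
      unfolding G_def using s by (intro set_integral_Ioc_split[OF ng ng, symmetric]) auto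
    finally have 1: "norm (u s - u t) \<le> G" .
    have "norm (u t) \<le> norm (u s) + norm (u s - u t)"
      by (metis norm_minus_commute norm_triangle_sub)
    also have "\<dots> \<le> norm (u s) + G" using 1 by simp
    finally have "(norm (u t))\<^sup>2 \<le> (norm (u s) + G)\<^sup>2" by (rule power_mono) simp
    also have "\<dots> \<le> 2 * (norm (u s))\<^sup>2 + 2 * G\<^sup>2"
    proof -
      have "0 \<le> (norm (u s) - G)\<^sup>2" by simp
      then show ?thesis by (simp add: power2_eq_square algebra_simps)
    qed
    finally show ?thesis using G by simp
  qed
  have "(norm (u t))\<^sup>2 = (LINT s:?S|lebesgue. (norm (u t))\<^sup>2)" using const(2) by simp
  also have "\<dots> \<le> (LINT s:?S|lebesgue. 2 * (norm (k s))\<^sup>2 + 2 * G2)"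
  proof (rule set_integral_mono_AE)
    show "set_integrable lebesgue ?S (\<lambda>s. 2 * (norm (k s))\<^sup>2 + 2 * G2)"
      by (intro set_integral_add(1) set_integrable_mult_right sq[OF k] const(1))
    show "AE s\<in>?S in lebesgue. (norm (u t))\<^sup>2 \<le> 2 * (norm (k s))\<^sup>2 + 2 * G2"
      using eq
    proof eventually_elim
      fix s assume "u s = i (k s)"
      then have "(norm (u s))\<^sup>2 \<le> (norm (k s))\<^sup>2"
        using dense_inclusion_norm_le[OF i, of "k s"] by (intro power_mono) auto
      then show "s \<in> ?S \<longrightarrow> (norm (u t))\<^sup>2 \<le> 2 * (norm (k s))\<^sup>2 + 2 * G2"
        using pointwise[of s] by (intro impI) linarith
    qed
  qed (rule const)
  also have "\<dots> = 2 * (LINT s:?S|lebesgue. (norm (k s))\<^sup>2) + 2 * G2"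
    using sq[OF k] const by (subst set_integral_add(2)) (auto intro!: set_integrable_mult_right)
  also have "\<dots> = 2 * (LINT s:?S|lebesgue. (norm (k s))\<^sup>2 + (norm (g s))\<^sup>2)"
    using sq[OF k] sq[OF g] by (simp add: G2_def)
  finally show ?thesis .
qed

lemma repr_norm_le:
  assumes i: "dense_inclusion i" and r: "repr i u g k"
  shows "norm (u t) \<le> 2 * W12_L2_norm i u"
proof -
  let ?h = "\<lambda>s. (norm (k s))\<^sup>2 + (norm (g s))\<^sup>2"
  have h: "integrable lebesgue ?h"
    using r by (auto simp: repr_def square_integrable_def)
  have "(norm (u t))\<^sup>2 \<le> 2 * (LINT s:{t<..t + 1}|lebesgue. ?h s)"
    by (rule repr_norm_square_le[OF i r])
  also have "(LINT s:{t<..t + 1}|lebesgue. ?h s) \<le> (LINT s|lebesgue. ?h s)"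
    unfolding set_lebesgue_integral_def
    by (intro integral_mono integrable_mult_indicator h) (auto simp: indicator_def)
  also have "(LINT s|lebesgue. ?h s) = (W12_L2_norm i u)\<^sup>2"
    using r by (auto simp: repr_def square_integrable_def l2sq_def repr_imp_W12_L2(2)[OF i r])
  \<comment> \<open>Rounding 2 up to 4 makes the constant a square.\<close>
  also have "2 * (W12_L2_norm i u)\<^sup>2 \<le> 4 * (W12_L2_norm i u)\<^sup>2"
    by (intro mult_right_mono) auto
  finally have "(norm (u t))\<^sup>2 \<le> (2 * W12_L2_norm i u)\<^sup>2"
    by (simp add: power_mult_distrib)
  then show ?thesis
    by (rule power2_le_imp_le) (simp add: W12_L2_norm_nonneg)
qed

lemma integrable_tail_small:
  fixes h :: "real \<Rightarrow> real"
  assumes h: "integrable lebesgue h" "\<And>x. h x \<ge> 0" and e: "e > 0"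
  obtains n :: nat where "(LINT x|lebesgue. indicator {x. real n \<le> \<bar>x\<bar>} x * h x) < e"
proof -
  have "(\<lambda>n. LINT x|lebesgue. indicator {x. real n \<le> \<bar>x\<bar>} x * h x) \<longlonglongrightarrow> (LINT x|(lebesgue :: real measure). 0)"
  proof (rule integral_dominated_convergence[where w=h])
    show "AE x in lebesgue. (\<lambda>n. indicator {x. real n \<le> \<bar>x\<bar>} x * h x) \<longlonglongrightarrow> 0"
    proof (rule AE_I2)
      fix x
      obtain N where N: "\<bar>x\<bar> < real N" using reals_Archimedean2 by blast
      have "\<forall>\<^sub>F n in sequentially. 0 = indicator {x. real n \<le> \<bar>x\<bar>} x * h x"
        using eventually_ge_at_top[of N]
        by eventually_elim (use N in \<open>auto simp: indicator_def\<close>)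
      then show "(\<lambda>n. indicator {x. real n \<le> \<bar>x\<bar>} x * h x) \<longlonglongrightarrow> 0"
        by (rule Lim_transform_eventually[OF tendsto_const])
    qed
    fix n :: nat
    have "{x. real n \<le> \<bar>x\<bar>} = {real n..} \<union> {..- real n}" by auto
    then have "{x. real n \<le> \<bar>x\<bar>} \<in> sets lebesgue" by simp
    then show "(\<lambda>x. indicator {x. real n \<le> \<bar>x\<bar>} x * h x) \<in> borel_measurable lebesgue"
      by (intro borel_measurable_times[OF borel_measurable_indicator borel_measurable_integrable[OF h(1)]])
    show "AE x in lebesgue. norm (indicator {x. real n \<le> \<bar>x\<bar>} x * h x) \<le> h x"
      using h(2) by (auto simp: indicator_def)
  qed (use h in auto)
  then have "\<forall>\<^sub>F n in sequentially. (LINT x|lebesgue. indicator {x. real n \<le> \<bar>x\<bar>} x * h x) < e"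
    using e by (intro order_tendstoD(2)) auto
  then show thesis using that by (auto simp: eventually_sequentially)
qed

lemma repr_vanishes_at_infinity:
  assumes i: "dense_inclusion i" and r: "repr i u g k" and e: "e > 0"
  obtains c where "\<And>t. c \<le> \<bar>t\<bar> \<Longrightarrow> norm (u t) < e"
proof -
  let ?h = "\<lambda>s. (norm (k s))\<^sup>2 + (norm (g s))\<^sup>2"
  have h: "integrable lebesgue ?h"
    using r by (auto simp: repr_def square_integrable_def)
  have "e\<^sup>2 / 2 > 0" using e by simp
  then obtain n :: nat where n: "(LINT x|lebesgue. indicator {x. real n \<le> \<bar>x\<bar>} x * ?h x) < e\<^sup>2 / 2"
    by (rule integrable_tail_small[OF h, rotated]) auto
  \<comment> \<open>The extra 1 keeps \<open>{t<..t + 1}\<close> inside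
    \<open>{x. real n \<le> \<bar>x\<bar>}\<close> also for negative \<open>t\<close>.\<close>
  have "norm (u t) < e" if t: "real n + 1 \<le> \<bar>t\<bar>" for t
  proof -
    have "(LINT s:{t<..t + 1}|lebesgue. ?h s) \<le> (LINT x|lebesgue. indicator {x. real n \<le> \<bar>x\<bar>} x * ?h x)"
      unfolding set_lebesgue_integral_def
    proof (rule integral_mono)
      have "{x. real n \<le> \<bar>x\<bar>} = {real n..} \<union> {..- real n}" by auto
      then have "{x. real n \<le> \<bar>x\<bar>} \<in> sets lebesgue" by simp
      then show "integrable lebesgue (\<lambda>x. indicator {x. real n \<le> \<bar>x\<bar>} x * ?h x)"
        using integrable_mult_indicator[OF _ h] by simp
      show "integrable lebesgue (\<lambda>x. indicator {t<..t + 1} x *\<^sub>R ?h x)"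
        by (rule integrable_mult_indicator[OF _ h]) simp
      show "indicator {t<..t + 1} x *\<^sub>R ?h x \<le> indicator {x. real n \<le> \<bar>x\<bar>} x * ?h x" for x
        using t by (auto simp: indicator_def)
    qed
    then have "(norm (u t))\<^sup>2 < e\<^sup>2"
      using repr_norm_square_le[OF i r, of t] n by linarith
    then show ?thesis using e by (simp add: power_less_imp_less_base)
  qed
  then show thesis by (rule that)
qed

text \<open>\<open>u\<close> extends continuously by 0 at infinity: the member of a cover that
  contains 0 also contains \<open>u t\<close> for large \<open>\<bar>t\<bar>\<close>, and the rest
  of the curve is the image of a compact interval.\<close>

lemma repr_compact_range:
  assumes i: "dense_inclusion i" and r: "repr i u g k"
  shows "compact (insert 0 (range u))"
proof (rule compactI)
  fix C assume C: "\<forall>t\<in>C. open t" "insert 0 (range u) \<subseteq> \<Union>C"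
  then obtain B where B: "B \<in> C" "0 \<in> B" by auto
  then obtain e where e: "e > 0" "ball 0 e \<subseteq> B" using C(1) openE by blast
  obtain c where c: "\<And>t. c \<le> \<bar>t\<bar> \<Longrightarrow> norm (u t) < e"
    by (rule repr_vanishes_at_infinity[OF i r e(1)]) blast
  have "compact (u ` {-c..c})"
    using r by (intro compact_continuous_image) (auto simp: repr_def intro: continuous_on_subset)
  then obtain D where D: "D \<subseteq> C" "finite D" "u ` {-c..c} \<subseteq> \<Union>D"
    by (rule compactE[of _ C]) (use C in auto)
  have "u t \<in> \<Union>(insert B D)" for t
  proof (cases "c \<le> \<bar>t\<bar>")
    case True
    then have "u t \<in> ball 0 e" using c[of t] by simp
    then show ?thesis using e(2) by auto
  next
    case False
    then have "t \<in> {-c..c}" by auto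
    then have "u t \<in> \<Union>D" using D(3) by blast
    then show ?thesis by simp
  qed
  then have "insert 0 (range u) \<subseteq> \<Union>(insert B D)" using B by auto
  then show "\<exists>C'\<subseteq>C. finite C' \<and> insert 0 (range u) \<subseteq> \<Union>C'"
    using B D by (intro exI[of _ "insert B D"]) auto
qed

section \<open>Tame maps near a compact set\<close>

text \<open>The pointwise estimates of the weak derivative and of the H2 representative share the
  coefficients \<open>a\<close>, \<open>b\<close>, \<open>c\<close>, so their squares add up to full
  norms. Estimates that arise with different coefficients are enlarged to common ones before
  use.\<close>

lemma repr_norm_bound:
  assumes i: "dense_inclusion i" and u: "repr i u g k"
    and r: "repr i u1 g1 k1" "repr i u2 g2 k2" "repr i u3 g3 k3"
    and g: "\<And>s. norm (g s) \<le> a * norm (g1 s) + b * norm (g2 s) + c * norm (g3 s)"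
    and k: "AE s in lebesgue. norm (k s) \<le> a * norm (k1 s) + b * norm (k2 s) + c * norm (k3 s)"
  shows "(W12_L2_norm i u)\<^sup>2 \<le> 3 * (a\<^sup>2 * (W12_L2_norm i u1)\<^sup>2 + b\<^sup>2 * (W12_L2_norm i u2)\<^sup>2
    + c\<^sup>2 * (W12_L2_norm i u3)\<^sup>2)"
proof -
  have m: "square_integrable g" "square_integrable k" "square_integrable g1" "square_integrable k1"
    "square_integrable g2" "square_integrable k2" "square_integrable g3" "square_integrable k3"
    using u r by (auto simp: repr_def)
  have "l2sq g \<le> 3 * (a\<^sup>2 * l2sq g1 + b\<^sup>2 * l2sq g2 + c\<^sup>2 * l2sq g3)"
    by (rule square_integrable_l2sq_bound(2)) (use m g in \<open>auto simp: square_integrable_def\<close>)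
  moreover have "l2sq k \<le> 3 * (a\<^sup>2 * l2sq k1 + b\<^sup>2 * l2sq k2 + c\<^sup>2 * l2sq k3)"
    by (rule square_integrable_l2sq_bound(2)) (use m k in \<open>auto simp: square_integrable_def\<close>)
  ultimately show ?thesis
    unfolding repr_imp_W12_L2(2)[OF i u] repr_imp_W12_L2(2)[OF i r(1)]
      repr_imp_W12_L2(2)[OF i r(2)] repr_imp_W12_L2(2)[OF i r(3)]
    by (simp add: algebra_simps)
qed

lemma repr_cong_AE:
  assumes r: "repr i u g k" and eq: "AE s in lebesgue. k s = k' s"
  shows "repr i u g k'"
proof -
  have k: "square_integrable k" and u: "AE s in lebesgue. u s = i (k s)"
    using r by (auto simp: repr_def)
  have "k' \<in> borel_measurable lebesgue"
    by (rule borel_measurable_lebesgue_cong_AE[OF _ eq]) (use k in \<open>simp add: square_integrable_def\<close>)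
  then have "square_integrable k'"
    by (rule square_integrable_imp_norm_bound[OF k]) (use eq in \<open>auto elim!: eventually_mono\<close>)
  moreover have "AE s in lebesgue. u s = i (k' s)"
    using u eq by eventually_elim simp
  ultimately show ?thesis using r by (simp add: repr_def)
qed

lemma continuous_on_has_derivative:
  "(\<And>x. x \<in> S \<Longrightarrow> (f has_derivative f' x) (at x)) \<Longrightarrow> continuous_on S f"
  by (intro continuous_at_imp_continuous_on ballI has_derivative_continuous)

text \<open>The locale fixes witnesses for the quantifiers in \<open>tame\<close>. The restricted
  map is characterized by \<open>i (\<psi> y) = \<phi> (i y)\<close>, which keeps
  \<open>inv i\<close> out of the estimates.\<close>

locale tame_setup =
  fixes i :: "'h2::{real_inner,complete_space,second_countable_topology} \<Rightarrow>
              'h1::{real_inner,complete_space,second_countable_topology}"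
    and U :: "'h1 set" and \<phi> :: "'h1 \<Rightarrow> 'h1"
    and d\<phi> :: "'h1 \<Rightarrow> 'h1 \<Rightarrow>\<^sub>L 'h1" and dd\<phi> :: "'h1 \<Rightarrow> 'h1 \<Rightarrow>\<^sub>L 'h1 \<Rightarrow>\<^sub>L 'h1"
    and \<psi> :: "'h2 \<Rightarrow> 'h2"
    and d\<psi> :: "'h2 \<Rightarrow> 'h2 \<Rightarrow>\<^sub>L 'h2" and dd\<psi> :: "'h2 \<Rightarrow> 'h2 \<Rightarrow>\<^sub>L 'h2 \<Rightarrow>\<^sub>L 'h2"
  assumes incl: "dense_inclusion i" and open_U: "open U"
    and C2_\<phi>: "C2_with U \<phi> d\<phi> dd\<phi>"
    and C2_\<psi>: "C2_with (i -` U) \<psi> d\<psi> dd\<psi>"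
    and i_\<psi>: "i y \<in> U \<Longrightarrow> i (\<psi> y) = \<phi> (i y)"
    and tame_bound: "x \<in> U \<Longrightarrow> \<exists>W \<kappa>. open W \<and> x \<in> W \<and> W \<subseteq> U \<and> \<kappa> > 0 \<and>
         (\<forall>y v w. i y \<in> W \<longrightarrow> norm (dd\<psi> y v w) \<le>
             \<kappa> * (norm (i v) * norm w + norm v * norm (i w) + norm y * norm (i v) * norm (i w)))"
    and zero_U: "0 \<in> U" and \<phi>_zero: "\<phi> 0 = 0"
begin

lemma
  shows i_bl: "bounded_linear i" and i_norm: "norm (i x) \<le> norm x"
    and i_add: "i (x + y) = i x + i y" and i_diff: "i (x - y) = i x - i y"
    and i_scale: "i (c *\<^sub>R x) = c *\<^sub>R i x" and i_zero: "i 0 = 0"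
    and i_inj: "i x = i y \<Longrightarrow> x = y"
proof -
  show bl: "bounded_linear i" by (rule dense_inclusion_bounded_linear[OF incl])
  show "norm (i x) \<le> norm x" by (rule dense_inclusion_norm_le[OF incl])
  show "i (x + y) = i x + i y" by (rule linear_simps(1)[OF bl])
  show "i (x - y) = i x - i y" by (rule linear_simps(2)[OF bl])
  show "i (c *\<^sub>R x) = c *\<^sub>R i x" by (rule linear_simps(5)[OF bl])
  show "i 0 = 0" by (rule linear_simps(3)[OF bl])
  show "i x = i y \<Longrightarrow> x = y" by (rule dense_inclusion_inj[OF incl])
qed

lemma \<psi>_zero: "\<psi> 0 = 0"
  using i_\<psi>[of 0] zero_U \<phi>_zero i_inj[of "\<psi> 0" 0] by (simp add: i_zero)

lemma
  assumes "x \<in> U"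
  shows \<phi>_deriv: "(\<phi> has_derivative d\<phi> x) (at x)" and d\<phi>_deriv: "(d\<phi> has_derivative dd\<phi> x) (at x)"
  using C2_\<phi> assms by (auto simp: C2_with_def)

lemma
  assumes "i y \<in> U"
  shows \<psi>_deriv: "(\<psi> has_derivative d\<psi> y) (at y)" and d\<psi>_deriv: "(d\<psi> has_derivative dd\<psi> y) (at y)"
  using C2_\<psi> assms by (auto simp: C2_with_def)

lemma dd\<phi>_cont: "continuous_on U dd\<phi>"
  using C2_\<phi> by (simp add: C2_with_def)

lemma d\<phi>_cont: "continuous_on U d\<phi>"
  by (rule continuous_on_has_derivative[OF d\<phi>_deriv])

lemma open_V: "open (i -` U)"
  using open_U i_bl by (intro open_vimage) (auto simp: linear_continuous_on)

lemma i_d\<psi>: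
  assumes y: "i y \<in> U"
  shows "i (d\<psi> y k) = d\<phi> (i y) (i k)"
proof -
  have "((\<lambda>y. i (\<psi> y)) has_derivative (\<lambda>k. i (d\<psi> y k))) (at y)"
    by (rule bounded_linear.has_derivative[OF i_bl \<psi>_deriv[OF y]])
  then have "((\<lambda>y. \<phi> (i y)) has_derivative (\<lambda>k. i (d\<psi> y k))) (at y)"
    by (rule has_derivative_transform_within_open[OF _ open_V]) (use y i_\<psi> in auto)
  moreover have "((\<lambda>y. \<phi> (i y)) has_derivative (\<lambda>k. d\<phi> (i y) (i k))) (at y)"
    by (rule has_derivative_compose[OF bounded_linear.has_derivative[OF i_bl has_derivative_ident] \<phi>_deriv[OF y]])
  ultimately have "(\<lambda>k. i (d\<psi> y k)) = (\<lambda>k. d\<phi> (i y) (i k))"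
    by (rule has_derivative_unique)
  then show ?thesis by metis
qed

text \<open>The bounds on \<open>\<psi>\<close> and \<open>d\<psi>\<close> are integrated versions of tameness. They have no constant term: away from \<open>0\<close> in
  \<open>H\<^sub>1\<close> the norm of \<open>y\<close> is bounded below, and near \<open>0\<close> one uses \<open>\<psi> 0 = 0\<close>.\<close>

definition bounds :: "real \<Rightarrow> 'h1 \<Rightarrow> bool" where
  "bounds C z \<longleftrightarrow> z \<in> U \<and> norm (d\<phi> z) \<le> C \<and> norm (dd\<phi> z) \<le> C \<and>
     (\<forall>y. i y = z \<longrightarrow> norm (\<psi> y) \<le> C * norm y \<and>
        (\<forall>w. norm (d\<psi> y w) \<le> C * (norm w + norm y * norm (i w))) \<and>
        (\<forall>v w. norm (dd\<psi> y v w) \<le>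
             C * (norm (i v) * norm w + norm v * norm (i w) + norm y * norm (i v) * norm (i w))))"

lemma bounds_mono:
  assumes b: "bounds C z" and le: "C \<le> C'"
  shows "bounds C' z"
proof -
  have *: "a \<le> C' * c" if "a \<le> C * c" "0 \<le> c" for a c :: real
    using mult_right_mono[OF le that(2)] that(1) by linarith
  show ?thesis
    unfolding bounds_def
  proof (intro conjI allI impI)
    show "z \<in> U" "norm (d\<phi> z) \<le> C'" "norm (dd\<phi> z) \<le> C'"
      using b le by (auto simp: bounds_def)
    fix y v w assume y: "i y = z"
    show "norm (\<psi> y) \<le> C' * norm y"
      by (rule *) (use b y in \<open>auto simp: bounds_def\<close>)
    show "norm (d\<psi> y w) \<le> C' * (norm w + norm y * norm (i w))"
      by (rule *) (use b y in \<open>auto simp: bounds_def\<close>)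
    show "norm (dd\<psi> y v w)
        \<le> C' * (norm (i v) * norm w + norm v * norm (i w) + norm y * norm (i v) * norm (i w))"
      by (rule *) (use b y in \<open>auto simp: bounds_def\<close>)
  qed
qed

lemma d\<psi>_apply_deriv:
  assumes "i z \<in> U"
  shows "((\<lambda>z. d\<psi> z w) has_derivative (\<lambda>v. dd\<psi> z v w)) (at z)"
  by (rule bounded_linear.has_derivative[OF blinfun.bounded_linear_left d\<psi>_deriv[OF assms]])

text \<open>The tame estimate is integrated twice, for \<open>d\<psi>\<close> and then for
  \<open>\<psi>\<close>, along segments from a base point \<open>y0\<close> of H2. Density supplies
  \<open>y0\<close> close to \<open>x\<close> in H1, since \<open>x\<close> itself need not lie in
  H2; convexity of H1 balls keeps each segment inside \<open>W\<close>, however long it is in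
  H2.\<close>

lemma local_bounds:
  assumes x: "x \<in> U"
  shows "\<exists>r>0. \<exists>C. \<forall>z. dist x z < r \<longrightarrow> bounds C z"
proof -
  obtain W \<kappa> where W: "open W" "x \<in> W" "W \<subseteq> U" and \<kappa>: "\<kappa> > 0"
    and tame: "\<And>y v w. i y \<in> W \<Longrightarrow> norm (dd\<psi> y v w) \<le>
        \<kappa> * (norm (i v) * norm w + norm v * norm (i w) + norm y * norm (i v) * norm (i w))"
    using tame_bound[OF x] by blast
  have cont: "isCont d\<phi> x" "isCont dd\<phi> x"
    using d\<phi>_cont dd\<phi>_cont open_U x by (auto simp: continuous_on_eq_continuous_at)
  obtain r0 where r0: "r0 > 0" "ball x r0 \<subseteq> W" using W openE by blast
  obtain r1 where r1: "r1 > 0" "\<And>z. dist z x < r1 \<Longrightarrow> dist (d\<phi> z) (d\<phi> x) < 1"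
    using cont(1) unfolding continuous_at_eps_delta by (meson zero_less_one)
  obtain r2 where r2: "r2 > 0" "\<And>z. dist z x < r2 \<Longrightarrow> dist (dd\<phi> z) (dd\<phi> x) < 1"
    using cont(2) unfolding continuous_at_eps_delta by (meson zero_less_one)
  \<comment> \<open>For \<open>x \<noteq> 0\<close> the bound by \<open>norm x / 2\<close> forces
    \<open>r \<le> norm y\<close> whenever \<open>i y\<close> lies in the ball; for
    \<open>x = 0\<close> the 1 is an arbitrary cap.\<close>
  define r where "r = min (min r0 (min r1 r2)) (if x = 0 then 1 else norm x / 2)"
  have r: "r > 0" "r \<le> r0" "r \<le> r1" "r \<le> r2" "x \<noteq> 0 \<Longrightarrow> r \<le> norm x / 2"
    using r0(1) r1(1) r2(1) by (auto simp: r_def)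
  have d\<phi>_le: "norm (d\<phi> z) \<le> norm (d\<phi> x) + 1" if "dist x z < r" for z
  proof -
    have "dist (d\<phi> z) (d\<phi> x) < 1"
      by (rule r1(2)) (use that r(3) in \<open>simp add: dist_commute\<close>)
    then show ?thesis
      using norm_triangle_sub[of "d\<phi> z" "d\<phi> x"] unfolding dist_norm by linarith
  qed
  have dd\<phi>_le: "norm (dd\<phi> z) \<le> norm (dd\<phi> x) + 1" if "dist x z < r" for z
  proof -
    have "dist (dd\<phi> z) (dd\<phi> x) < 1"
      by (rule r2(2)) (use that r(4) in \<open>simp add: dist_commute\<close>)
    then show ?thesis
      using norm_triangle_sub[of "dd\<phi> z" "dd\<phi> x"] unfolding dist_norm by linarith
  qed
  have W_r: "z \<in> W" "z \<in> U" if "dist x z < r" for z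
  proof -
    have "z \<in> ball x r0" using that r(2) by simp
    then show "z \<in> W" "z \<in> U" using r0(2) W(3) by blast+
  qed
  have "\<exists>y0. dist x (i y0) < r \<and> (x = 0 \<longrightarrow> y0 = 0)"
  proof (cases "x = 0")
    case True
    then show ?thesis using r(1) by (auto simp: i_zero)
  next
    case False
    have "x \<in> closure (range i)" using incl by (simp add: dense_inclusion_def)
    then show ?thesis using r(1) False by (auto simp: closure_approachable dist_commute)
  qed
  then obtain y0 where y0: "dist x (i y0) < r" "x = 0 \<Longrightarrow> y0 = 0" by blast
  have seg: "dist x (i (y0 + t *\<^sub>R (y - y0))) < r" "norm (y0 + t *\<^sub>R (y - y0)) \<le> norm y + norm y0"
    if y: "dist x (i y) < r" and t: "0 \<le> t" "t \<le> 1" for y t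
  proof -
    have eq: "y0 + t *\<^sub>R (y - y0) = (1 - t) *\<^sub>R y0 + t *\<^sub>R y" by (simp add: algebra_simps)
    have "(1 - t) *\<^sub>R i y0 + t *\<^sub>R i y \<in> ball x r"
      using y y0(1) t by (intro convexD[OF convex_ball]) auto
    then show "dist x (i (y0 + t *\<^sub>R (y - y0))) < r"
      unfolding eq i_add i_scale by simp
    have "norm ((1 - t) *\<^sub>R y0 + t *\<^sub>R y) \<le> norm ((1 - t) *\<^sub>R y0) + norm (t *\<^sub>R y)"
      by (rule norm_triangle_ineq)
    also have "\<dots> \<le> norm y0 + norm y"
      using t by (intro add_mono) (auto intro: mult_left_le_one_le)
    finally show "norm (y0 + t *\<^sub>R (y - y0)) \<le> norm y + norm y0" by (simp add: eq)
  qed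
  have i_diff_le: "norm (i (y - y0)) \<le> 2 * r" if "dist x (i y) < r" for y
    using that y0(1) dist_triangle3[of "i y" "i y0" x] by (simp add: i_diff dist_norm)
  \<comment> \<open>The first two summands collect the coefficients of \<open>norm w\<close>, the
    last one is that of \<open>norm y * norm (i w)\<close>.\<close>
  define C1 where "C1 = norm (d\<psi> y0) + \<kappa> * (2 * r + norm y0 * (1 + 2 * r)) + \<kappa> * (1 + 2 * r)"
  have C1: "C1 \<ge> 0" using \<kappa> r(1) by (simp add: C1_def)
  have d\<psi>_le: "norm (d\<psi> y w) \<le> C1 * (norm w + norm y * norm (i w))" if y: "dist x (i y) < r" for y w
  proof -
    let ?B = "\<kappa> * (2 * r * norm w + (norm y + norm y0) * norm (i w) + (norm y + norm y0) * (2 * r) * norm (i w))"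
    have "norm (d\<psi> (y0 + (y - y0)) w - d\<psi> y0 w) \<le> ?B"
    proof (rule norm_increment_le)
      fix t :: real assume t: "0 \<le> t" "t \<le> 1"
      let ?z = "y0 + t *\<^sub>R (y - y0)"
      show "((\<lambda>z. d\<psi> z w) has_derivative (\<lambda>v. dd\<psi> ?z v w)) (at ?z)"
        by (rule d\<psi>_apply_deriv[OF W_r(2)[OF seg(1)[OF y t]]])
      have "norm (dd\<psi> ?z (y - y0) w) \<le> \<kappa> * (norm (i (y - y0)) * norm w + norm (y - y0) * norm (i w)
          + norm ?z * norm (i (y - y0)) * norm (i w))"
        by (rule tame[OF W_r(1)[OF seg(1)[OF y t]]])
      also have "\<dots> \<le> ?B"
        using \<kappa> r(1) i_diff_le[OF y] seg(2)[OF y t] norm_triangle_ineq4[of y y0]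
        by (intro mult_left_mono add_mono mult_mono mult_right_mono) auto
      finally show "norm (dd\<psi> ?z (y - y0) w) \<le> ?B" .
    qed
    then have "norm (d\<psi> y w - d\<psi> y0 w) \<le> ?B" by simp
    then have "norm (d\<psi> y w) \<le> norm (d\<psi> y0) * norm w + ?B"
      using norm_triangle_sub[of "d\<psi> y w" "d\<psi> y0 w"] norm_blinfun[of "d\<psi> y0" w] by linarith
    also have "?B = \<kappa> * (2 * r) * norm w + \<kappa> * (1 + 2 * r) * (norm y * norm (i w))
        + \<kappa> * (1 + 2 * r) * norm y0 * norm (i w)"
      by (simp add: algebra_simps)
    also have "\<kappa> * (1 + 2 * r) * norm y0 * norm (i w) \<le> \<kappa> * (1 + 2 * r) * norm y0 * norm w"
      using \<kappa> r(1) i_norm by (intro mult_left_mono) auto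
    also have "norm (d\<psi> y0) * norm w + (\<kappa> * (2 * r) * norm w + \<kappa> * (1 + 2 * r) * (norm y * norm (i w))
        + \<kappa> * (1 + 2 * r) * norm y0 * norm w)
        = (C1 - \<kappa> * (1 + 2 * r)) * norm w + \<kappa> * (1 + 2 * r) * (norm y * norm (i w))"
      by (simp add: C1_def algebra_simps)
    also have "\<dots> \<le> C1 * norm w + C1 * (norm y * norm (i w))"
      using \<kappa> r(1) by (intro add_mono mult_right_mono) (auto simp: C1_def)
    finally show ?thesis by (simp add: algebra_simps)
  qed
  \<comment> \<open>The quotient by \<open>r\<close> absorbs the part independent of
    \<open>y\<close>, using \<open>r \<le> norm y\<close> when \<open>x \<noteq> 0\<close>; when
    \<open>x = 0\<close> that part vanishes because \<open>y0 = 0\<close>.\<close>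
  define C2 where "C2 = (norm (\<psi> y0) + C1 * (1 + 2 * r) * norm y0) / r + C1 * (1 + 2 * r)"
  have \<psi>_le: "norm (\<psi> y) \<le> C2 * norm y" if y: "dist x (i y) < r" for y
  proof -
    let ?B = "C1 * ((norm y + norm y0) * (1 + 2 * r))"
    have "norm (\<psi> (y0 + (y - y0)) - \<psi> y0) \<le> ?B"
    proof (rule norm_increment_le)
      fix t :: real assume t: "0 \<le> t" "t \<le> 1"
      let ?z = "y0 + t *\<^sub>R (y - y0)"
      show "(\<psi> has_derivative d\<psi> ?z) (at ?z)"
        by (rule \<psi>_deriv[OF W_r(2)[OF seg(1)[OF y t]]])
      have "norm (d\<psi> ?z (y - y0)) \<le> C1 * (norm (y - y0) + norm ?z * norm (i (y - y0)))"
        by (rule d\<psi>_le[OF seg(1)[OF y t]])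
      also have "\<dots> \<le> C1 * ((norm y + norm y0) + (norm y + norm y0) * (2 * r))"
        using C1 r(1) i_diff_le[OF y] seg(2)[OF y t] norm_triangle_ineq4[of y y0]
        by (intro mult_left_mono add_mono mult_mono) auto
      finally show "norm (d\<psi> ?z (y - y0)) \<le> ?B" by (simp add: algebra_simps)
    qed
    then have *: "norm (\<psi> y) \<le> (norm (\<psi> y0) + C1 * (1 + 2 * r) * norm y0) + C1 * (1 + 2 * r) * norm y"
      using norm_triangle_sub[of "\<psi> y" "\<psi> y0"] by (simp add: algebra_simps)
    have "norm (\<psi> y0) + C1 * (1 + 2 * r) * norm y0 \<le> (norm (\<psi> y0) + C1 * (1 + 2 * r) * norm y0) / r * norm y"
    proof (cases "x = 0")
      case True
      then show ?thesis using y0(2) by (simp add: \<psi>_zero)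
    next
      case False
      have "norm x \<le> norm (i y) + dist x (i y)"
        by (metis dist_norm norm_triangle_sub add.commute)
      then have "r \<le> norm y" using r(5)[OF False] y i_norm[of y] by linarith
      then have "1 \<le> norm y / r" using r(1) by simp
      then have "(norm (\<psi> y0) + C1 * (1 + 2 * r) * norm y0) * 1
          \<le> (norm (\<psi> y0) + C1 * (1 + 2 * r) * norm y0) * (norm y / r)"
        using C1 r(1) by (intro mult_left_mono) auto
      then show ?thesis by simp
    qed
    then show ?thesis using * by (simp add: C2_def algebra_simps)
  qed
  define C where "C = (norm (d\<phi> x) + 1) + (norm (dd\<phi> x) + 1) + C1 + C2 + \<kappa>"
  have C2: "C2 \<ge> 0" using C1 r(1) by (simp add: C2_def)
  have le_C: "norm (d\<phi> x) + 1 \<le> C" "norm (dd\<phi> x) + 1 \<le> C" "C1 \<le> C" "C2 \<le> C" "\<kappa> \<le> C"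
    using C1 C2 \<kappa> by (auto simp: C_def)
  have "bounds C z" if z: "dist x z < r" for z
    unfolding bounds_def
  proof (intro conjI allI impI)
    show "z \<in> U" by (rule W_r(2)[OF z])
    show "norm (d\<phi> z) \<le> C" "norm (dd\<phi> z) \<le> C"
      using d\<phi>_le[OF z] dd\<phi>_le[OF z] le_C by linarith+
    fix y assume y: "i y = z"
    show "norm (\<psi> y) \<le> C * norm y"
      using \<psi>_le[of y] z y mult_right_mono[OF le_C(4), of "norm y"] by auto
    show "norm (d\<psi> y w) \<le> C * (norm w + norm y * norm (i w))" for w
      using d\<psi>_le[of y w] z y mult_right_mono[OF le_C(3), of "norm w + norm y * norm (i w)"] by auto
    show "norm (dd\<psi> y v w) \<le> C * (norm (i v) * norm w + norm v * norm (i w) + norm y * norm (i v) * norm (i w))" for v w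
      using tame[of y v w] W_r(1)[OF z] y
        mult_right_mono[OF le_C(5), of "norm (i v) * norm w + norm v * norm (i w) + norm y * norm (i v) * norm (i w)"]
      by auto
  qed
  then show ?thesis using r(1) by blast
qed

end

section \<open>The superposition operator\<close>

lemma norm_blinfun_twice_le:
  assumes A: "norm A \<le> a" and w: "norm w \<le> b"
  shows "norm (blinfun_apply (blinfun_apply A v) w) \<le> a * b * norm v"
proof -
  have a: "a \<ge> 0" using A norm_ge_zero order_trans by blast
  have "norm (blinfun_apply (blinfun_apply A v) w) \<le> norm (blinfun_apply A v) * norm w"
    by (rule norm_blinfun)
  also have "\<dots> \<le> (norm A * norm v) * norm w" by (intro mult_right_mono norm_blinfun) simp
  also have "\<dots> \<le> (a * norm v) * b"
    using A w a by (intro mult_mono mult_right_mono) auto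
  finally show ?thesis by (simp add: mult_ac)
qed

section \<open>Taylor estimates with uniform constants, and the representatives they produce\<close>

context tame_setup
begin

lemma bounds_nonneg: "bounds C z \<Longrightarrow> C \<ge> 0"
  unfolding bounds_def by (meson norm_ge_zero order_trans)

lemma d\<phi>_increment:
  assumes B: "\<And>z. dist x z < d \<Longrightarrow> bounds C z" and v: "norm v < d"
  shows "norm (d\<phi> (x + v) - d\<phi> x) \<le> C * norm v"
proof (rule norm_increment_le)
  fix t :: real assume t: "0 \<le> t" "t \<le> 1"
  have "norm (t *\<^sub>R v) \<le> norm v" using t by (simp add: mult_left_le_one_le)
  then have b: "bounds C (x + t *\<^sub>R v)" by (intro B) (use v in \<open>simp add: dist_norm\<close>)
  then show "(d\<phi> has_derivative dd\<phi> (x + t *\<^sub>R v)) (at (x + t *\<^sub>R v))"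
    by (intro d\<phi>_deriv) (simp add: bounds_def)
  have "norm (dd\<phi> (x + t *\<^sub>R v) v) \<le> norm (dd\<phi> (x + t *\<^sub>R v)) * norm v" by (rule norm_blinfun)
  also have "\<dots> \<le> C * norm v" using b by (intro mult_right_mono) (auto simp: bounds_def)
  finally show "norm (dd\<phi> (x + t *\<^sub>R v) v) \<le> C * norm v" .
qed

lemma d\<phi>_taylor:
  assumes B: "\<And>z. dist x z < d \<Longrightarrow> z \<in> U \<and> norm (dd\<phi> z - dd\<phi> x) \<le> e" and v: "norm v < d"
  shows "norm (d\<phi> (x + v) - d\<phi> x - dd\<phi> x v) \<le> e * norm v"
proof -
  let ?g = "\<lambda>z. d\<phi> z - dd\<phi> x z"
  have "norm (?g (x + v) - ?g x) \<le> e * norm v"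
  proof (rule norm_increment_le)
    fix t :: real assume t: "0 \<le> t" "t \<le> 1"
    let ?z = "x + t *\<^sub>R v"
    have "norm (t *\<^sub>R v) \<le> norm v" using t by (simp add: mult_left_le_one_le)
    then have b: "?z \<in> U \<and> norm (dd\<phi> ?z - dd\<phi> x) \<le> e" by (intro B) (use v in \<open>simp add: dist_norm\<close>)
    then show "(?g has_derivative (\<lambda>w. dd\<phi> ?z w - dd\<phi> x w)) (at ?z)"
      by (intro has_derivative_diff_blinfun d\<phi>_deriv) simp
    have "norm ((dd\<phi> ?z - dd\<phi> x) v) \<le> norm (dd\<phi> ?z - dd\<phi> x) * norm v" by (rule norm_blinfun)
    also have "\<dots> \<le> e * norm v" using b by (intro mult_right_mono) auto
    finally show "norm (dd\<phi> ?z v - dd\<phi> x v) \<le> e * norm v" by (simp add: blinfun.diff_left)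
  qed
  then show ?thesis by (simp add: blinfun.add_right algebra_simps)
qed

text \<open>The restriction \<open>norm (i v) < d\<close> is on the H1 norm only: \<open>v\<close>
  may be large in H2, which is why \<open>norm v\<close> is added to \<open>norm y\<close> in the
  bound for points of the segment.\<close>

lemma d\<psi>_increment:
  assumes B: "\<And>z. dist (i y) z < d \<Longrightarrow> bounds C z" and v: "norm (i v) < d"
  shows "norm (d\<psi> (y + v) w - d\<psi> y w) \<le> C * (norm (i v) * norm w + norm v * norm (i w)
    + (norm y + norm v) * norm (i v) * norm (i w))"
proof (rule norm_increment_le)
  fix t :: real assume t: "0 \<le> t" "t \<le> 1"
  let ?z = "y + t *\<^sub>R v"
  have le: "norm (t *\<^sub>R u) \<le> norm u" for u :: "'c::real_normed_vector"
    using t by (simp add: mult_left_le_one_le)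
  have b: "bounds C (i ?z)"
    by (rule B) (use v le[of "i v"] in \<open>simp add: dist_norm i_add i_scale\<close>)
  then show "((\<lambda>z. d\<psi> z w) has_derivative (\<lambda>v. dd\<psi> ?z v w)) (at ?z)"
    by (intro d\<psi>_apply_deriv) (simp add: bounds_def)
  have C: "C \<ge> 0" by (rule bounds_nonneg[OF b])
  have z: "norm ?z \<le> norm y + norm v"
    using norm_triangle_ineq[of y "t *\<^sub>R v"] le[of v] by linarith
  have "norm (dd\<psi> ?z v w) \<le> C * (norm (i v) * norm w + norm v * norm (i w) + norm ?z * norm (i v) * norm (i w))"
    using b by (simp add: bounds_def)
  also have "\<dots> \<le> C * (norm (i v) * norm w + norm v * norm (i w) + (norm y + norm v) * norm (i v) * norm (i w))"
    using C z by (intro mult_left_mono add_mono mult_right_mono) auto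
  finally show "norm (dd\<psi> ?z v w) \<le> C * (norm (i v) * norm w + norm v * norm (i w)
    + (norm y + norm v) * norm (i v) * norm (i w))" .
qed

text \<open>Every term carries an additional factor \<open>norm (i v)\<close>, which can be made
  small uniformly in \<open>s\<close>. The factor 2 arises because the first two terms of
  \<open>d\<psi>_increment\<close> get the same bound when both directions are multiples of
  \<open>v\<close>.\<close>

lemma \<psi>_taylor:
  assumes B: "\<And>z. dist (i y) z < d \<Longrightarrow> bounds C z" and v: "norm (i v) < d"
  shows "norm (\<psi> (y + v) - \<psi> y - d\<psi> y v) \<le> C * (2 * norm (i v) * norm v
    + (norm y + norm v) * norm (i v) * norm (i v))" (is "_ \<le> ?B")
proof -
  let ?g = "\<lambda>z. \<psi> z - d\<psi> y z"
  have "norm (?g (y + v) - ?g y) \<le> ?B"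
  proof (rule norm_increment_le)
    fix t :: real assume t: "0 \<le> t" "t \<le> 1"
    let ?z = "y + t *\<^sub>R v"
    have le: "norm (t *\<^sub>R u) \<le> norm u" for u :: "'c::real_normed_vector"
      using t by (simp add: mult_left_le_one_le)
    have tv: "norm (i (t *\<^sub>R v)) < d" using v le[of "i v"] by (simp add: i_scale)
    have b: "bounds C (i ?z)"
      by (rule B) (use tv in \<open>simp add: dist_norm i_add\<close>)
    then show "(?g has_derivative (\<lambda>w. d\<psi> ?z w - d\<psi> y w)) (at ?z)"
      by (intro has_derivative_diff_blinfun \<psi>_deriv) (simp add: bounds_def)
    have C: "C \<ge> 0" by (rule bounds_nonneg[OF b])
    have "norm (d\<psi> ?z v - d\<psi> y v) \<le> C * (norm (i (t *\<^sub>R v)) * norm v + norm (t *\<^sub>R v) * norm (i v)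
      + (norm y + norm (t *\<^sub>R v)) * norm (i (t *\<^sub>R v)) * norm (i v))"
      by (rule d\<psi>_increment[OF B tv])
    also have "\<dots> \<le> C * (norm (i v) * norm v + norm v * norm (i v)
      + (norm y + norm v) * norm (i v) * norm (i v))"
      unfolding i_scale using C le[of v] le[of "i v"]
      by (intro mult_left_mono add_mono mult_mono mult_right_mono) auto
    finally show "norm (d\<psi> ?z v - d\<psi> y v) \<le> ?B" by (simp add: algebra_simps)
  qed
  then show ?thesis by (simp add: blinfun.add_right algebra_simps)
qed

lemma bounds_near_range:
  assumes r: "repr i \<xi> g y" and U: "\<And>s. \<xi> s \<in> U"
  obtains d C where "d > 0" "C > 0" "\<And>s z. dist (\<xi> s) z < d \<Longrightarrow> bounds C z"
proof -
  let ?K = "insert 0 (range \<xi>)"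
  have K: "compact ?K" "?K \<subseteq> U"
    using repr_compact_range[OF incl r] U zero_U by auto
  obtain d C where "d > 0" "C > 0" "\<And>x z. x \<in> ?K \<Longrightarrow> dist x z < d \<Longrightarrow> bounds C z"
    by (rule compact_uniform_near[OF K(1), where P=bounds])
      (use K(2) local_bounds bounds_mono in blast)+
  then show thesis using that[of d C] by auto
qed

lemma dd\<phi>_near_range:
  assumes r: "repr i \<xi> g y" and U: "\<And>s. \<xi> s \<in> U" and e: "e > 0"
  obtains d where "d > 0" "\<And>s z. dist (\<xi> s) z < d \<Longrightarrow> z \<in> U \<and> norm (dd\<phi> z - dd\<phi> (\<xi> s)) \<le> e"
proof -
  let ?K = "insert 0 (range \<xi>)"
  have K: "compact ?K" "?K \<subseteq> U"
    using repr_compact_range[OF incl r] U zero_U by auto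
  obtain d where "d > 0" "\<And>x z. x \<in> ?K \<Longrightarrow> dist x z < d \<Longrightarrow> z \<in> U \<and> dist (dd\<phi> z) (dd\<phi> x) < e"
    by (rule compact_uniformly_continuous_near[OF K open_U dd\<phi>_cont e]) blast
  then show thesis using that[of d] by (auto simp: dist_norm less_imp_le)
qed

text \<open>The restricted map is controlled only where \<open>i y \<in> U\<close>, so the H2
  representative is changed to 0 where it leaves that set. This happens on a null set, and 0 is
  admissible because \<open>0 \<in> U\<close>.\<close>

lemma repr_in_domain:
  assumes r: "repr i \<xi> g k" and U: "\<And>s. \<xi> s \<in> U"
  obtains y where "repr i \<xi> g y" "\<And>s. i (y s) \<in> U" "AE s in lebesgue. k s = y s"
proof -
  define y where "y s = (if i (k s) \<in> U then k s else 0)" for s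
  have "AE s in lebesgue. \<xi> s = i (k s)" using r by (simp add: repr_def)
  then have ae: "AE s in lebesgue. k s = y s"
    by eventually_elim (metis U y_def)
  have "i (y s) \<in> U" for s using zero_U by (simp add: y_def i_zero)
  then show thesis using that[OF repr_cong_AE[OF r ae] _ ae] by blast
qed

text \<open>The line has infinite measure, so square integrability of \<open>\<psi> (y s)\<close>
  rests on a bound by a multiple of \<open>norm (y s)\<close> without a constant term.\<close>

lemma repr_\<phi>:
  assumes r: "repr i \<xi> g y" and U: "\<And>s. \<xi> s \<in> U" and V: "\<And>s. i (y s) \<in> U"
  shows "repr i (\<lambda>s. \<phi> (\<xi> s)) (\<lambda>s. d\<phi> (\<xi> s) (g s)) (\<lambda>s. \<psi> (y s))"
proof -
  have \<xi>: "continuous_on UNIV \<xi>" and p: "primitive \<xi> g" and g: "square_integrable g"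
    and y: "square_integrable y" and eq: "AE s in lebesgue. \<xi> s = i (y s)"
    using r by (auto simp: repr_def)
  obtain d C where d: "d > 0" and C: "C > 0" and B: "\<And>s z. dist (\<xi> s) z < d \<Longrightarrow> bounds C z"
    by (rule bounds_near_range[OF r U]) blast
  have B0: "bounds C (\<xi> s)" for s using B[of s "\<xi> s"] d by simp
  have p': "primitive (\<lambda>s. \<phi> (\<xi> s)) (\<lambda>s. d\<phi> (\<xi> s) (g s))"
    by (rule primitive_compose[OF p \<xi> open_U U \<phi>_deriv d\<phi>_cont])
  have "continuous_on UNIV (\<lambda>s. \<phi> (\<xi> s))"
    by (rule continuous_on_compose2[OF continuous_on_has_derivative[OF \<phi>_deriv] \<xi>]) (use U in auto)
  moreover have "square_integrable (\<lambda>s. d\<phi> (\<xi> s) (g s))"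
  proof (rule square_integrable_l2sq_bound(1)[OF _ g g g, where a=C and b=0 and c=0])
    show "(\<lambda>s. d\<phi> (\<xi> s) (g s)) \<in> borel_measurable lebesgue" using p' by (simp add: primitive_def)
    have "norm (d\<phi> (\<xi> s) (g s)) \<le> C * norm (g s)" for s
      using B0[of s] norm_blinfun[of "d\<phi> (\<xi> s)" "g s"]
        mult_right_mono[of "norm (d\<phi> (\<xi> s))" C "norm (g s)"]
      by (simp add: bounds_def)
    then show "AE s in lebesgue. norm (d\<phi> (\<xi> s) (g s)) \<le> C * norm (g s) + 0 * norm (g s) + 0 * norm (g s)"
      by simp
  qed
  moreover have "square_integrable (\<lambda>s. \<psi> (y s))"
  proof (rule square_integrable_l2sq_bound(1)[OF _ y y y, where a=C and b=0 and c=0])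
    show "(\<lambda>s. \<psi> (y s)) \<in> borel_measurable lebesgue"
      by (rule borel_measurable_continuous_on_compose[OF continuous_on_has_derivative, of "i -` U"])
        (use V y \<psi>_deriv in \<open>auto simp: square_integrable_def\<close>)
    show "AE s in lebesgue. norm (\<psi> (y s)) \<le> C * norm (y s) + 0 * norm (y s) + 0 * norm (y s)"
      using eq
    proof eventually_elim
      fix s assume "\<xi> s = i (y s)"
      then have "norm (\<psi> (y s)) \<le> C * norm (y s)" using B0[of s] unfolding bounds_def by metis
      then show "norm (\<psi> (y s)) \<le> C * norm (y s) + 0 * norm (y s) + 0 * norm (y s)" by simp
    qed
  qed
  moreover have "AE s in lebesgue. \<phi> (\<xi> s) = i (\<psi> (y s))"
    using eq by eventually_elim (simp add: i_\<psi>[OF V])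
  ultimately show ?thesis using p' by (simp add: repr_def)
qed

text \<open>Chain rule for the evaluation map that sends \<open>(x, v)\<close> to
  \<open>d\<phi> x v\<close>, which is C1 because \<open>\<phi>\<close> is C2. Here
  \<open>blinfun.prod_left\<close> is evaluation of an operator at a fixed vector.\<close>

lemma primitive_d\<phi>:
  assumes \<xi>: "continuous_on UNIV \<xi>" "primitive \<xi> g" "\<And>s. \<xi> s \<in> U"
    and h: "continuous_on UNIV h" "primitive h g'"
  shows "primitive (\<lambda>s. d\<phi> (\<xi> s) (h s)) (\<lambda>s. dd\<phi> (\<xi> s) (g s) (h s) + d\<phi> (\<xi> s) (g' s))"
proof -
  let ?S = "U \<times> (UNIV :: 'h1 set)"
  let ?F' = "\<lambda>z. (blinfun.prod_left (snd z) o\<^sub>L (dd\<phi> (fst z) o\<^sub>L fst_blinfun)) + (d\<phi> (fst z) o\<^sub>L snd_blinfun)"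
  from \<xi>(2) h(2) have "primitive (\<lambda>s. (\<xi> s, h s)) (\<lambda>s. (g s, g' s))"
    by (rule primitive_Pair)
  then have "primitive (\<lambda>s. (\<lambda>z. d\<phi> (fst z) (snd z)) (\<xi> s, h s)) (\<lambda>s. ?F' (\<xi> s, h s) (g s, g' s))"
  proof (rule primitive_compose)
    show "continuous_on UNIV (\<lambda>s. (\<xi> s, h s))" by (intro continuous_intros \<xi> h)
    show "open ?S" using open_U by (intro open_Times) auto
    show "(\<xi> s, h s) \<in> ?S" for s using \<xi>(3) by simp
    show "continuous_on ?S ?F'"
      by (intro continuous_on_add bounded_bilinear.continuous_on[OF bounded_bilinear_blinfun_compose]
          continuous_on_const bounded_linear.continuous_on[OF blinfun.bounded_linear_prod_left]
          continuous_on_snd continuous_on_compose2[OF dd\<phi>_cont] continuous_on_compose2[OF d\<phi>_cont]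
          continuous_on_fst continuous_on_id) auto
    fix z assume "z \<in> ?S"
    then have z: "fst z \<in> U" by auto
    have "((\<lambda>z. d\<phi> (fst z)) has_derivative (\<lambda>v. dd\<phi> (fst z) (fst v))) (at z)"
      by (rule has_derivative_compose[of fst fst z UNIV d\<phi> "blinfun_apply (dd\<phi> (fst z))", OF _ d\<phi>_deriv[OF z]])
        (auto intro!: derivative_eq_intros)
    moreover have "((\<lambda>z::'h1 \<times> 'h1. snd z) has_derivative (\<lambda>v. snd v)) (at z)"
      by (auto intro!: derivative_eq_intros)
    ultimately have "((\<lambda>z. d\<phi> (fst z) (snd z)) has_derivative
        (\<lambda>v. d\<phi> (fst z) (snd v) + dd\<phi> (fst z) (fst v) (snd z))) (at z)"
      by (rule blinfun.FDERIV)
    moreover have "blinfun_apply (?F' z) = (\<lambda>v. d\<phi> (fst z) (snd v) + dd\<phi> (fst z) (fst v) (snd z))"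
      by (simp add: fun_eq_iff blinfun.add_left)
    ultimately show "((\<lambda>z. d\<phi> (fst z) (snd z)) has_derivative blinfun_apply (?F' z)) (at z)"
      by simp
  qed
  then show ?thesis by (simp add: blinfun.add_left)
qed

text \<open>In the products of \<open>g s\<close> with \<open>h s\<close> and of
  \<open>norm (y s)\<close> with \<open>norm (i (m s))\<close>, the factor from \<open>h\<close> is
  taken in the supremum norm and the one from \<open>\<xi>\<close> in L2. Since
  \<open>H = 2 * W12_L2_norm i h\<close>, the square of \<open>C * H\<close> produces the 4 in the
  bound; the 1 comes from the terms in \<open>g'\<close> and \<open>m\<close>.\<close>

lemma repr_d\<phi>:
  assumes r: "repr i \<xi> g y" and U: "\<And>s. \<xi> s \<in> U" and V: "\<And>s. i (y s) \<in> U"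
    and h: "repr i h g' m" and B: "\<And>s. bounds C (\<xi> s)"
  shows "repr i (\<lambda>s. d\<phi> (\<xi> s) (h s)) (\<lambda>s. dd\<phi> (\<xi> s) (g s) (h s) + d\<phi> (\<xi> s) (g' s)) (\<lambda>s. d\<psi> (y s) (m s))"
    and "(W12_L2_norm i (\<lambda>s. d\<phi> (\<xi> s) (h s)))\<^sup>2
      \<le> 3 * C\<^sup>2 * (4 * (W12_L2_norm i \<xi>)\<^sup>2 + 1) * (W12_L2_norm i h)\<^sup>2"
proof -
  have \<xi>: "continuous_on UNIV \<xi>" "primitive \<xi> g" "square_integrable g" "square_integrable y"
    and \<xi>_eq: "AE s in lebesgue. \<xi> s = i (y s)"
    using r by (auto simp: repr_def)
  have hh: "continuous_on UNIV h" "primitive h g'" "square_integrable g'" "square_integrable m"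
    and h_eq: "AE s in lebesgue. h s = i (m s)"
    using h by (auto simp: repr_def)
  have C: "C \<ge> 0" by (rule bounds_nonneg[OF B])
  define H where "H = 2 * W12_L2_norm i h"
  have H: "norm (h s) \<le> H" for s unfolding H_def by (rule repr_norm_le[OF incl h])
  let ?g = "\<lambda>s. dd\<phi> (\<xi> s) (g s) (h s) + d\<phi> (\<xi> s) (g' s)" and ?k = "\<lambda>s. d\<psi> (y s) (m s)"
  have p': "primitive (\<lambda>s. d\<phi> (\<xi> s) (h s)) ?g"
    by (rule primitive_d\<phi>[OF \<xi>(1,2) U hh(1,2)])
  have g_le: "norm (?g s) \<le> (C * H) * norm (g s) + C * norm (g' s) + 0 * norm (g' s)" for s
  proof -
    have 1: "norm (dd\<phi> (\<xi> s) (g s) (h s)) \<le> (C * H) * norm (g s)"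
      by (rule norm_blinfun_twice_le[OF _ H]) (use B[of s] in \<open>simp add: bounds_def\<close>)
    have "norm (d\<phi> (\<xi> s) (g' s)) \<le> norm (d\<phi> (\<xi> s)) * norm (g' s)" by (rule norm_blinfun)
    also have "\<dots> \<le> C * norm (g' s)" using B[of s] by (intro mult_right_mono) (auto simp: bounds_def)
    finally show ?thesis using 1 norm_triangle_ineq[of "dd\<phi> (\<xi> s) (g s) (h s)" "d\<phi> (\<xi> s) (g' s)"] by linarith
  qed
  have k_le: "AE s in lebesgue. norm (?k s) \<le> (C * H) * norm (y s) + C * norm (m s) + 0 * norm (m s)"
    using \<xi>_eq h_eq
  proof eventually_elim
    fix s assume s: "\<xi> s = i (y s)" "h s = i (m s)"
    have "norm (?k s) \<le> C * (norm (m s) + norm (y s) * norm (i (m s)))"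
      using B[of s] s by (simp add: bounds_def)
    also have "\<dots> \<le> C * (norm (m s) + norm (y s) * H)"
      using C H[of s] s by (intro mult_left_mono add_mono) auto
    finally show "norm (?k s) \<le> (C * H) * norm (y s) + C * norm (m s) + 0 * norm (m s)"
      by (simp add: algebra_simps)
  qed
  have "continuous_on UNIV (\<lambda>s. d\<phi> (\<xi> s) (h s))"
    by (intro blinfun.continuous_on continuous_on_compose2[OF d\<phi>_cont \<xi>(1)] hh(1)) (use U in auto)
  moreover have "square_integrable ?g"
    by (rule square_integrable_l2sq_bound(1)[OF _ \<xi>(3) hh(3) hh(3) AE_I2[OF g_le]])
      (use p' in \<open>simp add: primitive_def\<close>)
  moreover have "square_integrable ?k"
  proof (rule square_integrable_l2sq_bound(1)[OF _ \<xi>(4) hh(4) hh(4) k_le])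
    have "continuous_on (i -` U) d\<psi>"
      by (rule continuous_on_has_derivative[OF d\<psi>_deriv]) simp
    then show "?k \<in> borel_measurable lebesgue"
      by (rule borel_measurable_blinfun_compose) (use \<xi> hh V in \<open>auto simp: square_integrable_def\<close>)
  qed
  moreover have "AE s in lebesgue. d\<phi> (\<xi> s) (h s) = i (?k s)"
    using \<xi>_eq h_eq by eventually_elim (simp add: i_d\<psi>[OF V])
  ultimately show rT: "repr i (\<lambda>s. d\<phi> (\<xi> s) (h s)) ?g ?k"
    using p' by (simp add: repr_def)
  have "(W12_L2_norm i (\<lambda>s. d\<phi> (\<xi> s) (h s)))\<^sup>2
      \<le> 3 * ((C * H)\<^sup>2 * (W12_L2_norm i \<xi>)\<^sup>2 + C\<^sup>2 * (W12_L2_norm i h)\<^sup>2 + 0\<^sup>2 * (W12_L2_norm i h)\<^sup>2)"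
    by (rule repr_norm_bound[OF incl rT r h h g_le k_le])
  then show "(W12_L2_norm i (\<lambda>s. d\<phi> (\<xi> s) (h s)))\<^sup>2
      \<le> 3 * C\<^sup>2 * (4 * (W12_L2_norm i \<xi>)\<^sup>2 + 1) * (W12_L2_norm i h)\<^sup>2"
    by (simp add: H_def power_mult_distrib algebra_simps)
qed

text \<open>The coefficients are common upper bounds for both components: \<open>e * H\<close>
  arises for the weak derivative and \<open>C * H * H\<close> in H2, while \<open>C * H\<close> and
  \<open>2 * C * H + C * H * H\<close> are both at most \<open>3 * C * H\<close> because
  \<open>H \<le> 1\<close>.\<close>

lemma remainder_bound:
  assumes r: "repr i \<xi> g y" and U: "\<And>s. \<xi> s \<in> U" and V: "\<And>s. i (y s) \<in> U"
    and h: "repr i h g' m" and B: "\<And>s z. dist (\<xi> s) z < d \<Longrightarrow> bounds C z"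
    and E: "\<And>s z. dist (\<xi> s) z < d \<Longrightarrow> z \<in> U \<and> norm (dd\<phi> z - dd\<phi> (\<xi> s)) \<le> e"
    and H: "H = 2 * W12_L2_norm i h" "H < d" "H \<le> 1"
  shows "(W12_L2_norm i ((\<lambda>s. \<phi> ((\<xi> + h) s)) - (\<lambda>s. \<phi> (\<xi> s)) - (\<lambda>s. d\<phi> (\<xi> s) (h s))))\<^sup>2
    \<le> 3 * ((H * (e + C * H))\<^sup>2 * (W12_L2_norm i \<xi>)\<^sup>2 + (3 * C * H)\<^sup>2 * (W12_L2_norm i h)\<^sup>2)"
proof -
  have hs: "norm (h s) \<le> H" for s unfolding H(1) by (rule repr_norm_le[OF incl h])
  have H0: "H \<ge> 0" using W12_L2_norm_nonneg by (simp add: H(1))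
  have d: "d > 0" using H0 H(2) by linarith
  have B0: "bounds C (\<xi> s)" for s using B[of s "\<xi> s"] d by simp
  have C: "C \<ge> 0" by (rule bounds_nonneg[OF B0])
  have e: "e \<ge> 0" using E[of 0 "\<xi> 0"] d norm_ge_zero[of "dd\<phi> (\<xi> 0) - dd\<phi> (\<xi> 0)"] by simp
  have U': "(\<xi> + h) s \<in> U" for s
    using E[of s "(\<xi> + h) s"] hs[of s] H(2) by (simp add: dist_norm)
  obtain z where z: "repr i (\<xi> + h) (\<lambda>s. g s + g' s) z" "\<And>s. i (z s) \<in> U"
    "AE s in lebesgue. y s + m s = z s"
    by (rule repr_in_domain[OF repr_add[OF incl r h] U']) blast
  let ?R = "(\<lambda>s. \<phi> ((\<xi> + h) s)) - (\<lambda>s. \<phi> (\<xi> s)) - (\<lambda>s. d\<phi> (\<xi> s) (h s))"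
  let ?g = "\<lambda>s. d\<phi> ((\<xi> + h) s) (g s + g' s) - d\<phi> (\<xi> s) (g s)
      - (dd\<phi> (\<xi> s) (g s) (h s) + d\<phi> (\<xi> s) (g' s))"
  let ?k = "\<lambda>s. \<psi> (z s) - \<psi> (y s) - d\<psi> (y s) (m s)"
  have R: "repr i ?R ?g ?k"
    by (rule repr_diff[OF incl repr_diff[OF incl repr_\<phi>[OF z(1) U' z(2)] repr_\<phi>[OF r U V]]
          repr_d\<phi>(1)[OF r U V h B0]])
  have "(W12_L2_norm i ?R)\<^sup>2 \<le> 3 * ((H * (e + C * H))\<^sup>2 * (W12_L2_norm i \<xi>)\<^sup>2
      + (3 * C * H)\<^sup>2 * (W12_L2_norm i h)\<^sup>2 + 0\<^sup>2 * (W12_L2_norm i h)\<^sup>2)"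
  proof (rule repr_norm_bound[OF incl R r h h])
    fix s
    let ?x = "\<xi> s" and ?v = "h s"
    have v: "norm ?v < d" using hs[of s] H(2) by linarith
    \<comment> \<open>The chain rule yields \<open>dd\<phi>\<close> with the weak derivative first,
      the Taylor expansion of \<open>d\<phi>\<close> with the increment first; symmetry reconciles
      them.\<close>
    have "dd\<phi> ?x (g s) ?v = dd\<phi> ?x ?v (g s)"
      by (rule C2_with_symmetric[OF C2_\<phi> open_U U])
    then have "?g s = (d\<phi> (?x + ?v) - d\<phi> ?x - dd\<phi> ?x ?v) (g s) + (d\<phi> (?x + ?v) - d\<phi> ?x) (g' s)"
      by (simp add: blinfun.add_right blinfun.diff_left)
    also have "norm \<dots> \<le> norm (d\<phi> (?x + ?v) - d\<phi> ?x - dd\<phi> ?x ?v) * norm (g s)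
        + norm (d\<phi> (?x + ?v) - d\<phi> ?x) * norm (g' s)"
      by (intro norm_triangle_mono norm_blinfun)
    also have "\<dots> \<le> (e * H) * norm (g s) + (C * H) * norm (g' s)"
    proof (intro add_mono mult_right_mono norm_ge_zero)
      show "norm (d\<phi> (?x + ?v) - d\<phi> ?x - dd\<phi> ?x ?v) \<le> e * H"
        using d\<phi>_taylor[of ?x d e ?v, OF E[of s] v] mult_left_mono[OF hs[of s] e] by linarith
      show "norm (d\<phi> (?x + ?v) - d\<phi> ?x) \<le> C * H"
        using d\<phi>_increment[of ?x d C ?v, OF B[of s] v] mult_left_mono[OF hs[of s] C] by linarith
    qed
    also have "\<dots> \<le> (H * (e + C * H)) * norm (g s) + (3 * C * H) * norm (g' s)"
      using H0 C e by (intro add_mono mult_right_mono) (auto simp: algebra_simps)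
    finally show "norm (?g s) \<le> (H * (e + C * H)) * norm (g s) + (3 * C * H) * norm (g' s) + 0 * norm (g' s)"
      by simp
  next
    have "AE s in lebesgue. \<xi> s = i (y s)" "AE s in lebesgue. h s = i (m s)"
      using r h by (auto simp: repr_def)
    then show "AE s in lebesgue. norm (?k s)
        \<le> (H * (e + C * H)) * norm (y s) + (3 * C * H) * norm (m s) + 0 * norm (m s)"
      using z(3)
    proof eventually_elim
      fix s assume s: "\<xi> s = i (y s)" "h s = i (m s)" "y s + m s = z s"
      have im: "norm (i (m s)) \<le> H" using hs[of s] s by simp
      have "norm (?k s) \<le> C * (2 * norm (i (m s)) * norm (m s)
          + (norm (y s) + norm (m s)) * norm (i (m s)) * norm (i (m s)))"
        unfolding s(3)[symmetric]
        by (rule \<psi>_taylor) (use B[of s] s im H(2) in auto)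
      also have "\<dots> \<le> C * (2 * H * norm (m s) + (norm (y s) + norm (m s)) * H * H)"
        using C im H0 by (intro mult_left_mono add_mono mult_mono mult_right_mono) auto
      also have "\<dots> = (C * H * H) * norm (y s) + (2 * C * H + (C * H) * H) * norm (m s)"
        by (simp add: algebra_simps)
      also have "\<dots> \<le> (H * (e + C * H)) * norm (y s) + (3 * C * H) * norm (m s)"
      proof (intro add_mono mult_right_mono norm_ge_zero)
        show "C * H * H \<le> H * (e + C * H)" using H0 e by (simp add: algebra_simps)
        show "2 * C * H + C * H * H \<le> 3 * C * H"
          using mult_left_mono[OF H(3), of "C * H"] C H0 by simp
      qed
      finally show "norm (?k s)
          \<le> (H * (e + C * H)) * norm (y s) + (3 * C * H) * norm (m s) + 0 * norm (m s)" by simp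
    qed
  qed
  then show ?thesis by simp
qed

text \<open>The increment of \<open>dd\<phi> (\<xi> s) (g s) (h s)\<close> splits into a change of
  base point, small by the continuity bound \<open>e\<close>, and a change of \<open>g\<close> by
  the weak derivative \<open>g''\<close> of \<open>w\<close>, whose coefficient is not small but
  whose L2 norm is controlled by that of \<open>w\<close>.\<close>

lemma derivative_increment_bound:
  assumes r: "repr i \<xi> g y" and U: "\<And>s. \<xi> s \<in> U" and V: "\<And>s. i (y s) \<in> U"
    and w: "repr i w g'' l" and h: "repr i h g' m" and B: "\<And>s z. dist (\<xi> s) z < d \<Longrightarrow> bounds C z"
    and E: "\<And>s z. dist (\<xi> s) z < d \<Longrightarrow> z \<in> U \<and> norm (dd\<phi> z - dd\<phi> (\<xi> s)) \<le> e"
    and H: "H = 2 * W12_L2_norm i h" and Z: "Z = 2 * W12_L2_norm i w" "Z < d" "Z \<le> 1"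
  shows "(W12_L2_norm i ((\<lambda>s. d\<phi> ((\<xi> + w) s) (h s)) - (\<lambda>s. d\<phi> (\<xi> s) (h s))))\<^sup>2
    \<le> 3 * ((H * (e + C * Z))\<^sup>2 * (W12_L2_norm i \<xi>)\<^sup>2 + (2 * C * H)\<^sup>2 * (W12_L2_norm i w)\<^sup>2
        + (C * Z)\<^sup>2 * (W12_L2_norm i h)\<^sup>2)"
proof -
  have hs: "norm (h s) \<le> H" for s unfolding H(1) by (rule repr_norm_le[OF incl h])
  have ws: "norm (w s) \<le> Z" for s unfolding Z(1) by (rule repr_norm_le[OF incl w])
  have H0: "H \<ge> 0" and Z0: "Z \<ge> 0" using W12_L2_norm_nonneg by (auto simp: H(1) Z(1))
  have d: "d > 0" using Z0 Z(2) by linarith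
  have B0: "bounds C (\<xi> s)" for s using B[of s "\<xi> s"] d by simp
  have B1: "bounds C ((\<xi> + w) s)" for s
    by (rule B[of s]) (use ws[of s] Z(2) in \<open>simp add: dist_norm\<close>)
  have C: "C \<ge> 0" by (rule bounds_nonneg[OF B0])
  have e: "e \<ge> 0" using E[of 0 "\<xi> 0"] d norm_ge_zero[of "dd\<phi> (\<xi> 0) - dd\<phi> (\<xi> 0)"] by simp
  have U': "(\<xi> + w) s \<in> U" for s using B1 by (simp add: bounds_def)
  obtain z where z: "repr i (\<xi> + w) (\<lambda>s. g s + g'' s) z" "\<And>s. i (z s) \<in> U"
    "AE s in lebesgue. y s + l s = z s"
    by (rule repr_in_domain[OF repr_add[OF incl r w] U']) blast
  let ?R = "(\<lambda>s. d\<phi> ((\<xi> + w) s) (h s)) - (\<lambda>s. d\<phi> (\<xi> s) (h s))"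
  let ?g = "\<lambda>s. (dd\<phi> ((\<xi> + w) s) (g s + g'' s) (h s) + d\<phi> ((\<xi> + w) s) (g' s))
      - (dd\<phi> (\<xi> s) (g s) (h s) + d\<phi> (\<xi> s) (g' s))"
  let ?k = "\<lambda>s. d\<psi> (z s) (m s) - d\<psi> (y s) (m s)"
  have R: "repr i ?R ?g ?k"
    by (rule repr_diff[OF incl repr_d\<phi>(1)[OF z(1) U' z(2) h B1] repr_d\<phi>(1)[OF r U V h B0]])
  show ?thesis
  proof (rule repr_norm_bound[OF incl R r w h])
    fix s
    let ?x = "\<xi> s" and ?v = "w s"
    have v: "norm ?v < d" using ws[of s] Z(2) by linarith
    have near: "dist ?x (?x + ?v) < d" using v by (simp add: dist_norm)
    have "?g s = (dd\<phi> (?x + ?v) - dd\<phi> ?x) (g s) (h s) + dd\<phi> (?x + ?v) (g'' s) (h s)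
        + (d\<phi> (?x + ?v) - d\<phi> ?x) (g' s)"
      by (simp add: blinfun.add_right blinfun.add_left blinfun.diff_left)
    also have "norm \<dots> \<le> e * H * norm (g s) + C * H * norm (g'' s) + (C * Z) * norm (g' s)"
    proof (intro norm_triangle_mono)
      show "norm ((dd\<phi> (?x + ?v) - dd\<phi> ?x) (g s) (h s)) \<le> e * H * norm (g s)"
        by (rule norm_blinfun_twice_le[OF _ hs]) (use E[OF near] in simp)
      show "norm (dd\<phi> (?x + ?v) (g'' s) (h s)) \<le> C * H * norm (g'' s)"
        by (rule norm_blinfun_twice_le[OF _ hs]) (use B[OF near] in \<open>simp add: bounds_def\<close>)
      have "norm (d\<phi> (?x + ?v) - d\<phi> ?x) \<le> C * Z"
        using d\<phi>_increment[of ?x d C ?v, OF B[of s] v] mult_left_mono[OF ws[of s] C] by linarith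
      then have "norm (d\<phi> (?x + ?v) - d\<phi> ?x) * norm (g' s) \<le> (C * Z) * norm (g' s)"
        by (rule mult_right_mono) simp
      then show "norm ((d\<phi> (?x + ?v) - d\<phi> ?x) (g' s)) \<le> (C * Z) * norm (g' s)"
        by (rule order_trans[OF norm_blinfun])
    qed
    also have "\<dots> \<le> (H * (e + C * Z)) * norm (g s) + (2 * C * H) * norm (g'' s) + (C * Z) * norm (g' s)"
      using H0 C e Z0 by (intro add_mono mult_right_mono) (auto simp: algebra_simps)
    finally show "norm (?g s)
        \<le> (H * (e + C * Z)) * norm (g s) + (2 * C * H) * norm (g'' s) + (C * Z) * norm (g' s)" .
  next
    have "AE s in lebesgue. \<xi> s = i (y s)" "AE s in lebesgue. w s = i (l s)" "AE s in lebesgue. h s = i (m s)"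
      using r w h by (auto simp: repr_def)
    then show "AE s in lebesgue. norm (?k s)
        \<le> (H * (e + C * Z)) * norm (y s) + (2 * C * H) * norm (l s) + (C * Z) * norm (m s)"
      using z(3)
    proof eventually_elim
      fix s assume s: "\<xi> s = i (y s)" "w s = i (l s)" "h s = i (m s)" "y s + l s = z s"
      have il: "norm (i (l s)) \<le> Z" and im: "norm (i (m s)) \<le> H" using ws[of s] hs[of s] s by auto
      have "norm (?k s) \<le> C * (norm (i (l s)) * norm (m s) + norm (l s) * norm (i (m s))
          + (norm (y s) + norm (l s)) * norm (i (l s)) * norm (i (m s)))"
        unfolding s(4)[symmetric]
        by (rule d\<psi>_increment) (use B[of s] s il Z(2) in auto)
      also have "\<dots> \<le> C * (Z * norm (m s) + norm (l s) * H + (norm (y s) + norm (l s)) * Z * H)"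
        using C il im H0 Z0 by (intro mult_left_mono add_mono mult_mono mult_right_mono) auto
      also have "\<dots> = (C * Z * H) * norm (y s) + (C * H + (C * H) * Z) * norm (l s) + (C * Z) * norm (m s)"
        by (simp add: algebra_simps)
      also have "\<dots> \<le> (H * (e + C * Z)) * norm (y s) + (2 * C * H) * norm (l s) + (C * Z) * norm (m s)"
      proof (intro add_mono mult_right_mono norm_ge_zero order_refl)
        show "C * Z * H \<le> H * (e + C * Z)" using H0 e by (simp add: algebra_simps)
        show "C * H + C * H * Z \<le> 2 * C * H"
          using mult_left_mono[OF Z(3), of "C * H"] C H0 by simp
      qed (rule Z0)
      finally show "norm (?k s)
          \<le> (H * (e + C * Z)) * norm (y s) + (2 * C * H) * norm (l s) + (C * Z) * norm (m s)" .
    qed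
  qed
qed

end

text \<open>With the factors 4, 3 and 2 the bracket is at most
  \<open>(n * \<epsilon>)\<^sup>2 * (16 * M\<^sup>2 + 13)\<close>, and
  \<open>16 * M\<^sup>2 + 13 \<le> 16 * (M + 1)\<^sup>2\<close>. The outer 3 then gives 48, just
  below \<open>7 * 7\<close>, which explains the 7 in \<open>\<epsilon>\<close>.\<close>

lemma norm_le_of_square_bound:
  fixes X :: real
  assumes X: "X\<^sup>2 \<le> 3 * (a\<^sup>2 * M\<^sup>2 + b\<^sup>2 + c\<^sup>2)" and M: "M \<ge> 0" and n: "n \<ge> 0" and e: "e > 0"
    and \<epsilon>: "\<epsilon> = e / (7 * (M + 1))"
    and abc: "0 \<le> a" "a \<le> 4 * n * \<epsilon>" "0 \<le> b" "b \<le> 3 * n * \<epsilon>" "0 \<le> c" "c \<le> 2 * n * \<epsilon>"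
  shows "X \<le> e * n"
proof -
  have \<epsilon>0: "\<epsilon> > 0" using e M by (simp add: \<epsilon>)
  have "a\<^sup>2 * M\<^sup>2 + b\<^sup>2 + c\<^sup>2 \<le> (4 * n * \<epsilon>)\<^sup>2 * M\<^sup>2 + (3 * n * \<epsilon>)\<^sup>2 + (2 * n * \<epsilon>)\<^sup>2"
    using abc by (intro add_mono mult_right_mono power_mono) auto
  also have "\<dots> = (n * \<epsilon>)\<^sup>2 * (16 * M\<^sup>2 + 13)"
    by (simp add: power2_eq_square algebra_simps)
  also have "\<dots> \<le> (n * \<epsilon>)\<^sup>2 * (16 * (M + 1)\<^sup>2)"
  proof (rule mult_left_mono)
    show "16 * M\<^sup>2 + 13 \<le> 16 * (M + 1)\<^sup>2" using M by (simp add: power2_eq_square algebra_simps)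
  qed simp
  finally have "3 * (a\<^sup>2 * M\<^sup>2 + b\<^sup>2 + c\<^sup>2) \<le> 3 * ((n * \<epsilon>)\<^sup>2 * (16 * (M + 1)\<^sup>2))"
    by (rule mult_left_mono) simp
  with X have "X\<^sup>2 \<le> 3 * ((n * \<epsilon>)\<^sup>2 * (16 * (M + 1)\<^sup>2))" by (rule order_trans)
  also have "\<dots> = 48 * ((n * \<epsilon>)\<^sup>2 * (M + 1)\<^sup>2)" by simp
  also have "\<dots> \<le> 49 * ((n * \<epsilon>)\<^sup>2 * (M + 1)\<^sup>2)" by simp
  also have "\<dots> = (n * (7 * (\<epsilon> * (M + 1))))\<^sup>2" by (simp add: power_mult_distrib)
  also have "7 * (\<epsilon> * (M + 1)) = e" using M by (simp add: \<epsilon> field_simps)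
  finally have "X \<le> n * e"
    by (rule power2_le_imp_le) (use e n in simp)
  then show ?thesis by (simp only: mult.commute)
qed

section \<open>Frechet differentiability and continuity of the derivative\<close>

context tame_setup
begin

abbreviation N :: "(real \<Rightarrow> 'h1) \<Rightarrow> real" where "N \<equiv> W12_L2_norm i"

definition domain :: "(real \<Rightarrow> 'h1) set" where
  "domain = {\<xi> \<in> W12_L2 i. \<forall>s. \<xi> s \<in> U}"

lemma domain_repr:
  assumes "\<xi> \<in> domain"
  obtains g y where "repr i \<xi> g y" "\<And>s. i (y s) \<in> U" "\<And>s. \<xi> s \<in> U"
proof -
  have \<xi>: "\<xi> \<in> W12_L2 i" "\<And>s. \<xi> s \<in> U" using assms by (auto simp: domain_def)
  obtain g where "repr i \<xi> g (\<lambda>s. inv i (\<xi> s))" by (rule W12_L2_imp_repr[OF \<xi>(1)])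
  then obtain y where "repr i \<xi> g y" "\<And>s. i (y s) \<in> U"
    by (rule repr_in_domain[OF _ \<xi>(2)]) blast
  then show thesis using that \<xi>(2) by blast
qed

lemma superposition_in_W12_L2:
  assumes "\<xi> \<in> domain"
  shows "(\<lambda>s. \<phi> (\<xi> s)) \<in> W12_L2 i"
proof -
  obtain g y where "repr i \<xi> g y" "\<And>s. i (y s) \<in> U" "\<And>s. \<xi> s \<in> U"
    using domain_repr[OF assms] by metis
  then show ?thesis using repr_imp_W12_L2(1)[OF incl repr_\<phi>] by blast
qed

text \<open>By the supremum bound a norm ball of radius \<open>d / 2\<close> consists of curves
  within H1 distance \<open>d\<close> of \<open>\<xi>\<close>, uniformly in
  \<open>s\<close>.\<close>

lemma open_domain: "open_subset_of (W12_L2 i) N domain"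
  unfolding open_subset_of_def
proof (intro conjI ballI)
  show "domain \<subseteq> W12_L2 i" by (auto simp: domain_def)
  fix \<xi> assume "\<xi> \<in> domain"
  then obtain g y where r: "repr i \<xi> g y" and U: "\<And>s. \<xi> s \<in> U"
    using domain_repr by metis
  obtain d C where d: "d > 0" "\<And>s z. dist (\<xi> s) z < d \<Longrightarrow> bounds C z"
    by (rule bounds_near_range[OF r U]) blast
  have "\<eta> \<in> domain" if \<eta>: "\<eta> \<in> W12_L2 i" "N (\<eta> - \<xi>) < d / 2" for \<eta>
  proof -
    obtain g' where r': "repr i \<eta> g' (\<lambda>s. inv i (\<eta> s))" by (rule W12_L2_imp_repr[OF \<eta>(1)])
    have "\<eta> s \<in> U" for s
    proof -
      have "norm ((\<eta> - \<xi>) s) \<le> 2 * N (\<eta> - \<xi>)"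
        by (rule repr_norm_le[OF incl repr_diff[OF incl r' r]])
      then have "dist (\<xi> s) (\<eta> s) < d" using \<eta>(2) by (simp add: dist_norm norm_minus_commute)
      then show ?thesis using d(2) by (simp add: bounds_def)
    qed
    then show ?thesis using \<eta>(1) by (simp add: domain_def)
  qed
  then show "\<exists>d>0. \<forall>\<eta>\<in>W12_L2 i. N (\<eta> - \<xi>) < d \<longrightarrow> \<eta> \<in> domain"
    using d(1) by (intro exI[of _ "d / 2"]) auto
qed

text \<open>\<open>n\<close> stands for the norm of a perturbation and \<open>2 * n\<close> for its
  supremum bound. Below \<open>\<rho>\<close> the perturbed curve stays within \<open>d\<close>, the
  cap 1 absorbs higher powers, and \<open>C\<close> times the perturbation is at most
  \<open>\<epsilon>\<close>.\<close>

lemma small_radius: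
  assumes r: "repr i \<xi> g y" and U: "\<And>s. \<xi> s \<in> U" and \<epsilon>: "\<epsilon> > 0"
  obtains d C \<rho> where "C > 0" "\<And>s z. dist (\<xi> s) z < d \<Longrightarrow> bounds C z"
    "\<And>s z. dist (\<xi> s) z < d \<Longrightarrow> z \<in> U \<and> norm (dd\<phi> z - dd\<phi> (\<xi> s)) \<le> \<epsilon>"
    "\<rho> > 0" "\<And>n. n < \<rho> \<Longrightarrow> 2 * n < d \<and> 2 * n \<le> 1 \<and> C * (2 * n) \<le> \<epsilon>"
proof -
  obtain d1 C where d1: "d1 > 0" and C: "C > 0" and B: "\<And>s z. dist (\<xi> s) z < d1 \<Longrightarrow> bounds C z"
    by (rule bounds_near_range[OF r U]) blast
  obtain d2 where d2: "d2 > 0"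
    and E: "\<And>s z. dist (\<xi> s) z < d2 \<Longrightarrow> z \<in> U \<and> norm (dd\<phi> z - dd\<phi> (\<xi> s)) \<le> \<epsilon>"
    by (rule dd\<phi>_near_range[OF r U \<epsilon>]) blast
  define d where "d = min d1 d2"
  define \<rho> where "\<rho> = min (d / 2) (min (1 / 2) (\<epsilon> / (2 * C)))"
  have "\<rho> > 0" using d1 d2 C \<epsilon> by (simp add: \<rho>_def d_def)
  moreover have "2 * n < d \<and> 2 * n \<le> 1 \<and> C * (2 * n) \<le> \<epsilon>" if "n < \<rho>" for n
  proof -
    have "n < d / 2" "n < 1 / 2" "n < \<epsilon> / (2 * C)" using that by (auto simp: \<rho>_def)
    then show ?thesis using C by (auto simp: field_simps)
  qed
  moreover have "bounds C z" "z \<in> U \<and> norm (dd\<phi> z - dd\<phi> (\<xi> s)) \<le> \<epsilon>" if "dist (\<xi> s) z < d" for s z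
    using B[of s z] E[of s z] that by (auto simp: d_def)
  ultimately show thesis using that[of C d \<rho>] C by blast
qed

lemma frechet_derivative_superposition:
  assumes "\<xi> \<in> domain"
  shows "frechet_derivative_on (W12_L2 i) N (\<lambda>\<xi> s. \<phi> (\<xi> s)) (\<lambda>h s. d\<phi> (\<xi> s) (h s)) \<xi>"
  unfolding frechet_derivative_on_def
proof (intro conjI allI impI)
  let ?T = "\<lambda>h s. d\<phi> (\<xi> s) (h s)"
  obtain g y where r: "repr i \<xi> g y" and V: "\<And>s. i (y s) \<in> U" and U: "\<And>s. \<xi> s \<in> U"
    using domain_repr[OF assms] by metis
  obtain d C where d: "d > 0" and B: "\<And>s z. dist (\<xi> s) z < d \<Longrightarrow> bounds C z"
    by (rule bounds_near_range[OF r U]) blast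
  have B0: "bounds C (\<xi> s)" for s using B[of s "\<xi> s"] d by simp
  define L where "L = 3 * C\<^sup>2 * (4 * (N \<xi>)\<^sup>2 + 1)"
  have T: "?T h \<in> W12_L2 i \<and> N (?T h) \<le> sqrt L * N h" if h: "h \<in> W12_L2 i" for h
  proof -
    obtain g' where rh: "repr i h g' (\<lambda>s. inv i (h s))" by (rule W12_L2_imp_repr[OF h])
    have "(N (?T h))\<^sup>2 \<le> L * (N h)\<^sup>2"
      unfolding L_def by (rule repr_d\<phi>(2)[OF r U V rh B0])
    then have "N (?T h) \<le> sqrt (L * (N h)\<^sup>2)" by (rule real_le_rsqrt)
    also have "\<dots> = sqrt L * N h" by (simp add: real_sqrt_mult W12_L2_norm_nonneg)
    finally show ?thesis using repr_imp_W12_L2(1)[OF incl repr_d\<phi>(1)[OF r U V rh B0]] by simp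
  qed
  show "bounded_linear_on (W12_L2 i) N ?T"
    unfolding bounded_linear_on_def using T
    by (auto simp: fun_eq_iff blinfun.add_right blinfun.scaleR_right)
  fix e :: real assume e: "e > 0"
  define \<epsilon> where "\<epsilon> = e / (7 * (N \<xi> + 1))"
  have M: "N \<xi> \<ge> 0" by (rule W12_L2_norm_nonneg)
  have \<epsilon>: "\<epsilon> > 0" using e M by (simp add: \<epsilon>_def)
  obtain d C \<rho> where C: "C > 0" and B: "\<And>s z. dist (\<xi> s) z < d \<Longrightarrow> bounds C z"
    and E: "\<And>s z. dist (\<xi> s) z < d \<Longrightarrow> z \<in> U \<and> norm (dd\<phi> z - dd\<phi> (\<xi> s)) \<le> \<epsilon>"
    and \<rho>: "\<rho> > 0" "\<And>n. n < \<rho> \<Longrightarrow> 2 * n < d \<and> 2 * n \<le> 1 \<and> C * (2 * n) \<le> \<epsilon>"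
    by (rule small_radius[OF r U \<epsilon>]) blast
  have "N ((\<lambda>s. \<phi> ((\<xi> + h) s)) - (\<lambda>s. \<phi> (\<xi> s)) - ?T h) \<le> e * N h"
    if h: "h \<in> W12_L2 i" "N h < \<rho>" for h
  proof -
    obtain g' where rh: "repr i h g' (\<lambda>s. inv i (h s))" by (rule W12_L2_imp_repr[OF h(1)])
    define n where "n = N h"
    have n: "n \<ge> 0" by (simp add: n_def W12_L2_norm_nonneg)
    have sm: "2 * n < d" "2 * n \<le> 1" "C * (2 * n) \<le> \<epsilon>" using \<rho>(2)[OF h(2)] by (auto simp: n_def)
    have bd: "(N ((\<lambda>s. \<phi> ((\<xi> + h) s)) - (\<lambda>s. \<phi> (\<xi> s)) - ?T h))\<^sup>2
      \<le> 3 * ((2 * n * (\<epsilon> + C * (2 * n)))\<^sup>2 * (N \<xi>)\<^sup>2 + (3 * C * (2 * n))\<^sup>2 * n\<^sup>2)"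
      unfolding n_def
      by (rule remainder_bound[OF r U V rh B E refl]) (use sm in \<open>auto simp: n_def\<close>)
    show ?thesis
      unfolding n_def[symmetric]
    proof (rule norm_le_of_square_bound[OF _ M n e \<epsilon>_def, where c=0])
      show "(N ((\<lambda>s. \<phi> ((\<xi> + h) s)) - (\<lambda>s. \<phi> (\<xi> s)) - ?T h))\<^sup>2
        \<le> 3 * ((2 * n * (\<epsilon> + C * (2 * n)))\<^sup>2 * (N \<xi>)\<^sup>2 + (3 * n * (C * (2 * n)))\<^sup>2 + 0\<^sup>2)"
        using bd by (simp add: power_mult_distrib mult_ac)
      show "2 * n * (\<epsilon> + C * (2 * n)) \<le> 4 * n * \<epsilon>"
        using mult_left_mono[OF sm(3), of "2 * n"] n by (simp add: algebra_simps)
      show "3 * n * (C * (2 * n)) \<le> 3 * n * \<epsilon>"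
        by (intro mult_left_mono sm) (use n in simp)
    qed (use n C \<epsilon> in auto)
  qed
  then show "\<exists>d>0. \<forall>h\<in>W12_L2 i. N h < d \<longrightarrow>
      N ((\<lambda>s. \<phi> ((\<xi> + h) s)) - (\<lambda>s. \<phi> (\<xi> s)) - ?T h) \<le> e * N h"
    using \<rho>(1) by blast
qed

lemma derivative_superposition_continuous:
  assumes "\<xi> \<in> domain" and e: "e > 0"
  shows "\<exists>d>0. \<forall>\<eta>\<in>domain. N (\<eta> - \<xi>) < d \<longrightarrow>
    (\<forall>h\<in>W12_L2 i. N ((\<lambda>s. d\<phi> (\<eta> s) (h s)) - (\<lambda>s. d\<phi> (\<xi> s) (h s))) \<le> e * N h)"
proof -
  obtain g y where r: "repr i \<xi> g y" and V: "\<And>s. i (y s) \<in> U" and U: "\<And>s. \<xi> s \<in> U"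
    using domain_repr[OF assms(1)] by metis
  define \<epsilon> where "\<epsilon> = e / (7 * (N \<xi> + 1))"
  have M: "N \<xi> \<ge> 0" by (rule W12_L2_norm_nonneg)
  have \<epsilon>: "\<epsilon> > 0" using e M by (simp add: \<epsilon>_def)
  obtain d C \<rho> where C: "C > 0" and B: "\<And>s z. dist (\<xi> s) z < d \<Longrightarrow> bounds C z"
    and E: "\<And>s z. dist (\<xi> s) z < d \<Longrightarrow> z \<in> U \<and> norm (dd\<phi> z - dd\<phi> (\<xi> s)) \<le> \<epsilon>"
    and \<rho>: "\<rho> > 0" "\<And>n. n < \<rho> \<Longrightarrow> 2 * n < d \<and> 2 * n \<le> 1 \<and> C * (2 * n) \<le> \<epsilon>"
    by (rule small_radius[OF r U \<epsilon>]) blast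
  have "N ((\<lambda>s. d\<phi> (\<eta> s) (h s)) - (\<lambda>s. d\<phi> (\<xi> s) (h s))) \<le> e * N h"
    if \<eta>: "\<eta> \<in> domain" "N (\<eta> - \<xi>) < \<rho>" and h: "h \<in> W12_L2 i" for \<eta> h
  proof -
    obtain g1 y1 where r1: "repr i \<eta> g1 y1" using domain_repr[OF \<eta>(1)] by metis
    obtain g' where rh: "repr i h g' (\<lambda>s. inv i (h s))" by (rule W12_L2_imp_repr[OF h])
    note rw = repr_diff[OF incl r1 r]
    define n where "n = N h"
    define p where "p = N (\<eta> - \<xi>)"
    have n: "n \<ge> 0" and p: "p \<ge> 0" by (auto simp: n_def p_def W12_L2_norm_nonneg)
    have sm: "2 * p < d" "2 * p \<le> 1" "C * (2 * p) \<le> \<epsilon>" using \<rho>(2)[OF \<eta>(2)] by (auto simp: p_def)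
    have "\<xi> + (\<eta> - \<xi>) = \<eta>" by simp
    then have bd: "(N ((\<lambda>s. d\<phi> (\<eta> s) (h s)) - (\<lambda>s. d\<phi> (\<xi> s) (h s))))\<^sup>2
      \<le> 3 * ((2 * n * (\<epsilon> + C * (2 * p)))\<^sup>2 * (N \<xi>)\<^sup>2 + (2 * C * (2 * n))\<^sup>2 * p\<^sup>2 + (C * (2 * p))\<^sup>2 * n\<^sup>2)"
      using derivative_increment_bound[OF r U V rw rh B E refl refl] sm unfolding n_def p_def by simp
    show ?thesis
      unfolding n_def[symmetric]
    proof (rule norm_le_of_square_bound[OF _ M n e \<epsilon>_def])
      \<comment> \<open>In the middle term a factor 2 passes from the supremum bound of
        \<open>h\<close> to that of \<open>\<eta> - \<xi>\<close>, so that
        \<open>C * (2 * p) \<le> \<epsilon>\<close> applies there as well.\<close>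
      show "(N ((\<lambda>s. d\<phi> (\<eta> s) (h s)) - (\<lambda>s. d\<phi> (\<xi> s) (h s))))\<^sup>2
        \<le> 3 * ((2 * n * (\<epsilon> + C * (2 * p)))\<^sup>2 * (N \<xi>)\<^sup>2 + (2 * n * (C * (2 * p)))\<^sup>2 + (n * (C * (2 * p)))\<^sup>2)"
        using bd by (simp add: power_mult_distrib mult_ac)
      show "2 * n * (\<epsilon> + C * (2 * p)) \<le> 4 * n * \<epsilon>"
        using mult_left_mono[OF sm(3), of "2 * n"] n by (simp add: algebra_simps)
      show "2 * n * (C * (2 * p)) \<le> 3 * n * \<epsilon>" "n * (C * (2 * p)) \<le> 2 * n * \<epsilon>"
        using mult_left_mono[OF sm(3) n] mult_nonneg_nonneg[OF n less_imp_le[OF \<epsilon>]] by linarith+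
    qed (use n p C \<epsilon> in auto)
  qed
  then show ?thesis using \<rho>(1) by blast
qed

end

theorem theorem3p1:
  fixes i :: "'h2::{real_inner,complete_space,second_countable_topology} \<Rightarrow>
              'h1::{real_inner,complete_space,second_countable_topology}"
    and U1 :: "'h1 set"
    and \<phi> :: "'h1 \<Rightarrow> 'h1"
  assumes "dense_inclusion i"
    and "open U1"
    and "tame i U1 \<phi>"
    and "0 \<in> U1"
    and "\<phi> 0 = 0"
  shows "let \<U> = {\<xi> \<in> W12_L2 i. \<forall>s. \<xi> s \<in> U1};
             \<Phi> = (\<lambda>\<xi> s. \<phi> (\<xi> s))
         in \<Phi> ` \<U> \<subseteq> W12_L2 i \<and>
            continuously_differentiable_on (W12_L2 i) (W12_L2_norm i) \<U> \<Phi>"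
proof -
  obtain d\<phi> dd\<phi> where C2: "C2_with U1 \<phi> d\<phi> dd\<phi>"
    using assms(3) by (auto simp: tame_def)
  have range: "\<phi> ` (U1 \<inter> range i) \<subseteq> range i"
    using assms(3) by (simp add: tame_def)
  obtain d\<psi> dd\<psi> where C2': "C2_with (i -` U1) (\<lambda>y. inv i (\<phi> (i y))) d\<psi> dd\<psi>"
    and tame: "\<forall>x\<in>U1. \<exists>W \<kappa>. open W \<and> x \<in> W \<and> W \<subseteq> U1 \<and> \<kappa> > 0 \<and>
         (\<forall>y v w. i y \<in> W \<longrightarrow> norm (dd\<psi> y v w) \<le>
             \<kappa> * (norm (i v) * norm w + norm v * norm (i w) + norm y * norm (i v) * norm (i w)))"
    using assms(3) unfolding tame_def by blast
  interpret tame_setup i U1 \<phi> d\<phi> dd\<phi> "\<lambda>y. inv i (\<phi> (i y))" d\<psi> dd\<psi>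
  proof
    show "i (inv i (\<phi> (i y))) = \<phi> (i y)" if "i y \<in> U1" for y
      using range that by (intro f_inv_into_f) auto
  qed (use assms C2 C2' tame in auto)
  let ?dF = "\<lambda>\<xi> h s. d\<phi> (\<xi> s) (h s)"
  have "continuously_differentiable_on (W12_L2 i) (W12_L2_norm i) domain (\<lambda>\<xi> s. \<phi> (\<xi> s))"
    unfolding continuously_differentiable_on_def
    using open_domain frechet_derivative_superposition derivative_superposition_continuous
    by (intro conjI exI[of _ ?dF]) auto
  moreover have "(\<lambda>\<xi> s. \<phi> (\<xi> s)) ` domain \<subseteq> W12_L2 i"
    using superposition_in_W12_L2 by auto
  ultimately show ?thesis
    by (simp add: Let_def domain_def)
qed

end
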